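(* Let $j$ be an integer with $2\le j\le n$. For any given polynomial $f\in\mathbb Z[x_1,\dots,x_n]$ and any open connected set $U\subset\mathbb R^{j-1}$ defined by $\mathrm{Np}(f,[x_n,\dots,x_j])\ne0$, let $$S=U\setminus\mathrm{Zero}\big(\{\mathrm{Np}(f,[x_n,\dots,x_j],x_t)\mid t=j,\dots,n\}\big).$$ If the polynomials in $\bigcup_{i=0}^{n-j}\mathrm{Np}_1(f,[x_{n-i}])$ are all semi-definite on $U\times\mathbb R^{n-j}$, then $f$ is open delineable on $S$ with respect to $\overline{\mathrm{Np}}(f,j)$ and $\widetilde{\mathrm{Np}}(f,j)$.
   Context: Notation: $\mathbf x_k=(x_1,\dots,x_k)$. For a set of polynomials, $\mathrm{Zero}$ denotes its set of common real zeros. "An open connected set defined by $h\ne0$" in $\mathbb R^k$ means a maximal one, i.e. a connected component of $\{h\neq0\}\subset\mathbb R^k$. A polynomial is semi-definite on a set if it is everywhere $\ge0$ or everywhere $\le0$ there. The polynomials in $\mathrm{Np}_1(f,[x_{n-i}])$ below do not involve $x_{n-i}$; the factor $\mathbb R^{n-j}$ in $U\times\mathbb R^{n-j}$ carries the variables among $x_j,\dots,x_n$ other than $x_{n-i}$. Factorization: write a nonconstant $h\in\mathbb Z[\mathbf x_n]$ as $h=a\,l_1^{2j_1-1}\cdots l_t^{2j_t-1}h_1^{2i_1}\cdots h_m^{2i_m}$ with $a\in\mathbb Z$ and $l_1,\dots,l_t,h_1,\dots,h_m$ pairwise distinct irreducible primitive polynomials of positive degree with positive leading coefficient (under a suitable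 ordering). Then $\mathrm{sqrf}(h)=l_1\cdots l_th_1\cdots h_m$, $\mathrm{sqrf}_1(h)=\{l_1,\dots,l_t\}$, $\mathrm{sqrf}_2(h)=\{h_1,\dots,h_m\}$. If $h$ is constant, $\mathrm{sqrf}(h)=1$ and $\mathrm{sqrf}_1(h)=\mathrm{sqrf}_2(h)=\{1\}$. Brown projection: if $\deg(h,y)>0$ then $\mathrm{Bp}(h,[y])=\mathrm{Res}(\mathrm{sqrf}(h),\partial\,\mathrm{sqrf}(h)/\partial y,y)$ (Sylvester resultant); otherwise $\mathrm{Bp}(h,[y])=h$. Operator $\mathrm{Np}$ (introduced for $f\in\mathbb Z[\mathbf x_n]$ of level $n$, i.e. with $\deg(f,x_n)>0$): for a variable $x$ among $x_1,\dots,x_n$, let $\mathrm{lc}(f,x)$ and $\mathrm{discrim}(f,x)$ be the leading coefficient and the discriminant of $f$ with respect to $x$, and set $\mathrm{Ocd}(f,x)=\mathrm{sqrf}_1(\mathrm{lc}(f,x))\cup\mathrm{sqrf}_1(\mathrm{discrim}(f,x))$, $\mathrm{Ecd}(f,x)=\mathrm{sqrf}_2(\mathrm{lc}(f,x))\cup\mathrm{sqrf}_2(\mathrm{discrim}(f,x))$, $\mathrm{Np}_1(f,[x])=\mathrm{Ocd}(f,x)$. Further, $$\mathrm{Np}(f,[x])=\prod_{g\in\mathrm{Ecd}(f,x)\setminus\mathrm{Ocd}(f,x)}g,\qquad \mathrm{Np}(f,[x],x)=\prod_{g\in\mathrm{Np}_1(f,[x])}g$$ (empty products equal $1$). For a list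 $[\mathbf y]=[y_1,\dots,y_m]$ of $m\ge2$ distinct variables among $x_1,\dots,x_n$ and $1\le i\le m$, recursively $$\mathrm{Np}(f,[\mathbf y],y_i)=\mathrm{Bp}\big(\mathrm{Np}(f,[y_1,\dots,y_{i-1},y_{i+1},\dots,y_m]),[y_i]\big),$$ $$\mathrm{Np}(f,[\mathbf y])=\gcd\big(\mathrm{Np}(f,[\mathbf y],y_1),\dots,\mathrm{Np}(f,[\mathbf y],y_m)\big).$$ Set (as ordered lists, whose entries are polynomials in $\mathbf x_n,\mathbf x_{n-1},\dots,\mathbf x_{j-1}$ respectively) $\overline{\mathrm{Np}}(f,j)=[f,\mathrm{Np}(f,[x_n]),\dots,\mathrm{Np}(f,[x_n,\dots,x_j])]$ and $\widetilde{\mathrm{Np}}(f,j)=[f,\mathrm{Np}(f,[x_n],x_n),\dots,\mathrm{Np}(f,[x_n,\dots,x_j],x_j)]$. Open sample: a set $T\subseteq\mathbb R^k$ is an open sample defined by $h$ if $T$ meets every open connected set defined by $h\ne0$ in $\mathbb R^k$. $T_{h,g\neq0}$ denotes an open sample defined by $h$ such that moreover $g(\alpha)\ne0$ for all $\alpha\in T_{h,g\ne0}$. OpenSP: given lists $L_1=[f_n(\mathbf x_n),\dots,f_l(\mathbf x_l)]$, $L_2=[g_n(\mathbf x_n),\dots,g_l(\mathbf x_l)]$ and a set $T\subset\mathbb R^l$, an output of $\mathtt{OpenSP}(L_1,L_2,T)$ is any set obtained as follows: $O_l=T$; for $i=l+1,\dots,n$, choose for each $\alpha\in O_{i-1}$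 a univariate open sample $T_\alpha=T_{f_i(\alpha,x_i),\,g_i(\alpha,x_i)\neq0}\subset\mathbb R$ and put $O_i=\bigcup_{\alpha\in O_{i-1}}\{\alpha\}\times T_\alpha$; the output is $O_n$. Open delineable: let $L_1=[f_n(\mathbf x_n),\dots,f_l(\mathbf x_l)]$, $L_2=[g_n(\mathbf x_n),\dots,g_l(\mathbf x_l)]$, $S$ an open set of $\mathbb R^s$ with $s\le l$, and $S'=S\times\mathbb R^{l-s}$. $f_n$ is open delineable on $S$ w.r.t. $L_1$ and $L_2$ if for every maximal open connected set $V\subset\mathbb R^n$ defined by $f_n\ne0$ with $V\cap(S'\times\mathbb R^{n-l})\neq\emptyset$, every $\alpha\in S'$ with $f_l(\alpha)g_l(\alpha)\neq0$, and every output $\mathcal A$ of $\mathtt{OpenSP}(L_1,L_2,\{\alpha\})$, one has $\mathcal A\cap V\ne\emptyset$.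
   Formalization: Assumes additionally that discrim(f,x_t) is not the zero polynomial for t=j,…,n (no repeated factor of f involves x_j,…,x_n); otherwise the claim is false, e.g. n=j=2, f=(x_2^2-x_1)^2. *)

theory Defs
  imports
    "HOL-Analysis.Analysis"
    "HOL-Library.Poly_Mapping"
    "Subresultants.Resultant_Prelim"
begin

section \<open>Integer polynomials in several variables\<close>

text \<open>
  Exponent vectors are finitely supported maps from variables to exponents.  The variable
  \<open>x\<^sub>i\<close> (\<open>i \<ge> 1\<close>) is the natural number \<open>i - 1\<close>, so that it matches the coordinate \<open>i - 1\<close> of the
  points of \<^const>\<open>Euclidean_space\<close>; the ring in \<open>x\<^sub>1, \<dots>, x\<^sub>n\<close> consists of the \<open>f\<close> with
  \<open>mvars f \<subseteq> {..<n}\<close>.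
\<close>

type_synonym mpoly = "(nat \<Rightarrow>\<^sub>0 nat) \<Rightarrow>\<^sub>0 int"

definition mvars :: "mpoly \<Rightarrow> nat set" where
  "mvars f = (\<Union>m\<in>Poly_Mapping.keys f. Poly_Mapping.keys m)"

definition mconst :: "mpoly \<Rightarrow> bool" where
  "mconst f \<longleftrightarrow> mvars f = {}"

definition meval :: "(nat \<Rightarrow> real) \<Rightarrow> mpoly \<Rightarrow> real" where
  "meval a f = (\<Sum>m\<in>Poly_Mapping.keys f. of_int (Poly_Mapping.lookup f m) *
                 (\<Prod>i\<in>Poly_Mapping.keys m. a i ^ Poly_Mapping.lookup m i))"

text \<open>\<open>f\<close> as a univariate polynomial in \<open>x\<close> whose coefficients do not involve \<open>x\<close>.\<close>

definition as_poly :: "nat \<Rightarrow> mpoly \<Rightarrow> mpoly poly" where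
  "as_poly x f = (\<Sum>m\<in>Poly_Mapping.keys f.
      monom (Poly_Mapping.single (Poly_Mapping.update x 0 m) (Poly_Mapping.lookup f m))
            (Poly_Mapping.lookup m x))"

definition mdeg :: "mpoly \<Rightarrow> nat \<Rightarrow> nat" where
  "mdeg f x = degree (as_poly x f)"

definition lc :: "mpoly \<Rightarrow> nat \<Rightarrow> mpoly" where
  "lc f x = lead_coeff (as_poly x f)"

text \<open>
  The discriminant is determined by
  \<open>Res(f, \<partial>f/\<partial>x, x) = (-1)\<^bsup>d(d-1)/2\<^esup> lc(f,x) discrim(f,x)\<close> with \<open>d = deg(f,x) > 0\<close>.  The value for
  \<open>d = 0\<close> is a convention.
\<close>

definition discrim :: "mpoly \<Rightarrow> nat \<Rightarrow> mpoly" where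
  "discrim f x = (if mdeg f x = 0 then 1 else
     (THE D. resultant (as_poly x f) (pderiv (as_poly x f)) =
             (-1) ^ (mdeg f x * (mdeg f x - 1) div 2) * lc f x * D))"

text \<open>Integer leading coefficient for the (lexicographic) linear order on exponent vectors.\<close>

definition head_coeff :: "mpoly \<Rightarrow> int" where
  "head_coeff f = (if f = 0 then 0 else Poly_Mapping.lookup f (Max (Poly_Mapping.keys f)))"

definition mprimitive :: "mpoly \<Rightarrow> bool" where
  "mprimitive f \<longleftrightarrow> (GCD m\<in>Poly_Mapping.keys f. Poly_Mapping.lookup f m) = 1"

text \<open>The greatest common divisor in the polynomial ring over the integers, with the sign normalised.\<close>

definition mgcd :: "mpoly set \<Rightarrow> mpoly" where
  "mgcd A = (THE g. (\<forall>a\<in>A. g dvd a) \<and> (\<forall>d. (\<forall>a\<in>A. d dvd a) \<longrightarrow> d dvd g) \<and>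
                    (g = 0 \<or> head_coeff g > 0))"


section \<open>Squarefree parts and projection operators\<close>

text \<open>\<open>h = a \<cdot> \<Prod>\<^sub>p\<^sub>\<in>\<^sub>F p\<^bsup>e p\<^esup>\<close> is the irreducible factorisation of \<open>h\<close>.\<close>

definition factorization :: "mpoly \<Rightarrow> int \<Rightarrow> mpoly set \<Rightarrow> (mpoly \<Rightarrow> nat) \<Rightarrow> bool" where
  "factorization h a F e \<longleftrightarrow> finite F \<and>
     (\<forall>p\<in>F. irreducible p \<and> mprimitive p \<and> \<not> mconst p \<and> head_coeff p > 0 \<and> e p > 0) \<and>
     h = of_int a * (\<Prod>p\<in>F. p ^ e p)"

definition sqrf1 :: "mpoly \<Rightarrow> mpoly set" where
  "sqrf1 h = (if mconst h then {1} else {p. \<exists>a F e. factorization h a F e \<and> p \<in> F \<and> odd (e p)})"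

definition sqrf2 :: "mpoly \<Rightarrow> mpoly set" where
  "sqrf2 h = (if mconst h then {1} else {p. \<exists>a F e. factorization h a F e \<and> p \<in> F \<and> even (e p)})"

definition sqrf :: "mpoly \<Rightarrow> mpoly" where
  "sqrf h = (if mconst h then 1 else \<Prod>(sqrf1 h) * \<Prod>(sqrf2 h))"

definition Bp :: "mpoly \<Rightarrow> nat \<Rightarrow> mpoly" where
  "Bp h y = (if mdeg h y > 0 then resultant (as_poly y (sqrf h)) (pderiv (as_poly y (sqrf h)))
             else h)"

definition Ocd :: "mpoly \<Rightarrow> nat \<Rightarrow> mpoly set" where
  "Ocd f x = sqrf1 (lc f x) \<union> sqrf1 (discrim f x)"

definition Ecd :: "mpoly \<Rightarrow> nat \<Rightarrow> mpoly set" where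
  "Ecd f x = sqrf2 (lc f x) \<union> sqrf2 (discrim f x)"

definition Np1 :: "mpoly \<Rightarrow> nat \<Rightarrow> mpoly set" where
  "Np1 f x = Ocd f x"

text \<open>
  \<open>Np f ys\<close> is \<open>Np(f,[ys])\<close> and \<open>Np_wrt f ys y\<close> is \<open>Np(f,[ys],y)\<close>.  They are meant for nonempty
  lists of distinct variables and \<open>y\<close> in \<open>ys\<close>; the value on the empty list is irrelevant.
\<close>

function Np :: "mpoly \<Rightarrow> nat list \<Rightarrow> mpoly" where
  "Np f [] = 1"
| "Np f [x] = \<Prod>(Ecd f x - Ocd f x)"
| "Np f (x # y # zs) =
     mgcd ((\<lambda>u. Bp (Np f (remove1 u (x # y # zs))) u) ` set (x # y # zs))"
  by pat_completeness auto
termination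
  by (relation "Wellfounded.measure (\<lambda>(f, ys). length ys)") (auto simp: length_remove1 dest: length_pos_if_in_set)

definition Np_wrt :: "mpoly \<Rightarrow> nat list \<Rightarrow> nat \<Rightarrow> mpoly" where
  "Np_wrt f ys y = (if ys = [y] then \<Prod>(Np1 f y) else Bp (Np f (remove1 y ys)) y)"

lemma Np_eq_mgcd_Np_wrt:
  assumes "length ys \<ge> 2"
  shows "Np f ys = mgcd (Np_wrt f ys ` set ys)"
proof -
  obtain x y zs where ys: "ys = x # y # zs"
    using assms by (cases ys; cases "tl ys") auto
  show ?thesis
    unfolding ys Np.simps(3) by (intro arg_cong[of _ _ mgcd] image_cong) (auto simp: Np_wrt_def)
qed

text \<open>\<open>varlist n k\<close> is \<open>[x\<^sub>n, \<dots>, x\<^sub>k]\<close>, for \<open>1 \<le> k \<le> n\<close>.\<close>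

definition varlist :: "nat \<Rightarrow> nat \<Rightarrow> nat list" where
  "varlist n k = rev [k - 1..<n]"

definition Np_bar :: "nat \<Rightarrow> mpoly \<Rightarrow> nat \<Rightarrow> mpoly list" where
  "Np_bar n f j = f # map (\<lambda>k. Np f (varlist n k)) (rev [j..<n + 1])"

definition Np_tilde :: "nat \<Rightarrow> mpoly \<Rightarrow> nat \<Rightarrow> mpoly list" where
  "Np_tilde n f j = f # map (\<lambda>k. Np_wrt f (varlist n k) (k - 1)) (rev [j..<n + 1])"


section \<open>Open samples and open delineability\<close>

text \<open>
  Points of the \<open>k\<close>-dimensional space are functions vanishing from index \<open>k\<close> on, so
  \<open>\<alpha>(k := x)\<close> is the point \<open>(\<alpha>, x)\<close> one dimension higher.
\<close>

text \<open>The maximal open connected sets defined by \<open>h \<noteq> 0\<close>.\<close>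

definition open_cells :: "'a topology \<Rightarrow> ('a \<Rightarrow> real) \<Rightarrow> 'a set set" where
  "open_cells X h = connected_components_of (subtopology X {a. h a \<noteq> 0})"

definition open_sample :: "'a topology \<Rightarrow> ('a \<Rightarrow> real) \<Rightarrow> 'a set \<Rightarrow> bool" where
  "open_sample X h T \<longleftrightarrow> T \<subseteq> topspace X \<and> (\<forall>C\<in>open_cells X h. T \<inter> C \<noteq> {})"

definition open_sample_nz :: "'a topology \<Rightarrow> ('a \<Rightarrow> real) \<Rightarrow> ('a \<Rightarrow> real) \<Rightarrow> 'a set \<Rightarrow> bool" where
  "open_sample_nz X h g T \<longleftrightarrow> open_sample X h T \<and> (\<forall>a\<in>T. g a \<noteq> 0)"

text \<open>
  \<open>OpenSP l T L1 L2 A\<close>: the set \<open>A\<close> is an output for the lists \<open>L1 = [f\<^sub>n, \<dots>, f\<^sub>l]\<close>,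
  \<open>L2 = [g\<^sub>n, \<dots>, g\<^sub>l]\<close> and the set \<open>T\<close> in dimension \<open>l\<close>.  In the step rule \<open>L1\<close> ends at \<open>f\<^sub>k\<close>
  with \<open>k = l + length L1 - 1\<close>, and \<open>x\<^sub>k\<^sub>+\<^sub>1\<close> is the variable \<open>k\<close>.
\<close>

inductive OpenSP ::
  "nat \<Rightarrow> (nat \<Rightarrow> real) set \<Rightarrow> mpoly list \<Rightarrow> mpoly list \<Rightarrow> (nat \<Rightarrow> real) set \<Rightarrow> bool"
  for l T where
  base: "OpenSP l T [p] [q] T"
| step: "OpenSP l T L1 L2 B \<Longrightarrow> k = l + length L1 - 1 \<Longrightarrow>
    (\<And>\<alpha>. \<alpha> \<in> B \<Longrightarrow> open_sample_nz euclideanreal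
        (\<lambda>x. meval (\<alpha>(k := x)) p) (\<lambda>x. meval (\<alpha>(k := x)) q) (Tf \<alpha>)) \<Longrightarrow>
    OpenSP l T (p # L1) (q # L2) (\<Union>\<alpha>\<in>B. (\<lambda>x. \<alpha>(k := x)) ` Tf \<alpha>)"

text \<open>\<open>cyl s m S\<close> is \<open>S \<times> \<real>\<^bsup>m-s\<^esup>\<close>, for a set \<open>S\<close> in dimension \<open>s \<le> m\<close>.\<close>

definition cyl :: "nat \<Rightarrow> nat \<Rightarrow> (nat \<Rightarrow> real) set \<Rightarrow> (nat \<Rightarrow> real) set" where
  "cyl s m S = {a \<in> topspace (Euclidean_space m). (\<lambda>i. if i < s then a i else 0) \<in> S}"

definition open_delineable ::
  "nat \<Rightarrow> nat \<Rightarrow> nat \<Rightarrow> mpoly \<Rightarrow> (nat \<Rightarrow> real) set \<Rightarrow> mpoly list \<Rightarrow> mpoly list \<Rightarrow> bool" where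
  "open_delineable n l s f S L1 L2 \<longleftrightarrow>
     s \<le> l \<and> l \<le> n \<and> length L1 = n - l + 1 \<and> length L2 = n - l + 1 \<and> hd L1 = f \<and>
     openin (Euclidean_space s) S \<and>
     (\<forall>V \<in> open_cells (Euclidean_space n) (\<lambda>a. meval a f).
        V \<inter> cyl l n (cyl s l S) \<noteq> {} \<longrightarrow>
        (\<forall>\<alpha> \<in> cyl s l S. meval \<alpha> (last L1) * meval \<alpha> (last L2) \<noteq> 0 \<longrightarrow>
           (\<forall>A. OpenSP l {\<alpha>} L1 L2 A \<longrightarrow> A \<inter> V \<noteq> {})))"

definition Zeros :: "mpoly set \<Rightarrow> (nat \<Rightarrow> real) set" where
  "Zeros P = {a. \<forall>p\<in>P. meval a p = 0}"

definition semidefinite_on :: "mpoly \<Rightarrow> (nat \<Rightarrow> real) set \<Rightarrow> bool" where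
  "semidefinite_on p A \<longleftrightarrow> (\<forall>a\<in>A. meval a p \<ge> 0) \<or> (\<forall>a\<in>A. meval a p \<le> 0)"

end

theory Submission
  imports Defs "HOL-Computational_Algebra.Field_as_Ring" "Subresultants.Subresultant_Gcd"
begin

text \<open>
  Points of \<open>\<real>\<^sup>n\<close> are embedded in the space of all real sequences, where projecting along a set of
  variables becomes working with open sets that are cylindrical in these variables.

  Two facts make a region \<open>U\<close> stay connected after removal of the zeros that the statement removes.
  The common zeros of polynomials without common factor have codimension at least two; this applies
  to the quotients of the \<open>Np(f,[ys],y)\<close> by their gcd.  And an irreducible \<open>l\<close> that is semi-definite on
  \<open>U\<close> vanishes there only together with its partial derivatives, so its zeros in \<open>U\<close> are common
  zeros of the coprime polynomials \<open>l\<close> and \<open>\<partial>l/\<partial>x\<close>.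

  Near a point where \<open>Np(f,[ys],y)\<close> does not vanish, \<open>Np(f,[ys - y])\<close> has, as a polynomial in \<open>y\<close>,
  nonzero leading coefficient and simple roots, so each sector of its complement projects onto the
  whole neighbourhood.  By induction on \<open>ys\<close> the set of points of \<open>U\<close> that are approximated by the projection
  of a cell \<open>V\<close> of \<open>f \<noteq> 0\<close> is closed and open in the connected set that is left of \<open>U\<close>: the
  projection of \<open>V\<close> is empty or dense in \<open>U\<close>.  Hence, at each step of the sampling, some sector over the current
  sample point still meets \<open>V\<close>, and the open sample contains a point of that sector.
\<close>

section \<open>Multivariate polynomials as univariate ones\<close>

text \<open>The obstacle is that \<open>Np f ys\<close> is a gcd: where it does not vanish, some
  \<open>Np_wrt f ys y\<close> may still vanish, and which \<open>y\<close> is usable changes from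
  point to point. So the density argument cannot follow the order [x_n, ..., x_j]; it is proved for
  arbitrary distinct lists, removing at each point a variable that is usable there. This is why
  regions are cylindrical in arbitrary sets of variables. The sampling, in contrast, has a fixed
  order; there the polynomials of the second list, nonzero at every sample point, provide regularity
  in the variable that comes next.

  The algebra needed is primality of irreducibles, first for unique factorisation and gcds, then for
  elimination: the ideal of coprime polynomials contains a nonzero polynomial free of a given
  variable. Elimination yields both the thinness of common zeros and the nonvanishing of the
  resultants in \<open>Bp\<close>. Pseudo-division takes the place of fraction fields.\<close>

lemma mpoly_induct [case_names zero add]:
  fixes f :: mpoly
  assumes "P 0" "\<And>m c f. P f \<Longrightarrow> P (Poly_Mapping.single m c + f)"
  shows "P f"
proof (induction f rule: Poly_Mapping.update_induct)
  case (update f a b)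
  have "Poly_Mapping.update a b f = Poly_Mapping.single a b + f"
    using update(1)
    by (intro poly_mapping_eqI) (auto simp: lookup_update lookup_add lookup_single not_in_keys_iff_lookup_eq_zero when_def)
  then show ?case using assms(2) update by simp
qed (rule assms(1))

lemma mpoly_hom_mult:
  fixes \<phi> :: "mpoly \<Rightarrow> 'b::comm_ring_1"
  assumes add: "\<And>f g. \<phi> (f + g) = \<phi> f + \<phi> g"
    and mult: "\<And>m c m' c'. \<phi> (Poly_Mapping.single m c * Poly_Mapping.single m' c') =
      \<phi> (Poly_Mapping.single m c) * \<phi> (Poly_Mapping.single m' c')"
  shows "\<phi> (f * g) = \<phi> f * \<phi> g"
proof -
  have zero: "\<phi> 0 = 0" using add[of 0 0] by simp
  have 1: "\<phi> (Poly_Mapping.single m c * g) = \<phi> (Poly_Mapping.single m c) * \<phi> g" for m c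
    by (induction g rule: mpoly_induct) (auto simp: zero add mult distrib_left)
  show ?thesis
    by (induction f rule: mpoly_induct) (auto simp: zero add 1 distrib_right)
qed

text \<open>Erasing the exponent of x is injective on the monomials of a given x-degree, with
  inverse \<open>update x i\<close>, so each entry comes from a single term of f.\<close>

lemma lookup_coeff_as_poly:
  "Poly_Mapping.lookup (coeff (as_poly x f) i) m =
    (if Poly_Mapping.lookup m x = 0 then Poly_Mapping.lookup f (Poly_Mapping.update x i m) else 0)"
proof -
  have eq: "(Poly_Mapping.lookup m' x = i \<and> Poly_Mapping.update x 0 m' = m) \<longleftrightarrow>
      (Poly_Mapping.lookup m x = 0 \<and> m' = Poly_Mapping.update x i m)" for m'
    by (auto simp: poly_mapping_eq_iff fun_eq_iff lookup_update split: if_splits)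
  have "Poly_Mapping.lookup (coeff (as_poly x f) i) m =
      (\<Sum>m'\<in>Poly_Mapping.keys f. if Poly_Mapping.lookup m' x = i \<and> Poly_Mapping.update x 0 m' = m
        then Poly_Mapping.lookup f m' else 0)"
    unfolding as_poly_def coeff_sum lookup_sum
    by (intro sum.cong) (auto simp: lookup_single when_def)
  also have "\<dots> = (\<Sum>m'\<in>Poly_Mapping.keys f. if m' = Poly_Mapping.update x i m
        then (if Poly_Mapping.lookup m x = 0 then Poly_Mapping.lookup f m' else 0) else 0)"
    unfolding eq by (intro sum.cong) auto
  also have "\<dots> = (if Poly_Mapping.lookup m x = 0 then Poly_Mapping.lookup f (Poly_Mapping.update x i m) else 0)"
    by (simp add: not_in_keys_iff_lookup_eq_zero)
  finally show ?thesis .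
qed

lemma as_poly_add: "as_poly x (f + g) = as_poly x f + as_poly x g"
  by (intro poly_eqI poly_mapping_eqI) (simp add: lookup_coeff_as_poly lookup_add)

lemma as_poly_single:
  "as_poly x (Poly_Mapping.single m c) =
    monom (Poly_Mapping.single (Poly_Mapping.update x 0 m) c) (Poly_Mapping.lookup m x)"
  by (cases "c = 0") (auto simp: as_poly_def)

lemma update_zero_add: "Poly_Mapping.update x (0::nat) (m + m') = Poly_Mapping.update x 0 m + Poly_Mapping.update x 0 m'"
  by (intro poly_mapping_eqI) (auto simp: lookup_update lookup_add)

lemma as_poly_mult: "as_poly x (f * g) = as_poly x f * as_poly x g"
  by (rule mpoly_hom_mult[of "as_poly x"])
    (simp_all add: as_poly_add mult_single as_poly_single mult_monom update_zero_add lookup_add)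

lemma as_poly_const: "as_poly x (Poly_Mapping.single 0 c) = [:Poly_Mapping.single 0 c:]"
proof -
  have "Poly_Mapping.update x (0::nat) 0 = 0" by (intro poly_mapping_eqI) (auto simp: lookup_update)
  then show ?thesis by (simp add: as_poly_single monom_0)
qed

interpretation as_poly: comm_ring_hom "as_poly x" for x
proof
  show "as_poly x 1 = 1" using as_poly_const[of x 1] by simp
qed (simp_all add: as_poly_add as_poly_mult, simp add: as_poly_def)

definition mvar :: "nat \<Rightarrow> mpoly" where
  "mvar x = Poly_Mapping.single (Poly_Mapping.single x 1) 1"

lemma mvar_power: "mvar x ^ k = Poly_Mapping.single (Poly_Mapping.single x k) 1"
proof (induction k)
  case 0
  show ?case by (simp only: power_0 single_zero single_one)
next
  case (Suc k)
  have "Poly_Mapping.single x 1 + Poly_Mapping.single x k = Poly_Mapping.single x (Suc k)"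
    by (simp only: single_add[symmetric]) simp
  then show ?case
    unfolding power_Suc Suc by (simp only: mvar_def mult_single mult_1_left)
qed

lemma poly_as_poly_mvar: "poly (as_poly x f) (mvar x) = f"
proof (induction f rule: mpoly_induct)
  case (add m c f)
  have "Poly_Mapping.update x 0 m + Poly_Mapping.single x (Poly_Mapping.lookup m x) = m"
    by (intro poly_mapping_eqI) (auto simp: lookup_update lookup_add lookup_single)
  then show ?case using add
    by (simp add: as_poly_add as_poly_single poly_monom mvar_power mult_single)
qed simp

lemma as_poly_eq_iff: "as_poly x f = as_poly x g \<longleftrightarrow> f = g"
  by (metis poly_as_poly_mvar)

lemma as_poly_eq_0_iff [simp]: "as_poly x f = 0 \<longleftrightarrow> f = 0"
  using as_poly_eq_iff[of x f 0] by simp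

lemma as_poly_mvar: "as_poly x (mvar x) = [:0, 1:]"
proof -
  have "Poly_Mapping.update x (0::nat) (Poly_Mapping.single x 1) = 0"
    by (intro poly_mapping_eqI) (auto simp: lookup_update lookup_single)
  then show ?thesis by (simp add: mvar_def as_poly_single monom_altdef)
qed

lemma in_mvars_iff: "x \<in> mvars f \<longleftrightarrow> (\<exists>m. Poly_Mapping.lookup f m \<noteq> 0 \<and> Poly_Mapping.lookup m x \<noteq> 0)"
  by (auto simp: mvars_def in_keys_iff)

lemma finite_mvars [simp]: "finite (mvars f)"
  by (simp add: mvars_def)

lemma not_in_mvars_iff_as_poly: "x \<notin> mvars f \<longleftrightarrow> as_poly x f = [:f:]"
proof
  assume *: "x \<notin> mvars f"
  show "as_poly x f = [:f:]"
  proof (intro poly_eqI poly_mapping_eqI)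
    fix i :: nat and m :: "nat \<Rightarrow>\<^sub>0 nat"
    have "Poly_Mapping.update x 0 m = m" if "Poly_Mapping.lookup m x = 0"
      using that by (intro poly_mapping_eqI) (auto simp: lookup_update)
    then have "Poly_Mapping.lookup (coeff [:f:] i) m = (if i = 0 then Poly_Mapping.lookup f m else 0)"
      by (cases i) auto
    moreover have "Poly_Mapping.lookup f m = 0" if "Poly_Mapping.lookup m x \<noteq> 0" for m
      using * that unfolding in_mvars_iff by blast
    ultimately show "Poly_Mapping.lookup (coeff (as_poly x f) i) m = Poly_Mapping.lookup (coeff [:f:] i) m"
      using \<open>Poly_Mapping.lookup m x = 0 \<Longrightarrow> Poly_Mapping.update x 0 m = m\<close>
      by (simp add: lookup_coeff_as_poly lookup_update)
  qed
next
  assume *: "as_poly x f = [:f:]"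
  have "Poly_Mapping.lookup f m = 0" if "Poly_Mapping.lookup m x \<noteq> 0" for m
    using lookup_coeff_as_poly[of x f 0 m] that * by simp
  then show "x \<notin> mvars f" by (auto simp: in_mvars_iff)
qed

lemma mdeg_eq_0_iff: "mdeg f x = 0 \<longleftrightarrow> x \<notin> mvars f"
proof
  assume "mdeg f x = 0"
  then obtain c where c: "as_poly x f = [:c:]" by (auto simp: mdeg_def elim: degree_eq_zeroE)
  then have "c = f" using poly_as_poly_mvar[of x f] by simp
  with c show "x \<notin> mvars f" by (simp add: not_in_mvars_iff_as_poly)
next
  assume "x \<notin> mvars f"
  then have "as_poly x f = [:f:]" by (simp only: not_in_mvars_iff_as_poly)
  then show "mdeg f x = 0" by (simp add: mdeg_def)
qed

lemma mvars_coeff_as_poly: "mvars (coeff (as_poly x f) i) \<subseteq> mvars f - {x}"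
  by (force simp: in_mvars_iff lookup_coeff_as_poly lookup_update split: if_splits)

lemma mvars_add: "mvars (f + g) \<subseteq> mvars f \<union> mvars g"
  unfolding subset_iff in_mvars_iff Un_iff lookup_add by (metis add_0)

lemma mvars_0 [simp]: "mvars 0 = {}" and mvars_single_0 [simp]: "mvars (Poly_Mapping.single 0 c) = {}"
  by (auto simp: mvars_def)

lemma mvars_of_int [simp]: "mvars (of_int c) = {}"
  using mvars_single_0[of c] by (simp del: mvars_single_0 flip: single_of_int)

lemma mvars_1 [simp]: "mvars 1 = {}"
  using mvars_of_int[of 1] by simp

lemma mvars_mult_subset: "mvars (f * g) \<subseteq> mvars f \<union> mvars g"
proof
  fix x assume "x \<in> mvars (f * g)"
  then show "x \<in> mvars f \<union> mvars g"
    by (metis UnCI add_0 as_poly_mult degree_mult_le le_zero_eq mdeg_def mdeg_eq_0_iff)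
qed

lemma mvars_mult: "f \<noteq> 0 \<Longrightarrow> g \<noteq> 0 \<Longrightarrow> mvars (f * g) = mvars f \<union> mvars g"
proof -
  assume "f \<noteq> 0" "g \<noteq> 0"
  then have "mdeg (f * g) x = mdeg f x + mdeg g x" for x
    by (simp add: mdeg_def as_poly_mult degree_mult_eq)
  then have "x \<in> mvars (f * g) \<longleftrightarrow> x \<in> mvars f \<union> mvars g" for x
    by (metis Un_iff add_is_0 mdeg_eq_0_iff)
  then show ?thesis by blast
qed

lemma mvars_dvd: "f dvd g \<Longrightarrow> g \<noteq> 0 \<Longrightarrow> mvars f \<subseteq> mvars g"
  by (auto simp: dvd_def mvars_mult)

lemma mvars_uminus [simp]: "mvars (- f) = mvars f"
  by (simp add: mvars_def)

lemma mvars_sum: "mvars (sum f A) \<subseteq> (\<Union>a\<in>A. mvars (f a))"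
proof (induction A rule: infinite_finite_induct)
  case (insert a A) then show ?case using mvars_add[of "f a" "sum f A"] by auto
qed auto

lemma mvars_prod: "mvars (prod f A) \<subseteq> (\<Union>a\<in>A. mvars (f a))"
proof (induction A rule: infinite_finite_induct)
  case (insert a A) then show ?case using mvars_mult_subset[of "f a" "prod f A"] by auto
qed auto

lemma mvars_power: "mvars (f ^ k) \<subseteq> mvars f"
  using mvars_prod[of "\<lambda>_. f" "{..<k}"] by (cases k) (auto split: if_splits)

lemma mvars_lc: "mvars (lc f x) \<subseteq> mvars f - {x}"
  unfolding lc_def by (rule mvars_coeff_as_poly)

lemma lc_eq_0_iff [simp]: "lc f x = 0 \<longleftrightarrow> f = 0"
  by (simp add: lc_def)

lemma as_poly_poly_mvar:
  assumes "\<And>i. x \<notin> mvars (coeff P i)"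
  shows "as_poly x (poly P (mvar x)) = P"
  using assms
proof (induction P)
  case (pCons a P)
  have "x \<notin> mvars a" using pCons(3)[of 0] by simp
  moreover have "x \<notin> mvars (coeff P i)" for i using pCons(3)[of "Suc i"] by simp
  ultimately show ?case using pCons.IH
    by (simp add: as_poly_add as_poly_mult as_poly_mvar not_in_mvars_iff_as_poly)
qed simp

lemma mconst_iff: "mconst f \<longleftrightarrow> (\<exists>c. f = of_int c)"
proof
  assume *: "mconst f"
  have "Poly_Mapping.keys f \<subseteq> {0}"
    using * by (auto simp: mconst_def mvars_def)
  then have "f = Poly_Mapping.single 0 (Poly_Mapping.lookup f 0)"
    by (intro poly_mapping_eqI) (auto simp: lookup_single when_def in_keys_iff)
  then show "\<exists>c. f = of_int c" by (metis of_int_eq_id id_apply single_of_int)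
qed (auto simp: mconst_def)

section \<open>Evaluation at real points and restriction to lines parallel to an axis\<close>

lemma meval_add: "meval a (f + g) = meval a f + meval a g"
  unfolding meval_def by (rule setsum_keys_plus_distrib) (simp_all add: distrib_right)

lemma meval_single:
  "meval a (Poly_Mapping.single m c) = of_int c * (\<Prod>i\<in>Poly_Mapping.keys m. a i ^ Poly_Mapping.lookup m i)"
  by (cases "c = 0") (auto simp: meval_def)

lemma prod_keys_superset:
  fixes a :: "nat \<Rightarrow> real"
  assumes "finite A" "Poly_Mapping.keys m \<subseteq> A"
  shows "(\<Prod>i\<in>Poly_Mapping.keys m. a i ^ Poly_Mapping.lookup m i) = (\<Prod>i\<in>A. a i ^ Poly_Mapping.lookup m i)"
  using assms by (intro prod.mono_neutral_left) (auto simp: in_keys_iff)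

lemma meval_mult: "meval a (f * g) = meval a f * meval a g"
proof (rule mpoly_hom_mult[of "meval a"])
  fix m m' :: "nat \<Rightarrow>\<^sub>0 nat" and c c' :: int
  let ?A = "Poly_Mapping.keys m \<union> Poly_Mapping.keys m'"
  have "Poly_Mapping.keys (m + m') \<subseteq> ?A" by (rule Poly_Mapping.keys_add)
  then have "(\<Prod>i\<in>Poly_Mapping.keys (m + m'). a i ^ Poly_Mapping.lookup (m + m') i) =
      (\<Prod>i\<in>?A. a i ^ Poly_Mapping.lookup m i * a i ^ Poly_Mapping.lookup m' i)"
    by (subst prod_keys_superset[of ?A]) (simp_all add: lookup_add power_add)
  then show "meval a (Poly_Mapping.single m c * Poly_Mapping.single m' c') =
      meval a (Poly_Mapping.single m c) * meval a (Poly_Mapping.single m' c')"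
    by (simp add: mult_single meval_single prod_keys_superset[of ?A m] prod_keys_superset[of ?A m'] prod.distrib)
qed (rule meval_add)

interpretation meval: comm_ring_hom "meval a" for a
proof
  show "meval a 1 = 1" using meval_single[of a 0 1] by simp
qed (simp_all add: meval_add meval_mult, simp add: meval_def)

lemma meval_mvar [simp]: "meval a (mvar x) = a x"
  by (simp add: mvar_def meval_single)

lemma meval_cong: "(\<And>i. i \<in> mvars f \<Longrightarrow> a i = b i) \<Longrightarrow> meval a f = meval b f"
  unfolding meval_def mvars_def
  by (intro sum.cong refl arg_cong2[of _ _ _ _ "(*)"] prod.cong arg_cong2[of _ _ _ _ "(^)"]) blast

text \<open>The restriction of f to the line through \<open>a\<close> in direction x. It is
  independent of \<open>a x\<close>, because the coefficients do not involve x.\<close>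

definition upoly :: "(nat \<Rightarrow> real) \<Rightarrow> nat \<Rightarrow> mpoly \<Rightarrow> real poly" where
  "upoly a x f = map_poly (meval a) (as_poly x f)"

lemma coeff_upoly: "coeff (upoly a x f) i = meval a (coeff (as_poly x f) i)"
  by (simp add: upoly_def coeff_map_poly)

lemma poly_upoly: "poly (upoly a x f) t = meval (a(x := t)) f"
proof -
  have "upoly a x f = upoly (a(x := t)) x f"
    by (intro poly_eqI) (use mvars_coeff_as_poly in \<open>force simp: coeff_upoly intro!: meval_cong\<close>)
  then have "poly (upoly a x f) t = poly (map_poly (meval (a(x := t))) (as_poly x f)) (meval (a(x := t)) (mvar x))"
    by (simp add: upoly_def)
  also have "\<dots> = meval (a(x := t)) (poly (as_poly x f) (mvar x))"
    by (simp only: meval.poly_map_poly)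
  finally show ?thesis by (simp add: poly_as_poly_mvar)
qed

text \<open>Induction on the number of variables: the leading coefficient in some variable has fewer
  of them, and where it is nonzero the restriction in that direction is a nonzero real
  polynomial.\<close>

lemma mpoly_nonzero_point:
  assumes "f \<noteq> 0" shows "\<exists>a. meval a f \<noteq> 0"
  using assms
proof (induction "card (mvars f)" arbitrary: f rule: less_induct)
  case (less f)
  show ?case
  proof (cases "mvars f = {}")
    case True
    then obtain c where "f = of_int c" using mconst_iff mconst_def by blast
    then show ?thesis using less by (auto simp: meval.hom_of_int)
  next
    case False
    then obtain x where x: "x \<in> mvars f" by blast
    have "card (mvars (lc f x)) < card (mvars f)"
      using x mvars_lc[of f x] by (intro psubset_card_mono) auto
    then obtain a where "meval a (lc f x) \<noteq> 0" using less by fastforce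
    then have "upoly a x f \<noteq> 0" by (metis coeff_0 coeff_upoly lc_def)
    then obtain t where "poly (upoly a x f) t \<noteq> 0" using poly_all_0_iff_0 by blast
    then show ?thesis by (auto simp: poly_upoly)
  qed
qed

lemma real_resultant_0: "resultant (f :: real poly) g = 0 \<longleftrightarrow> degree (gcd f g) \<noteq> 0"
  by (rule resultant_0_gcd)

section \<open>Unique factorisation\<close>

lemma mvars_empty_const: "mvars f \<subseteq> {} \<Longrightarrow> \<exists>c. f = of_int c"
  using mconst_iff[of f] by (auto simp: mconst_def)

lemma mpoly_unit_iff: "(u::mpoly) dvd 1 \<longleftrightarrow> u = 1 \<or> u = - 1"
proof
  assume u: "u dvd 1"
  then obtain v where v: "1 = u * v" by (auto simp: dvd_def)
  have "mvars u = {}" "mvars v = {}"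
    using mvars_dvd[of u 1] mvars_dvd[of v 1] u dvdI[of 1 v u] v by (auto simp: mult.commute)
  then obtain c d where cd: "u = of_int c" "v = of_int d"
    using mvars_empty_const by (metis order_refl)
  with v have "(of_int (c * d) :: mpoly) = of_int 1" by simp
  then have "c * d = 1" using of_int_eq_iff by blast
  then have "c = 1 \<or> c = -1" using zmult_eq_1_iff by blast
  then show "u = 1 \<or> u = -1" using cd by auto
qed auto

section \<open>Leading terms and a measure that decreases along proper divisors\<close>

lemma head_coeff_eq_0_iff [simp]: "head_coeff f = 0 \<longleftrightarrow> f = 0"
proof -
  have "Max (Poly_Mapping.keys f) \<in> Poly_Mapping.keys f" if "f \<noteq> 0"
    using that by (intro Max_in) auto
  then show ?thesis by (auto simp: head_coeff_def in_keys_iff)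
qed

lemma head_coeff_uminus: "head_coeff (- f) = - head_coeff f"
  by (simp add: head_coeff_def)

text \<open>The order on exponent vectors is compatible with addition, so the two maximal exponents
  are the only pair whose sum is \<open>m + m'\<close>; the lower parts \<open>f'\<close> and
  \<open>g'\<close> contribute nothing there.\<close>

lemma lookup_mult_Max_keys:
  fixes f g :: mpoly
  assumes "f \<noteq> 0" "g \<noteq> 0"
  defines "m \<equiv> Max (Poly_Mapping.keys f)" and "m' \<equiv> Max (Poly_Mapping.keys g)"
  shows "Poly_Mapping.lookup (f * g) (m + m') = head_coeff f * head_coeff g"
    and "\<And>k. k \<in> Poly_Mapping.keys (f * g) \<Longrightarrow> k \<le> m + m'"
proof -
  have le: "k \<le> m" if "k \<in> Poly_Mapping.keys f" for k
    using that by (auto simp: m_def)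
  have le': "k \<le> m'" if "k \<in> Poly_Mapping.keys g" for k
    using that by (auto simp: m'_def)
  show "k \<le> m + m'" if "k \<in> Poly_Mapping.keys (f * g)" for k
    using that keys_mult[of f g] le le' by (auto intro: add_mono)
  define f' where "f' = f - Poly_Mapping.single m (head_coeff f)"
  define g' where "g' = g - Poly_Mapping.single m' (head_coeff g)"
  have lt: "k < m" if "k \<in> Poly_Mapping.keys f'" for k
  proof -
    have "k \<noteq> m" "k \<in> Poly_Mapping.keys f"
      using that assms(1) by (auto simp: f'_def in_keys_iff lookup_minus lookup_single head_coeff_def m_def when_def split: if_splits)
    then show ?thesis using le by force
  qed
  have lt': "k < m'" if "k \<in> Poly_Mapping.keys g'" for k
  proof -
    have "k \<noteq> m'" "k \<in> Poly_Mapping.keys g"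
      using that assms(2) by (auto simp: g'_def in_keys_iff lookup_minus lookup_single head_coeff_def m'_def when_def split: if_splits)
    then show ?thesis using le' by force
  qed
  have eq: "f * g = Poly_Mapping.single (m + m') (head_coeff f * head_coeff g) +
      (Poly_Mapping.single m (head_coeff f) * g' + f' * g)"
    by (simp add: f'_def g'_def algebra_simps mult_single)
  have "m + m' \<notin> Poly_Mapping.keys (Poly_Mapping.single m (head_coeff f) * g')"
  proof
    assume "m + m' \<in> Poly_Mapping.keys (Poly_Mapping.single m (head_coeff f) * g')"
    then obtain a b where ab: "a \<in> Poly_Mapping.keys (Poly_Mapping.single m (head_coeff f))"
      "b \<in> Poly_Mapping.keys g'" "m + m' = a + b"
      using keys_mult by blast
    have "a = m" using ab(1) by (auto split: if_splits)
    then show False using lt'[OF ab(2)] ab(3) by simp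
  qed
  moreover have "m + m' \<notin> Poly_Mapping.keys (f' * g)"
  proof
    assume "m + m' \<in> Poly_Mapping.keys (f' * g)"
    then obtain a b where ab: "a \<in> Poly_Mapping.keys f'" "b \<in> Poly_Mapping.keys g" "m + m' = a + b"
      using keys_mult by blast
    have "a + b < m + m'" by (rule add_less_le_mono[OF lt[OF ab(1)] le'[OF ab(2)]])
    then show False using ab(3) by simp
  qed
  ultimately show "Poly_Mapping.lookup (f * g) (m + m') = head_coeff f * head_coeff g"
    by (subst eq) (simp add: lookup_add not_in_keys_iff_lookup_eq_zero)
qed

lemma head_coeff_mult: "head_coeff (f * g) = head_coeff f * head_coeff g"
proof (cases "f = 0 \<or> g = 0")
  case False
  then have nz: "f \<noteq> 0" "g \<noteq> 0" by auto
  let ?m = "Max (Poly_Mapping.keys f) + Max (Poly_Mapping.keys g)"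
  have "?m \<in> Poly_Mapping.keys (f * g)"
    using lookup_mult_Max_keys(1)[OF nz] nz by (simp add: in_keys_iff)
  then have "Max (Poly_Mapping.keys (f * g)) = ?m"
    using lookup_mult_Max_keys(2)[OF nz] by (intro Max_eqI) auto
  then show ?thesis using lookup_mult_Max_keys(1)[OF nz] nz by (simp add: head_coeff_def)
qed (auto simp: head_coeff_def)

lemma head_coeff_of_int: "head_coeff (of_int c) = c"
proof (cases "c = 0")
  case False
  then have "Poly_Mapping.keys (of_int c :: mpoly) = {0}"
    by (simp flip: single_of_int)
  with False show ?thesis by (simp add: head_coeff_def lookup_of_int)
qed (simp add: head_coeff_def)

text \<open>Under multiplication degrees add and head coefficients multiply, so a nonunit factor
  increases the measure: a nonconstant one through its degrees, a constant one through its absolute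
  value.\<close>

definition mpoly_measure :: "mpoly \<Rightarrow> nat" where
  "mpoly_measure f = (\<Sum>x\<in>mvars f. mdeg f x) + nat \<bar>head_coeff f\<bar>"

lemma mpoly_measure_mult_less:
  assumes "f \<noteq> 0" "g \<noteq> 0" "\<not> g dvd 1"
  shows "mpoly_measure f < mpoly_measure (f * g)"
proof -
  have sum: "(\<Sum>x\<in>mvars (f * g). mdeg (f * g) x) = (\<Sum>x\<in>mvars f. mdeg f x) + (\<Sum>x\<in>mvars g. mdeg g x)"
  proof -
    have "(\<Sum>x\<in>mvars (f * g). mdeg (f * g) x) = (\<Sum>x\<in>mvars f \<union> mvars g. mdeg f x + mdeg g x)"
      using assms by (simp add: mvars_mult mdeg_def as_poly_mult degree_mult_eq)
    also have "\<dots> = (\<Sum>x\<in>mvars f. mdeg f x) + (\<Sum>x\<in>mvars g. mdeg g x)"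
      by (simp only: sum.distrib, intro arg_cong2[of _ _ _ _ "(+)"] sum.mono_neutral_right)
        (auto simp: mdeg_eq_0_iff)
    finally show ?thesis .
  qed
  have pos: "nat \<bar>head_coeff f\<bar> > 0" "nat \<bar>head_coeff g\<bar> > 0" using assms by auto
  have hc: "nat \<bar>head_coeff (f * g)\<bar> = nat \<bar>head_coeff f\<bar> * nat \<bar>head_coeff g\<bar>"
    by (simp add: head_coeff_mult abs_mult nat_mult_distrib)
  show ?thesis
  proof (cases "mconst g")
    case True
    then obtain c where c: "g = of_int c" by (auto simp: mconst_iff)
    then have "nat \<bar>head_coeff g\<bar> > 1"
      using assms(2,3) by (cases "c = 1 \<or> c = -1") (auto simp: head_coeff_of_int)
    with pos have "nat \<bar>head_coeff f\<bar> < nat \<bar>head_coeff (f * g)\<bar>" unfolding hc by simp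
    then show ?thesis unfolding mpoly_measure_def sum by linarith
  next
    case False
    then obtain x where "x \<in> mvars g" by (auto simp: mconst_def)
    then have "mdeg g x \<noteq> 0" by (simp add: mdeg_eq_0_iff)
    with \<open>x \<in> mvars g\<close> have "(\<Sum>x\<in>mvars g. mdeg g x) > 0"
      by (metis finite_mvars gr_zeroI sum_eq_0_iff)
    moreover have "nat \<bar>head_coeff f\<bar> \<le> nat \<bar>head_coeff (f * g)\<bar>" using pos unfolding hc by (cases "nat \<bar>head_coeff g\<bar>") auto
    ultimately show ?thesis unfolding mpoly_measure_def sum by linarith
  qed
qed

lemma mpoly_irreducible_factor:
  fixes f :: mpoly
  assumes "f \<noteq> 0" "\<not> f dvd 1"
  shows "\<exists>p. irreducible p \<and> p dvd f"
  using assms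
proof (induction "mpoly_measure f" arbitrary: f rule: less_induct)
  case (less f)
  show ?case
  proof (cases "irreducible f")
    case False
    then obtain a b where ab: "f = a * b" "\<not> a dvd 1" "\<not> b dvd 1"
      using less by (auto simp: irreducible_def)
    then have "mpoly_measure a < mpoly_measure f"
      using less.prems by (auto intro: mpoly_measure_mult_less)
    then obtain p where "irreducible p" "p dvd a" using less ab by force
    then show ?thesis using ab by auto
  qed auto
qed

lemma mpoly_factor_induct [consumes 1, case_names unit mult]:
  fixes f :: mpoly
  assumes "f \<noteq> 0" "\<And>u. u dvd 1 \<Longrightarrow> P u"
    and mult: "\<And>p f. irreducible p \<Longrightarrow> f \<noteq> 0 \<Longrightarrow> P f \<Longrightarrow> P (p * f)"
  shows "P f"
  using assms(1)
proof (induction "mpoly_measure f" arbitrary: f rule: less_induct)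
  case (less f)
  show ?case
  proof (cases "f dvd 1")
    case False
    then obtain p g where p: "irreducible p" "f = p * g"
      using mpoly_irreducible_factor[of f] less by (auto simp: dvd_def)
    then have "\<not> p dvd 1" "p \<noteq> 0" by (auto simp: irreducible_def)
    then have "mpoly_measure g < mpoly_measure f"
      using p less.prems mpoly_measure_mult_less[of g p] by (auto simp: mult.commute)
    then show ?thesis using less p mult by auto
  qed (rule assms(2))
qed

section \<open>From irreducible to prime, by induction on the set of variables\<close>

lemma as_poly_dvd_iff: "as_poly x f dvd as_poly x g \<longleftrightarrow> f dvd g"
proof
  assume "as_poly x f dvd as_poly x g"
  then obtain h where "as_poly x g = as_poly x f * h" by (auto simp: dvd_def)
  then have "poly (as_poly x g) (mvar x) = poly (as_poly x f) (mvar x) * poly h (mvar x)" by simp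
  then show "f dvd g" by (simp add: poly_as_poly_mvar)
qed (auto simp: dvd_def as_poly_mult)

lemma free_dvd_iff_coeff:
  assumes "x \<notin> mvars p"
  shows "p dvd f \<longleftrightarrow> (\<forall>i. p dvd coeff (as_poly x f) i)"
  using assms as_poly_dvd_iff[of x p f] by (simp add: not_in_mvars_iff_as_poly const_poly_dvd_iff)

lemma of_int_dvd_of_int_mpoly: "(of_int a :: mpoly) dvd of_int b \<longleftrightarrow> a dvd b"
proof
  assume *: "(of_int a :: mpoly) dvd of_int b"
  show "a dvd b"
  proof (cases "b = 0")
    case False
    from * obtain q :: mpoly where q: "of_int b = of_int a * q" unfolding dvd_def by blast
    with False have "mvars q \<subseteq> mvars (of_int b)" by (intro mvars_dvd) auto
    then obtain c where "q = of_int c" using mvars_empty_const[of q] by auto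
    with q have "(of_int b :: mpoly) = of_int (a * c)" by simp
    then have "b = a * c" using of_int_eq_iff by blast
    then show ?thesis by simp
  qed auto
qed (auto simp: dvd_def)

text \<open>Primality tested only on polynomials with variables in \<open>X\<close>, for induction on \<open>X\<close>.\<close>

definition prime_within :: "nat set \<Rightarrow> mpoly \<Rightarrow> bool" where
  "prime_within X p \<longleftrightarrow> (\<forall>a b. mvars a \<subseteq> X \<longrightarrow> mvars b \<subseteq> X \<longrightarrow> p dvd a * b \<longrightarrow> p dvd a \<or> p dvd b)"

lemma prime_within_empty:
  assumes "irreducible p" "mvars p \<subseteq> {}"
  shows "prime_within {} p"
proof -
  obtain c where c: "p = of_int c" using assms(2) mvars_empty_const by blast
  have "irreducible c"
  proof (rule irreducibleI)
    show "c \<noteq> 0" using assms(1) c by auto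
    show "\<not> is_unit c" using assms(1) c of_int_dvd_of_int_mpoly[of c 1] by (auto simp: irreducible_def)
    fix a b assume "c = a * b"
    then have "p = of_int a * of_int b" using c by simp
    then have "of_int a dvd (1::mpoly) \<or> of_int b dvd (1::mpoly)" using assms(1) by (auto simp: irreducible_def)
    then show "is_unit a \<or> is_unit b" using of_int_dvd_of_int_mpoly[of _ 1] by simp
  qed
  then have "prime_elem c" by (rule irreducible_imp_prime_elem)
  show ?thesis
    unfolding prime_within_def
  proof (intro allI impI)
    fix a b assume "mvars a \<subseteq> {}" "mvars b \<subseteq> {}" and dvd: "p dvd a * b"
    then obtain a' b' where "a = of_int a'" "b = of_int b'" using mvars_empty_const by blast
    with dvd c \<open>prime_elem c\<close> show "p dvd a \<or> p dvd b"
      by (simp add: of_int_dvd_of_int_mpoly prime_elem_dvd_mult_iff flip: of_int_mult)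
  qed
qed

text \<open>Gauss's argument: let i and k be the first indices at which p does not divide the
  coefficient of a and of b. In the coefficient \<open>i + k\<close> of \<open>a * b\<close> all
  other summands are divisible by p, so p divides the product of these two.\<close>

lemma prime_within_insert_free:
  assumes "prime_within X p" "x \<notin> mvars p"
  shows "prime_within (insert x X) p"
  unfolding prime_within_def
proof (intro allI impI, rule ccontr)
  fix a b assume ab: "mvars a \<subseteq> insert x X" "mvars b \<subseteq> insert x X" "p dvd a * b" "\<not> (p dvd a \<or> p dvd b)"
  let ?a = "coeff (as_poly x a)" and ?b = "coeff (as_poly x b)"
  define i where "i = (LEAST i. \<not> p dvd ?a i)"
  define k where "k = (LEAST i. \<not> p dvd ?b i)"
  have "\<exists>i. \<not> p dvd ?a i" "\<exists>i. \<not> p dvd ?b i"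
    using ab(4) free_dvd_iff_coeff[OF assms(2)] by blast+
  then have i: "\<not> p dvd ?a i" and k: "\<not> p dvd ?b k"
    unfolding i_def k_def by (metis (mono_tags, lifting) LeastI)+
  have i': "p dvd ?a r" if "r < i" for r using that not_less_Least unfolding i_def by blast
  have k': "p dvd ?b r" if "r < k" for r using that not_less_Least unfolding k_def by blast
  have "p dvd coeff (as_poly x (a * b)) (i + k)"
    using ab(3) free_dvd_iff_coeff[OF assms(2)] by blast
  also have "coeff (as_poly x (a * b)) (i + k) = (\<Sum>r\<le>i+k. ?a r * ?b (i + k - r))"
    by (simp add: as_poly_mult coeff_mult)
  also have "\<dots> = ?a i * ?b k + (\<Sum>r\<in>{..i+k}-{i}. ?a r * ?b (i + k - r))"
    by (subst sum.remove[of _ i]) auto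
  finally have 1: "p dvd ?a i * ?b k + (\<Sum>r\<in>{..i+k}-{i}. ?a r * ?b (i + k - r))" .
  have "p dvd (\<Sum>r\<in>{..i+k}-{i}. ?a r * ?b (i + k - r))"
  proof (intro dvd_sum)
    fix r assume "r \<in> {..i+k}-{i}"
    then have "r < i \<or> i + k - r < k" by auto
    then show "p dvd ?a r * ?b (i + k - r)" using i' k' by (meson dvd_mult dvd_mult2)
  qed
  with 1 have "p dvd ?a i * ?b k" by (simp add: dvd_add_left_iff)
  moreover have "mvars (?a i) \<subseteq> X" "mvars (?b k) \<subseteq> X"
    using ab(1,2) mvars_coeff_as_poly[of x] by blast+
  ultimately show False using assms(1) i k unfolding prime_within_def by blast
qed

text \<open>The irreducible factors of c are handed one by one to q or to d, whichever they divide.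
  This is how denominators are cleared; X bounds the variables of the factors known to be prime, Y
  those of the polynomials on which primality is tested.\<close>

lemma mpoly_cancel_primes:
  assumes "c \<noteq> 0" "mvars c \<subseteq> X" "c * f = q * d" "mvars q \<subseteq> Y" "mvars d \<subseteq> Y"
    and prime: "\<And>p. irreducible p \<Longrightarrow> mvars p \<subseteq> X \<Longrightarrow> prime_within Y p"
  shows "\<exists>c1 c2 q' d'. c = c1 * c2 \<and> q = c1 * q' \<and> d = c2 * d' \<and> f = q' * d'"
  using assms(1-5)
proof (induction c arbitrary: f q d rule: mpoly_factor_induct)
  case (unit u)
  then obtain v where v: "1 = u * v" by (auto simp: dvd_def)
  then have "q = u * (v * q)" by (simp add: mult.assoc[symmetric])
  moreover have "f = (v * q) * d"
    using unit v by (metis mult.assoc mult.commute mult_1)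
  ultimately show ?case by (metis mult_1 mult_1_right)
next
  case (mult p c)
  have p: "p \<noteq> 0" using mult(1) by auto
  have pc: "mvars p \<subseteq> X" "mvars c \<subseteq> X" using mult.prems(1) mvars_mult[OF p mult(2)] by auto
  have "p dvd q * d" using mult.prems(2) by (metis dvd_triv_left mult.assoc)
  then consider "p dvd q" | "p dvd d"
    using prime[OF mult(1) pc(1)] mult.prems unfolding prime_within_def by blast
  then show ?case
  proof cases
    case 1
    then obtain q0 where q0: "q = p * q0" by (auto simp: dvd_def)
    have "mvars q0 \<subseteq> Y" using mult.prems(3) mvars_mult[OF p, of q0] q0 by (cases "q0 = 0") auto
    moreover have "c * f = q0 * d" using mult.prems(2) q0 p by (simp add: mult.assoc)
    ultimately obtain c1 c2 q' d' where "c = c1 * c2" "q0 = c1 * q'" "d = c2 * d'" "f = q' * d'"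
      using mult.IH pc(2) mult.prems(4) by metis
    then show ?thesis using q0 by (intro exI[of _ "p * c1"] exI[of _ c2] exI[of _ q'] exI[of _ d']) (auto simp: mult_ac)
  next
    case 2
    then obtain d0 where d0: "d = p * d0" by (auto simp: dvd_def)
    have "mvars d0 \<subseteq> Y" using mult.prems(4) mvars_mult[OF p, of d0] d0 by (cases "d0 = 0") auto
    moreover have "c * f = q * d0" using mult.prems(2) d0 p by (simp add: mult_ac)
    ultimately obtain c1 c2 q' d' where "c = c1 * c2" "q = c1 * q'" "d0 = c2 * d'" "f = q' * d'"
      using mult.IH pc(2) mult.prems(3) by metis
    then show ?thesis using d0 by (intro exI[of _ c1] exI[of _ "p * c2"] exI[of _ q'] exI[of _ d']) (auto simp: mult_ac)
  qed
qed

lemma mvars_closed: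
  "mvars f \<subseteq> Y \<Longrightarrow> mvars g \<subseteq> Y \<Longrightarrow> mvars (f + g) \<subseteq> Y"
  "mvars f \<subseteq> Y \<Longrightarrow> mvars g \<subseteq> Y \<Longrightarrow> mvars (f - g) \<subseteq> Y"
  "mvars f \<subseteq> Y \<Longrightarrow> mvars g \<subseteq> Y \<Longrightarrow> mvars (f * g) \<subseteq> Y"
  "mvars f \<subseteq> Y \<Longrightarrow> mvars (f ^ k) \<subseteq> Y"
  using mvars_add[of f g] mvars_add[of f "- g"] mvars_mult_subset[of f g] mvars_power[of f k] by auto

lemma mvars_mvar [simp]: "mvars (mvar x) = {x}"
  by (simp add: mvars_def mvar_def)

lemma mpoly_pseudo_division:
  assumes "d \<noteq> 0" "x \<in> Y" "mvars f \<subseteq> Y" "mvars d \<subseteq> Y"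
  shows "\<exists>c q r. c \<noteq> 0 \<and> mvars c \<subseteq> Y - {x} \<and> c * f = q * d + r \<and> (r = 0 \<or> mdeg r x < mdeg d x) \<and>
    mvars q \<subseteq> Y \<and> mvars r \<subseteq> Y"
  using assms(3)
proof (induction "mdeg f x" arbitrary: f rule: less_induct)
  case (less f)
  show ?case
  proof (cases "f = 0 \<or> mdeg f x < mdeg d x")
    case True
    then show ?thesis using less by (intro exI[of _ 1] exI[of _ 0] exI[of _ f]) auto
  next
    case False
    then have f: "f \<noteq> 0" and deg: "mdeg d x \<le> mdeg f x" by auto
    have lcd: "mvars (lc d x) \<subseteq> Y - {x}" "mvars (lc f x) \<subseteq> Y - {x}"
      using mvars_lc[of d x] mvars_lc[of f x] assms less by auto
    show ?thesis
    proof (cases "mdeg d x = 0")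
      case True
      then have "x \<notin> mvars d" by (simp add: mdeg_eq_0_iff)
      then show ?thesis using assms less
        by (intro exI[of _ d] exI[of _ f] exI[of _ 0]) (auto simp: mult.commute)
    next
      case False
      define s where "s = lc f x * mvar x ^ (mdeg f x - mdeg d x)"
      define g where "g = lc d x * f - s * d"
      have s: "mvars s \<subseteq> Y" unfolding s_def using lcd assms by (intro mvars_closed) auto
      have g: "mvars g \<subseteq> Y" unfolding g_def using s lcd assms less by (intro mvars_closed) auto
      have free: "as_poly x (lc h x) = [:lc h x:]" for h
        using mvars_lc[of h x] by (intro not_in_mvars_iff_as_poly[THEN iffD1]) auto
      have mono: "as_poly x (mvar x ^ k) = monom 1 k" for k
        by (simp add: as_poly.hom_power as_poly_mvar monom_altdef)
      have ag: "as_poly x g = Polynomial.smult (lc d x) (as_poly x f) -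
          Polynomial.smult (lc f x) (monom 1 (mdeg f x - mdeg d x) * as_poly x d)"
        by (simp add: g_def s_def as_poly.hom_minus as_poly_mult free mono)
      have dg: "mdeg g x < mdeg f x"
        unfolding mdeg_def
      proof (rule degree_lessI)
        show "as_poly x g \<noteq> 0 \<or> 0 < degree (as_poly x f)" using False deg by (simp add: mdeg_def)
        show "\<forall>k\<ge>degree (as_poly x f). coeff (as_poly x g) k = 0"
        proof (intro allI impI)
          fix k assume k: "degree (as_poly x f) \<le> k"
          have "k - (mdeg f x - mdeg d x) \<ge> mdeg d x" using k deg by (simp add: mdeg_def)
          then show "coeff (as_poly x g) k = 0"
            using k deg unfolding ag
            by (cases "k = mdeg f x") (auto simp: coeff_monom_mult lc_def mdeg_def coeff_eq_0)
        qed
      qed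
      from less.hyps[OF dg g] obtain c q r where cqr: "c \<noteq> 0" "mvars c \<subseteq> Y - {x}" "c * g = q * d + r"
        "r = 0 \<or> mdeg r x < mdeg d x" "mvars q \<subseteq> Y" "mvars r \<subseteq> Y" by blast
      have "c * lc d x * f = (q + c * s) * d + r"
        using cqr(3) unfolding g_def by (simp add: algebra_simps)
      moreover have "mvars (c * lc d x) \<subseteq> Y - {x}" using cqr lcd by (intro mvars_closed)
      moreover have "mvars (q + c * s) \<subseteq> Y" using cqr s by (intro mvars_closed) auto
      moreover have "c * lc d x \<noteq> 0" using cqr assms by simp
      ultimately show ?thesis using cqr by blast
    qed
  qed
qed

text \<open>Over a field of fractions the ideal would be generated by an element of least degree;
  pseudo-division gives the same up to factors free of x. It is applied within a restricted set of
  variables for Gauss's lemma and with \<open>UNIV\<close> for elimination.\<close>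

lemma minimal_degree_pseudo_divides:
  assumes "I \<subseteq> {f. mvars f \<subseteq> Y}" "x \<in> Y" "f0 \<in> I" "f0 \<noteq> 0"
    and diff: "\<And>f g. f \<in> I \<Longrightarrow> g \<in> I \<Longrightarrow> f - g \<in> I"
    and mult: "\<And>f h. f \<in> I \<Longrightarrow> mvars h \<subseteq> Y \<Longrightarrow> h * f \<in> I"
  shows "\<exists>d\<in>I. d \<noteq> 0 \<and> (\<forall>f\<in>I. \<exists>c q. c \<noteq> 0 \<and> mvars c \<subseteq> Y - {x} \<and> mvars q \<subseteq> Y \<and> c * f = q * d)"
proof -
  have "\<exists>d. (d \<in> I \<and> d \<noteq> 0) \<and> (\<forall>f. f \<in> I \<and> f \<noteq> 0 \<longrightarrow> mdeg d x \<le> mdeg f x)"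
    using assms(3,4) by (intro ex_has_least_nat[of "\<lambda>d. d \<in> I \<and> d \<noteq> 0" f0 "\<lambda>d. mdeg d x"]) auto
  then obtain d where d: "d \<in> I" "d \<noteq> 0" and min: "\<And>f. f \<in> I \<Longrightarrow> f \<noteq> 0 \<Longrightarrow> mdeg d x \<le> mdeg f x"
    by blast
  have "\<exists>c q. c \<noteq> 0 \<and> mvars c \<subseteq> Y - {x} \<and> mvars q \<subseteq> Y \<and> c * f = q * d" if "f \<in> I" for f
  proof -
    have mf: "mvars f \<subseteq> Y" "mvars d \<subseteq> Y" using that d assms(1) by auto
    obtain c q r where *: "c \<noteq> 0" "mvars c \<subseteq> Y - {x}" "c * f = q * d + r" "r = 0 \<or> mdeg r x < mdeg d x"
      "mvars q \<subseteq> Y"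
      using mpoly_pseudo_division[OF d(2) assms(2) mf] by blast
    have "r = c * f - q * d" using *(3) by simp
    then have "r \<in> I" using that d(1) *(2,5) by (auto intro!: diff mult)
    with min *(4) have "r = 0" by fastforce
    with * show ?thesis by auto
  qed
  with d show ?thesis by blast
qed

text \<open>Gauss's lemma without fraction fields: if \<open>p\<close> divides \<open>a b\<close>, a nonzero element \<open>d\<close> of least degree in \<open>x\<close> of
  the ideal \<open>(p, a)\<close> divides \<open>p\<close> and \<open>a\<close> up to factors free of \<open>x\<close>, and such factors can be cancelled.\<close>

lemma prime_within_insert:
  assumes p: "irreducible p" "x \<in> mvars p" "mvars p \<subseteq> insert x X" and "x \<notin> X"
    and IH: "\<And>q. irreducible q \<Longrightarrow> mvars q \<subseteq> X \<Longrightarrow> prime_within (insert x X) q"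
  shows "prime_within (insert x X) p"
  unfolding prime_within_def
proof (intro allI impI, rule ccontr)
  let ?Y = "insert x X"
  have Y: "?Y - {x} = X" using \<open>x \<notin> X\<close> by auto
  have pnz: "p \<noteq> 0" using p(1) by auto
  \<comment> \<open>The part \<open>c2\<close> of c that divides p is free of x, whereas p involves
    x; irreducibility makes \<open>c2\<close> a unit, so cancelling c takes nothing away from
    p.\<close>
  have cancel: "p dvd f" if cf: "c \<noteq> 0" "mvars c \<subseteq> X" "c * f = s * p" "mvars s \<subseteq> ?Y" for c f s
  proof -
    obtain c1 c2 s' p' where *: "c = c1 * c2" "p = c2 * p'" "f = s' * p'"
      using mpoly_cancel_primes[OF cf p(3) IH] by blast
    have "x \<notin> mvars c" using cf(2) \<open>x \<notin> X\<close> by auto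
    then have "x \<notin> mvars c2" using mvars_mult[of c1 c2] cf(1) * by auto
    moreover have "mvars p = mvars c2 \<union> mvars p'" using *(2) pnz by (auto simp: mvars_mult)
    ultimately have "x \<in> mvars p'" using p(2) by auto
    then have "\<not> p' dvd 1" using mvars_dvd[of p' 1] by auto
    then have "c2 dvd 1" using p(1) *(2) by (auto simp: irreducible_def)
    then have "p dvd p'" using *(2) by (auto simp: mpoly_unit_iff)
    then show ?thesis using *(3) by auto
  qed
  fix a b assume ab: "mvars a \<subseteq> ?Y" "mvars b \<subseteq> ?Y" "p dvd a * b" "\<not> (p dvd a \<or> p dvd b)"
  define I where "I = {u * p + v * a |u v. mvars u \<subseteq> ?Y \<and> mvars v \<subseteq> ?Y}"
  have pI: "p \<in> I" unfolding I_def
    by (rule CollectI, rule exI[of _ 1], rule exI[of _ 0]) auto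
  have aI: "a \<in> I" unfolding I_def
    by (rule CollectI, rule exI[of _ 0], rule exI[of _ 1]) auto
  have "\<exists>d\<in>I. d \<noteq> 0 \<and> (\<forall>f\<in>I. \<exists>c q. c \<noteq> 0 \<and> mvars c \<subseteq> ?Y - {x} \<and> mvars q \<subseteq> ?Y \<and> c * f = q * d)"
  proof (rule minimal_degree_pseudo_divides[OF _ _ pI pnz])
    show "I \<subseteq> {f. mvars f \<subseteq> ?Y}" unfolding I_def using p ab by (auto dest!: subsetD[OF mvars_add] subsetD[OF mvars_mult_subset])
    fix f assume "f \<in> I"
    then obtain u v where uv: "f = u * p + v * a" "mvars u \<subseteq> ?Y" "mvars v \<subseteq> ?Y" by (auto simp: I_def)
    show "f - g \<in> I" if gI: "g \<in> I" for g
    proof -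
      obtain u' v' where uv': "g = u' * p + v' * a" "mvars u' \<subseteq> ?Y" "mvars v' \<subseteq> ?Y"
        using gI by (auto simp: I_def)
      have "f - g = (u - u') * p + (v - v') * a" using uv uv' by (simp add: algebra_simps)
      moreover have "mvars (u - u') \<subseteq> ?Y" "mvars (v - v') \<subseteq> ?Y" by (rule mvars_closed(2)[OF uv(2) uv'(2)], rule mvars_closed(2)[OF uv(3) uv'(3)])
      ultimately show ?thesis unfolding I_def by blast
    qed
    show "h * f \<in> I" if "mvars h \<subseteq> ?Y" for h
    proof -
      have "h * f = (h * u) * p + (h * v) * a" using uv by (simp add: algebra_simps)
      moreover have "mvars (h * u) \<subseteq> ?Y" "mvars (h * v) \<subseteq> ?Y"
        by (rule mvars_closed(3)[OF that uv(2)], rule mvars_closed(3)[OF that uv(3)])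
      ultimately show ?thesis unfolding I_def by blast
    qed
  qed auto
  then obtain d where d: "d \<in> I" "d \<noteq> 0" and
    div: "\<And>f. f \<in> I \<Longrightarrow> \<exists>c q. c \<noteq> 0 \<and> mvars c \<subseteq> X \<and> mvars q \<subseteq> ?Y \<and> c * f = q * d"
    unfolding Y by blast
  obtain u v where uv: "d = u * p + v * a" "mvars u \<subseteq> ?Y" "mvars v \<subseteq> ?Y" using d by (auto simp: I_def)
  have dY: "mvars d \<subseteq> ?Y" unfolding uv(1) using uv p ab by (intro mvars_closed)
  show False
  \<comment> \<open>If d involves x, so does \<open>d'\<close> in \<open>p = q' * d'\<close>; then
    \<open>q'\<close> is a unit, and p divides d and, after cancellation, a. If d is free of x, then
    p divides \<open>d * b\<close>, and cancelling d leaves b.\<close>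
  proof (cases "x \<in> mvars d")
    case True
    obtain c q where cq: "c \<noteq> 0" "mvars c \<subseteq> X" "mvars q \<subseteq> ?Y" "c * p = q * d" using div[OF pI] by blast
    obtain c1 c2 q' d' where *: "c = c1 * c2" "q = c1 * q'" "d = c2 * d'" "p = q' * d'"
      using mpoly_cancel_primes[OF cq(1,2,4,3) dY IH] by blast
    have "x \<notin> mvars c2" using cq(1,2) * \<open>x \<notin> X\<close> mvars_mult[of c1 c2] by auto
    moreover have "mvars d = mvars c2 \<union> mvars d'" using d(2) * by (auto simp: mvars_mult)
    ultimately have "x \<in> mvars d'" using True by auto
    then have "\<not> d' dvd 1" using mvars_dvd[of d' 1] by auto
    then have "q' dvd 1" using p(1) *(4) by (auto simp: irreducible_def)
    then have "p dvd d" using * by (auto simp: mpoly_unit_iff)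
    then obtain s where s: "d = s * p" by (auto simp: dvd_def mult.commute)
    obtain c' q'' where cq': "c' \<noteq> 0" "mvars c' \<subseteq> X" "mvars q'' \<subseteq> ?Y" "c' * a = q'' * d" using div[OF aI] by blast
    have "mvars s \<subseteq> ?Y" using dY s d(2) mvars_mult[of s p] by auto
    then have "p dvd a" using cancel[OF cq'(1,2), of a "q'' * s"] cq'(3,4) s
      by (simp add: mult.assoc mvars_closed)
    then show False using ab by simp
  next
    case False
    then have dX: "mvars d \<subseteq> X" using dY by auto
    have "p dvd d * b" using ab(3) unfolding uv(1) by (simp add: distrib_right mult.assoc dvd_mult)
    then obtain s where s: "d * b = s * p" by (auto simp: dvd_def mult.commute)
    have "mvars s \<subseteq> ?Y"
    proof (cases "s = 0")
      case False
      then have "mvars s \<subseteq> mvars (d * b)" using mvars_mult[of s p] pnz s by auto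
      then show ?thesis using mvars_closed(3)[OF dY ab(2)] by auto
    qed auto
    then have "p dvd b" using cancel[OF d(2) dX s] by simp
    then show False using ab by simp
  qed
qed

lemma irreducible_imp_prime_within:
  assumes "finite X" "irreducible p" "mvars p \<subseteq> X"
  shows "prime_within X p"
  using assms
proof (induction X arbitrary: p)
  case empty
  then show ?case using prime_within_empty by blast
next
  case (insert x X)
  have IH: "prime_within (insert x X) q" if "irreducible q" "mvars q \<subseteq> X" for q
    using prime_within_insert_free[of X q x] insert that by auto
  show ?case
  proof (cases "x \<in> mvars p")
    case True
    then show ?thesis using prime_within_insert insert IH by blast
  next
    case False
    then have "mvars p \<subseteq> X" using insert by auto
    then show ?thesis using IH insert by simp
  qed
qed

text \<open>A single divisibility involves finitely many variables, so the induction on finite sets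
  of variables suffices.\<close>

lemma mpoly_irreducible_prime:
  fixes p :: mpoly
  assumes "irreducible p" shows "prime_elem p"
proof (rule prime_elemI)
  show "p \<noteq> 0" "\<not> p dvd 1" using assms by (auto simp: irreducible_def)
  fix a b assume "p dvd a * b"
  moreover have "prime_within (mvars p \<union> mvars a \<union> mvars b) p"
    by (rule irreducible_imp_prime_within) (use assms in auto)
  ultimately show "p dvd a \<or> p dvd b" unfolding prime_within_def by blast
qed

section \<open>Elimination of a variable from coprime polynomials\<close>

lemma irreducible_factor_involving:
  assumes "f \<noteq> 0" "x \<in> mvars f"
  shows "\<exists>p. irreducible p \<and> x \<in> mvars p \<and> p dvd f"
  using assms
proof (induction f rule: mpoly_factor_induct)
  case (unit u)
  then show ?case using mvars_dvd[of u 1] by auto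
next
  case (mult p f)
  then have "x \<in> mvars p \<or> x \<in> mvars f" using mvars_mult_subset by blast
  then show ?case using mult by (metis dvd_mult dvd_triv_left)
qed

definition mideal :: "mpoly set \<Rightarrow> bool" where
  "mideal J \<longleftrightarrow> (\<forall>f\<in>J. \<forall>g\<in>J. f - g \<in> J) \<and> (\<forall>f\<in>J. \<forall>h. h * f \<in> J)"

text \<open>A nonzero element of least degree in x of the ideal generated by P cannot involve x: an
  irreducible factor with x would, by primality, divide every member of P. Quantifying over all
  ideals J replaces explicit cofactors; J is later the ideal of the polynomials vanishing at a
  point, or of those whose restriction to a line is divisible by a given polynomial.\<close>

lemma elimination:
  assumes "f0 \<in> P" "f0 \<noteq> 0"
    and coprime: "\<And>p. irreducible p \<Longrightarrow> x \<in> mvars p \<Longrightarrow> \<exists>f\<in>P. \<not> p dvd f"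
  shows "\<exists>r. r \<noteq> 0 \<and> x \<notin> mvars r \<and> (\<forall>J. mideal J \<longrightarrow> P \<subseteq> J \<longrightarrow> r \<in> J)"
proof -
  define I where "I = \<Inter>{J. mideal J \<and> P \<subseteq> J}"
  have "f0 \<in> I" using assms by (auto simp: I_def)
  have "\<exists>d\<in>I. d \<noteq> 0 \<and> (\<forall>f\<in>I. \<exists>c q. c \<noteq> 0 \<and> mvars c \<subseteq> UNIV - {x} \<and> mvars q \<subseteq> UNIV \<and> c * f = q * d)"
    by (rule minimal_degree_pseudo_divides[OF _ _ \<open>f0 \<in> I\<close> \<open>f0 \<noteq> 0\<close>]) (auto simp: I_def mideal_def)
  then obtain d where d: "d \<in> I" "d \<noteq> 0"
    and div: "\<And>f. f \<in> I \<Longrightarrow> \<exists>c q. c \<noteq> 0 \<and> x \<notin> mvars c \<and> c * f = q * d"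
    by (auto simp: subset_Diff_insert)
  have "x \<notin> mvars d"
  proof
    assume "x \<in> mvars d"
    then obtain p where p: "irreducible p" "x \<in> mvars p" "p dvd d"
      using irreducible_factor_involving d by blast
    obtain f where f: "f \<in> P" "\<not> p dvd f" using coprime p by blast
    then obtain c q where "c \<noteq> 0" "x \<notin> mvars c" "c * f = q * d" using div[of f] by (auto simp: I_def)
    moreover have "\<not> p dvd c" using mvars_dvd[of p c] p calculation by auto
    ultimately have "p dvd c * f" "\<not> p dvd c" using p by auto
    then show False using f mpoly_irreducible_prime[OF p(1)] prime_elem_dvd_mult_iff by blast
  qed
  with d show ?thesis by (auto simp: I_def)
qed

section \<open>Existence of irreducible factorisations and their multiplicities\<close>

lemma mpoly_eq_sum_single: "(f::mpoly) = (\<Sum>m\<in>Poly_Mapping.keys f. Poly_Mapping.single m (Poly_Mapping.lookup f m))"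
proof (rule poly_mapping_eqI)
  fix k
  have "(\<Sum>m\<in>Poly_Mapping.keys f. Poly_Mapping.lookup (Poly_Mapping.single m (Poly_Mapping.lookup f m)) k) =
      (\<Sum>m\<in>Poly_Mapping.keys f. if m = k then Poly_Mapping.lookup f m else 0)"
    by (intro sum.cong) (auto simp: lookup_single)
  then show "Poly_Mapping.lookup f k = Poly_Mapping.lookup (\<Sum>m\<in>Poly_Mapping.keys f. Poly_Mapping.single m (Poly_Mapping.lookup f m)) k"
    by (simp add: lookup_sum not_in_keys_iff_lookup_eq_zero)
qed

lemma irreducible_imp_mprimitive:
  assumes "irreducible p" "\<not> mconst p"
  shows "mprimitive p"
proof -
  define g where "g = (GCD m\<in>Poly_Mapping.keys p. Poly_Mapping.lookup p m)"
  have "Poly_Mapping.single 0 g dvd p"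
  proof (subst mpoly_eq_sum_single[of p], intro dvd_sum)
    fix m assume "m \<in> Poly_Mapping.keys p"
    then have "g dvd Poly_Mapping.lookup p m" by (auto simp: g_def)
    then obtain k where "Poly_Mapping.lookup p m = g * k" by (auto simp: dvd_def)
    then have "Poly_Mapping.single m (Poly_Mapping.lookup p m) = Poly_Mapping.single 0 g * Poly_Mapping.single m k"
      by (simp add: mult_single)
    then show "Poly_Mapping.single 0 g dvd Poly_Mapping.single m (Poly_Mapping.lookup p m)" by simp
  qed
  then have "of_int g dvd p" by (simp flip: single_of_int)
  then obtain q where q: "p = of_int g * q" by (auto simp: dvd_def)
  have "\<not> q dvd 1"
  proof
    assume "q dvd 1"
    then have "mvars q = {}" using mvars_dvd[of q 1] by auto
    then show False using assms(2) mvars_mult_subset[of "of_int g" q] q by (auto simp: mconst_def)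
  qed
  then have "(of_int g::mpoly) dvd of_int 1" using assms(1) q by (auto simp: irreducible_def)
  then have "g dvd 1" by (simp only: of_int_dvd_of_int_mpoly)
  moreover have "g \<ge> 0" by (simp add: g_def)
  ultimately show ?thesis unfolding mprimitive_def g_def by auto
qed

lemma normalized_irreducible_dvd_imp_eq:
  assumes "irreducible p" "irreducible q" "head_coeff p > 0" "head_coeff q > 0" "p dvd (q::mpoly)"
  shows "p = q"
proof -
  obtain u where u: "q = p * u" using assms by (auto simp: dvd_def)
  then have "u dvd 1" using assms by (auto simp: irreducible_def)
  then have "u = 1 \<or> u = -1" by (simp add: mpoly_unit_iff)
  then show ?thesis using u assms by (auto simp: head_coeff_uminus)
qed

lemma factorization_exists:
  assumes "h \<noteq> 0" shows "\<exists>a F e. factorization h a F e"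
  using assms
proof (induction h rule: mpoly_factor_induct)
  case (unit u)
  then have "factorization u (if u = 1 then 1 else -1) {} (\<lambda>_. 0)"
    by (auto simp: factorization_def mpoly_unit_iff)
  then show ?case by blast
next
  case (mult p h)
  then obtain a F e where fac: "factorization h a F e" by blast
  show ?case
  proof (cases "mconst p")
    case True
    then obtain c where "p = of_int c" by (auto simp: mconst_iff)
    with fac have "factorization (p * h) (c * a) F e" by (auto simp: factorization_def mult_ac)
    then show ?thesis by blast
  next
    case False
    define s :: int where "s = (if head_coeff p > 0 then 1 else -1)"
    define q where "q = of_int s * p"
    have pq: "p = of_int s * q" by (simp add: q_def s_def)
    have "p \<noteq> 0" using mult(1) by auto
    then have "head_coeff p \<noteq> 0" by simp
    then have hq: "head_coeff q > 0" using linorder_less_linear[of "head_coeff p" 0] by (auto simp: q_def s_def head_coeff_uminus)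
    have irr: "irreducible q" using mult(1)
      by (auto simp: q_def s_def irreducible_def) (metis minus_mult_minus minus_dvd_iff mult_minus_left neg_equal_0_iff_equal minus_equation_iff)+
    have q: "\<not> mconst q" using False by (auto simp: q_def s_def mconst_def)
    then have prim: "mprimitive q" using irreducible_imp_mprimitive irr by blast
    show ?thesis
    proof (cases "q \<in> F")
      case True
      have "(\<Prod>r\<in>F. r ^ (e(q := Suc (e q))) r) = q * (\<Prod>r\<in>F. r ^ e r)"
      proof -
        have fin: "finite F" using fac by (simp add: factorization_def)
        have "(\<Prod>r\<in>F - {q}. r ^ (e(q := Suc (e q))) r) = (\<Prod>r\<in>F - {q}. r ^ e r)"
          by (intro prod.cong) auto
        then show ?thesis using True fin by (simp add: prod.remove mult.assoc)
      qed
      then have "factorization (p * h) (s * a) F (e(q := Suc (e q)))"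
        using fac unfolding factorization_def by (auto simp: pq mult_ac)
      then show ?thesis by blast
    next
      case nin: False
      have "(\<Prod>r\<in>F. r ^ (e(q := 1)) r) = (\<Prod>r\<in>F. r ^ e r)"
        using nin by (intro prod.cong) auto
      then have "factorization (p * h) (s * a) (insert q F) (e(q := 1))"
        using fac nin hq q irr prim unfolding factorization_def by (auto simp: pq mult_ac)
      then show ?thesis by blast
    qed
  qed
qed

lemma prime_elem_dvd_prodE:
  assumes "finite F" "prime_elem p" "p dvd prod f F"
  obtains q where "q \<in> F" "p dvd f q"
proof -
  have "\<exists>q\<in>F. p dvd f q"
    using assms
  proof (induction F)
    case (insert q F)
    then show ?case by (auto simp: prime_elem_dvd_mult_iff)
  qed (auto simp: prime_elem_def)
  then show ?thesis using that by blast
qed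

text \<open>The exponent of p becomes its multiplicity in h, a quantity independent of the
  factorisation chosen; uniqueness is then immediate.\<close>

lemma factorization_power_dvd_iff:
  assumes fac: "factorization h a F e" and "h \<noteq> 0"
    and p: "irreducible p" "\<not> mconst p" "head_coeff p > 0"
  shows "p ^ k dvd h \<longleftrightarrow> k \<le> (if p \<in> F then e p else 0)"
proof -
  let ?e = "if p \<in> F then e p else 0"
  define r where "r = of_int a * (\<Prod>q\<in>F - {p}. q ^ e q)"
  have fin: "finite F" using fac by (simp add: factorization_def)
  have h: "h = p ^ ?e * r"
  proof (cases "p \<in> F")
    case True
    then show ?thesis using fac fin by (simp add: factorization_def r_def prod.remove mult_ac)
  next
    case False
    then have "F - {p} = F" by auto
    then show ?thesis using fac False by (simp add: factorization_def r_def)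
  qed
  have prime: "prime_elem p" using p mpoly_irreducible_prime by blast
  have "a \<noteq> 0" using fac \<open>h \<noteq> 0\<close> by (auto simp: factorization_def)
  have "\<not> p dvd r"
  proof
    assume "p dvd r"
    then consider "p dvd of_int a" | "p dvd (\<Prod>q\<in>F - {p}. q ^ e q)"
      unfolding r_def using prime by (auto simp: prime_elem_dvd_mult_iff)
    then show False
    proof cases
      case 1
      then show False using mvars_dvd[of p "of_int a"] \<open>a \<noteq> 0\<close> p(2) by (auto simp: mconst_def)
    next
      case 2
      then obtain q where "q \<in> F - {p}" "p dvd q ^ e q"
        using prime_elem_dvd_prodE[of "F - {p}" p] fin prime by blast
      then have "q \<in> F" "q \<noteq> p" "p dvd q" using prime by (auto simp: prime_elem_dvd_power)
      moreover then have "irreducible q" "head_coeff q > 0" using fac by (auto simp: factorization_def)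
      ultimately show False using normalized_irreducible_dvd_imp_eq p by blast
    qed
  qed
  have nz: "p \<noteq> 0" using p by auto
  show ?thesis
  proof
    assume dvd: "p ^ k dvd h"
    show "k \<le> ?e"
    proof (rule ccontr)
      assume "\<not> k \<le> ?e"
      then have "p ^ Suc ?e dvd p ^ k" by (intro le_imp_power_dvd) auto
      then have "p ^ Suc ?e dvd p ^ ?e * r" using dvd h by (metis dvd_trans)
      then have "p dvd r" using nz by (simp add: mult.commute)
      with \<open>\<not> p dvd r\<close> show False by simp
    qed
  next
    assume "k \<le> ?e"
    then show "p ^ k dvd h" using h by (metis dvd_mult2 le_imp_power_dvd)
  qed
qed

section \<open>Squarefree parts, gcds and resultants\<close>

lemma factorization_unique:
  assumes "factorization h a F e" "factorization h a' F' e'" "h \<noteq> 0"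
  shows "F = F'" "\<And>p. p \<in> F \<Longrightarrow> e p = e' p"
proof -
  have normal: "irreducible p \<and> \<not> mconst p \<and> head_coeff p > 0" if "p \<in> F \<union> F'" for p
    using that assms by (auto simp: factorization_def)
  have eq: "(if p \<in> F then e p else 0) = (if p \<in> F' then e' p else 0)" if "p \<in> F \<union> F'" for p
  proof -
    have "k \<le> (if p \<in> F then e p else 0) \<longleftrightarrow> k \<le> (if p \<in> F' then e' p else 0)" for k
      using factorization_power_dvd_iff[OF assms(1,3), of p k] factorization_power_dvd_iff[OF assms(2,3), of p k]
        normal[OF that] by simp
    from this[of "if p \<in> F then e p else 0"] this[of "if p \<in> F' then e' p else 0"] show ?thesis
      by linarith
  qed
  have pos: "p \<in> F \<Longrightarrow> e p > 0" "p \<in> F' \<Longrightarrow> e' p > 0" for p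
    using assms by (auto simp: factorization_def)
  show "F = F'" using eq pos by (metis Un_iff less_irrefl set_eq_iff)
  then show "e p = e' p" if "p \<in> F" for p using eq[of p] that by simp
qed

definition normal_irreducible :: "mpoly \<Rightarrow> bool" where
  "normal_irreducible p \<longleftrightarrow> irreducible p \<and> \<not> mconst p \<and> head_coeff p > 0"

text \<open>Uniqueness replaces the existentially quantified factorisations in \<open>sqrf1\<close>
  and \<open>sqrf2\<close> by a single one, split according to the parity of the exponents.\<close>

lemma sqrf_factors:
  assumes "\<not> mconst h"
  obtains F where "finite F" "\<And>p. p \<in> F \<Longrightarrow> normal_irreducible p \<and> p dvd h"
    "sqrf1 h \<union> sqrf2 h = F" "sqrf h = \<Prod>F"
    "\<And>a. meval a h = 0 \<longleftrightarrow> (\<exists>p\<in>F. meval a p = 0)" "mvars h \<subseteq> (\<Union>p\<in>F. mvars p)"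
proof -
  have h: "h \<noteq> 0" using assms by (auto simp: mconst_def)
  then obtain a F e where fac: "factorization h a F e" using factorization_exists by blast
  have unique: "F' = F \<and> (p \<in> F \<longrightarrow> e' p = e p)" if "factorization h a' F' e'" for a' F' e' p
    using factorization_unique[OF fac that h] by auto
  have ex: "(\<exists>a' F' e'. factorization h a' F' e' \<and> p \<in> F' \<and> Q (e' p)) \<longleftrightarrow> p \<in> F \<and> Q (e p)" for p Q
  proof
    assume "\<exists>a' F' e'. factorization h a' F' e' \<and> p \<in> F' \<and> Q (e' p)"
    then obtain a' F' e' where *: "factorization h a' F' e'" "p \<in> F'" "Q (e' p)" by blast
    with unique[OF *(1), of p] show "p \<in> F \<and> Q (e p)" by simp
  qed (use fac in blast)
  have s1: "sqrf1 h = {p \<in> F. odd (e p)}" and s2: "sqrf2 h = {p \<in> F. even (e p)}"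
    using assms ex[where Q = "\<lambda>k. odd k"] ex[where Q = "\<lambda>k. even k"] by (simp_all add: sqrf1_def sqrf2_def)
  have fin: "finite F" using fac by (simp add: factorization_def)
  have "a \<noteq> 0" using fac h by (auto simp: factorization_def)
  show ?thesis
  proof (rule that)
    show "finite F" by (rule fin)
    show "normal_irreducible p \<and> p dvd h" if "p \<in> F" for p
    proof
      show nf: "normal_irreducible p"
        using fac that by (auto simp: factorization_def normal_irreducible_def)
      show "p dvd h" using factorization_power_dvd_iff[OF fac h, of p 1] nf that fac
        by (auto simp: normal_irreducible_def factorization_def Suc_le_eq)
    qed
    show "sqrf1 h \<union> sqrf2 h = F" using s1 s2 by auto
    have "\<Prod>(sqrf1 h) * \<Prod>(sqrf2 h) = \<Prod>(sqrf1 h \<union> sqrf2 h)"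
      by (rule prod.union_disjoint[symmetric]) (use s1 s2 fin in auto)
    then show "sqrf h = \<Prod>F" using assms s1 s2 by (auto simp: sqrf_def intro!: arg_cong[of _ _ Prod])
    have "h = of_int a * (\<Prod>p\<in>F. p ^ e p)" using fac by (simp add: factorization_def)
    then have "mvars h \<subseteq> mvars (\<Prod>p\<in>F. p ^ e p)" using mvars_mult_subset[of "of_int a"] by auto
    then show "mvars h \<subseteq> (\<Union>p\<in>F. mvars p)"
      using mvars_prod[of "\<lambda>p. p ^ e p" F] mvars_power by blast
    fix b
    have "meval b h = of_int a * (\<Prod>p\<in>F. meval b p ^ e p)"
      using fac by (simp add: factorization_def meval.hom_mult meval.hom_prod meval.hom_power meval.hom_of_int)
    then show "meval b h = 0 \<longleftrightarrow> (\<exists>p\<in>F. meval b p = 0)"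
      using \<open>a \<noteq> 0\<close> fin fac by (auto simp: factorization_def)
  qed
qed

text \<open>For constants both sets are {1}. This includes h = 0, whose zeros are then not recorded;
  hence the condition \<open>h \<noteq> 0\<close> in the part on zeros.\<close>

lemma sqrf12_props:
  shows "finite (sqrf1 h)" "finite (sqrf2 h)"
    and "\<And>p. p \<in> sqrf1 h \<union> sqrf2 h \<Longrightarrow> p = 1 \<or> normal_irreducible p"
    and "\<And>p. p \<in> sqrf1 h \<union> sqrf2 h \<Longrightarrow> mvars p \<subseteq> mvars h"
    and "\<And>a. h \<noteq> 0 \<Longrightarrow> meval a h = 0 \<longleftrightarrow> (\<exists>p\<in>sqrf1 h \<union> sqrf2 h. meval a p = 0)"
proof -
  have "finite (sqrf1 h) \<and> finite (sqrf2 h) \<and>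
    (\<forall>p\<in>sqrf1 h \<union> sqrf2 h. (p = 1 \<or> normal_irreducible p) \<and> mvars p \<subseteq> mvars h) \<and>
    (h \<noteq> 0 \<longrightarrow> (\<forall>a. meval a h = 0 \<longleftrightarrow> (\<exists>p\<in>sqrf1 h \<union> sqrf2 h. meval a p = 0)))"
  proof (cases "mconst h")
    case True
    then obtain c where "h = of_int c" by (auto simp: mconst_iff)
    with True show ?thesis by (auto simp: sqrf1_def sqrf2_def meval.hom_of_int)
  next
    case False
    then have h: "h \<noteq> 0" by (auto simp: mconst_def)
    show ?thesis
      by (rule sqrf_factors[OF False]) (use h mvars_dvd in auto)
  qed
  then show "finite (sqrf1 h)" "finite (sqrf2 h)"
    "\<And>p. p \<in> sqrf1 h \<union> sqrf2 h \<Longrightarrow> p = 1 \<or> normal_irreducible p"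
    "\<And>p. p \<in> sqrf1 h \<union> sqrf2 h \<Longrightarrow> mvars p \<subseteq> mvars h"
    "\<And>a. h \<noteq> 0 \<Longrightarrow> meval a h = 0 \<longleftrightarrow> (\<exists>p\<in>sqrf1 h \<union> sqrf2 h. meval a p = 0)"
    by blast+
qed

text \<open>Common irreducible factors are removed from all members of A until none is left; the
  measure of \<open>f0\<close> bounds how often this happens. Primality serves for a common divisor
  d not divisible by p: the factor p of \<open>p * b\<close> must then lie in the cofactor of
  d.\<close>

lemma mpoly_gcd_exists:
  fixes A :: "mpoly set"
  assumes "f0 \<in> A" "f0 \<noteq> 0"
  shows "\<exists>g. (\<forall>a\<in>A. g dvd a) \<and> (\<forall>d. (\<forall>a\<in>A. d dvd a) \<longrightarrow> d dvd g)"
  using assms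
proof (induction "mpoly_measure f0" arbitrary: f0 A rule: less_induct)
  case (less f0 A)
  show ?case
  proof (cases "\<exists>p. irreducible p \<and> (\<forall>a\<in>A. p dvd a)")
    case False
    have "d dvd 1" if d: "\<forall>a\<in>A. d dvd a" for d
    proof (rule ccontr)
      assume nd: "\<not> d dvd 1"
      have "d dvd f0" using d less by blast
      then have "d \<noteq> 0" using less by auto
      then obtain p where "irreducible p" "p dvd d" using mpoly_irreducible_factor nd by blast
      then show False using False d dvd_trans by blast
    qed
    then show ?thesis by (intro exI[of _ 1]) auto
  next
    case True
    then obtain p where p: "irreducible p" "\<forall>a\<in>A. p dvd a" by blast
    have pnz: "p \<noteq> 0" "\<not> p dvd 1" using p by (auto simp: irreducible_def)
    define B where "B = {b. p * b \<in> A}"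
    have A: "\<exists>b\<in>B. a = p * b" if "a \<in> A" for a
      using p(2) that by (auto simp: B_def dvd_def)
    obtain g0 where g0: "g0 \<in> B" "f0 = p * g0" using A less by blast
    then have "mpoly_measure g0 < mpoly_measure f0" "g0 \<noteq> 0"
      using mpoly_measure_mult_less[of g0 p] pnz less by (auto simp: mult.commute)
    then obtain g where g: "\<forall>b\<in>B. g dvd b" "\<And>d. (\<forall>b\<in>B. d dvd b) \<Longrightarrow> d dvd g"
      using less.hyps[OF _ g0(1)] by blast
    have "d dvd p * g" if d: "\<forall>a\<in>A. d dvd a" for d
    proof (cases "p dvd d")
      case True
      then obtain d' where d': "d = p * d'" by (auto simp: dvd_def)
      have "d' dvd b" if "b \<in> B" for b
        using d that pnz unfolding B_def d' by auto
      then show ?thesis using g(2) d' by auto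
    next
      case False
      have "d dvd b" if "b \<in> B" for b
      proof -
        have "d dvd p * b" using d that by (auto simp: B_def)
        then obtain q where q: "p * b = d * q" by (auto simp: dvd_def)
        then have "p dvd d * q" by (metis dvd_triv_left)
        then have "p dvd q" using False mpoly_irreducible_prime[OF p(1)] by (auto simp: prime_elem_dvd_mult_iff)
        then obtain q' where "q = p * q'" by (auto simp: dvd_def)
        then have "p * b = p * (d * q')" using q by (simp add: mult_ac)
        then show ?thesis using pnz by simp
      qed
      then show ?thesis using g(2) by auto
    qed
    moreover have "\<forall>a\<in>A. p * g dvd a" using A g(1) by (metis dvd_refl mult_dvd_mono)
    ultimately show ?thesis by blast
  qed
qed

text \<open>Two gcds differ by a unit, that is by a sign, and the sign of the head coefficient picks
  one; so the \<open>THE\<close> has a unique candidate.\<close>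

lemma mgcd_props:
  assumes "f0 \<in> A" "f0 \<noteq> 0"
  shows "\<And>a. a \<in> A \<Longrightarrow> mgcd A dvd a" "\<And>d. (\<And>a. a \<in> A \<Longrightarrow> d dvd a) \<Longrightarrow> d dvd mgcd A" "mgcd A \<noteq> 0"
proof -
  let ?P = "\<lambda>g. (\<forall>a\<in>A. g dvd a) \<and> (\<forall>d. (\<forall>a\<in>A. d dvd a) \<longrightarrow> d dvd g)"
  obtain g where g: "?P g" using mpoly_gcd_exists[OF assms] by blast
  then have gnz: "g \<noteq> 0" using assms by auto
  define g' where "g' = (if head_coeff g > 0 then g else - g)"
  have "head_coeff g \<noteq> 0" using gnz by simp
  then have g': "?P g' \<and> (g' = 0 \<or> head_coeff g' > 0)"
    using g linorder_less_linear[of "head_coeff g" 0] by (auto simp: g'_def head_coeff_uminus)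
  have "?P (mgcd A) \<and> (mgcd A = 0 \<or> head_coeff (mgcd A) > 0)"
    unfolding mgcd_def conj_assoc[symmetric]
  proof (rule theI[where a = g'])
    show "?P g' \<and> (g' = 0 \<or> head_coeff g' > 0)" by (rule g')
    fix k assume k: "?P k \<and> (k = 0 \<or> head_coeff k > 0)"
    then have kd: "k dvd g'" "g' dvd k" using g' by blast+
    then obtain u v where uv: "g' = k * u" "k = g' * v" unfolding dvd_def by blast
    have "g' \<noteq> 0" using gnz by (auto simp: g'_def)
    have "g' * (v * u) = k * u" by (simp only: uv(2) mult.assoc)
    also have "\<dots> = g' * 1" by (simp only: uv(1)[symmetric] mult_1_right)
    finally have "u * v = 1" using \<open>g' \<noteq> 0\<close> by (simp add: mult.commute)
    then have "u dvd 1" by (metis dvd_triv_left)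
    then have "u = 1 \<or> u = -1" by (simp add: mpoly_unit_iff)
    then show "k = g'" using uv(1) k g' \<open>g' \<noteq> 0\<close> by (auto simp: head_coeff_uminus)
  qed
  then have *: "?P (mgcd A)" by blast
  then show "\<And>a. a \<in> A \<Longrightarrow> mgcd A dvd a" "\<And>d. (\<And>a. a \<in> A \<Longrightarrow> d dvd a) \<Longrightarrow> d dvd mgcd A" by auto
  show "mgcd A \<noteq> 0" using * assms by auto
qed

section \<open>Resultants, regular points and discriminants\<close>

lemma mvars_det:
  assumes "\<And>i j. i < dim_row A \<Longrightarrow> j < dim_col A \<Longrightarrow> mvars (A $$ (i, j)) \<subseteq> Y"
  shows "mvars (det A) \<subseteq> Y"
proof (cases "dim_row A = dim_col A")
  case True
  have sign: "mvars (signof p :: mpoly) = {}" for p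
    by (cases "sign p = 1") (auto simp: sign_def)
  have "mvars (signof p * (\<Prod>i = 0..<dim_row A. A $$ (i, p i))) \<subseteq> Y" if "p permutes {0..<dim_row A}" for p
  proof -
    have "p i < dim_col A" if "i < dim_row A" for i
      using \<open>p permutes _\<close> that True permutes_in_image[of p "{0..<dim_row A}" i] by auto
    then have "mvars (A $$ (i, p i)) \<subseteq> Y" if "i < dim_row A" for i using that assms by blast
    then have "mvars (\<Prod>i = 0..<dim_row A. A $$ (i, p i)) \<subseteq> Y"
      by (intro order_trans[OF mvars_prod] UN_least) auto
    then show ?thesis using sign by (intro mvars_closed) auto
  qed
  then show ?thesis unfolding Determinant.det_def using True
    by (auto intro!: order_trans[OF mvars_sum] UN_least simp del: mvars_single_0)
qed (auto simp: Determinant.det_def)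

lemma mvars_resultant:
  assumes "\<And>i. mvars (coeff P i) \<subseteq> Y" "\<And>i. mvars (coeff Q i) \<subseteq> Y"
  shows "mvars (resultant P Q) \<subseteq> Y"
  unfolding resultant_def
proof (rule mvars_det)
  fix i j assume "i < dim_row (sylvester_mat P Q)" "j < dim_col (sylvester_mat P Q)"
  then show "mvars (sylvester_mat P Q $$ (i, j)) \<subseteq> Y"
    using assms by (auto simp: sylvester_index_mat)
qed

lemma mvars_coeff_pderiv: "(\<And>i. mvars (coeff P i) \<subseteq> Y) \<Longrightarrow> mvars (coeff (pderiv P) i) \<subseteq> Y"
  unfolding coeff_pderiv using mvars_of_int[of "int (Suc i)"]
  by (intro mvars_closed) (simp_all del: of_nat_Suc mvars_of_int)

text \<open>Expansion of the Sylvester determinant along its first column: besides zeros it contains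
  only the leading coefficients of P and of its derivative, the latter being \<open>degree P\<close>
  times the former.\<close>

lemma lead_coeff_dvd_resultant_pderiv:
  fixes P :: "'a::{idom,ring_char_0} poly"
  assumes "degree P > 0"
  shows "lead_coeff P dvd resultant P (pderiv P)"
proof -
  let ?S = "sylvester_mat P (pderiv P)"
  define N where "N = degree P + degree (pderiv P)"
  have "?S \<in> carrier_mat N N" unfolding N_def by (rule sylvester_carrier_mat)
  moreover have N: "0 < N" using assms by (simp add: N_def)
  ultimately have "det ?S = (\<Sum>i<N. ?S $$ (i, 0) * cofactor ?S i 0)" by (rule laplace_expansion_column)
  also have "lead_coeff P dvd \<dots>"
  proof (intro dvd_sum dvd_mult2)
    fix i assume i: "i \<in> {..<N}"
    have d: "degree (pderiv P) = degree P - 1" by (simp add: degree_pderiv)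
    have "coeff (pderiv P) (degree (pderiv P)) = of_nat (degree P) * lead_coeff P"
      using assms unfolding d coeff_pderiv by simp
    then show "lead_coeff P dvd ?S $$ (i, 0)"
      using i N by (subst sylvester_index_mat) (auto simp: N_def intro: dvd_mult)
  qed
  finally show ?thesis by (simp add: resultant_def)
qed

interpretation upoly: comm_ring_hom "upoly a x" for a x
proof -
  interpret map_poly_comm_ring_hom "meval a" ..
  show "comm_ring_hom (upoly a x)"
    by unfold_locales (simp_all add: upoly_def as_poly.hom_add as_poly.hom_mult hom_add hom_mult)
qed

lemma upoly_free: "x \<notin> mvars f \<Longrightarrow> upoly a x f = [:meval a f:]"
  by (intro poly_eqI) (simp add: coeff_upoly not_in_mvars_iff_as_poly coeff_pCons split: nat.split)

text \<open>The leading coefficient keeps roots from escaping to infinity near \<open>a\<close>, and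
  simplicity keeps real roots from merging or disappearing. A restriction that is a nonzero constant
  counts as regular if y does not occur in p.\<close>

definition regular_at :: "mpoly \<Rightarrow> nat \<Rightarrow> (nat \<Rightarrow> real) \<Rightarrow> bool" where
  "regular_at p y a \<longleftrightarrow> meval a (lc p y) \<noteq> 0 \<and>
    (\<forall>t. poly (upoly a y p) t = 0 \<longrightarrow> poly (pderiv (upoly a y p)) t \<noteq> 0)"

lemma degree_upoly: "meval a (lc p y) \<noteq> 0 \<Longrightarrow> degree (upoly a y p) = mdeg p y"
  unfolding mdeg_def upoly_def lc_def by (rule degree_map_poly) auto

lemma pderiv_upoly: "pderiv (upoly a y p) = map_poly (meval a) (pderiv (as_poly y p))"
  by (intro poly_eqI) (simp add: upoly_def coeff_map_poly coeff_pderiv meval.hom_mult meval.hom_add meval.hom_of_nat)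

text \<open>The nonzero leading coefficient preserves the degrees of p and of its derivative, so
  evaluating the Sylvester matrix gives the Sylvester matrix of the restrictions.\<close>

lemma meval_resultant:
  assumes "meval a (lc p y) \<noteq> 0" "mdeg p y > 0"
  shows "meval a (resultant (as_poly y p) (pderiv (as_poly y p))) =
    resultant (upoly a y p) (pderiv (upoly a y p))"
proof -
  have "degree (map_poly (meval a) (pderiv (as_poly y p))) = degree (pderiv (as_poly y p))"
    using degree_upoly[OF assms(1)] unfolding pderiv_upoly[symmetric] by (simp add: degree_pderiv mdeg_def)
  then show ?thesis
    using degree_upoly[OF assms(1)]
    unfolding pderiv_upoly by (subst meval.resultant_map_poly[symmetric]) (auto simp: upoly_def mdeg_def)
qed

lemma regular_at_resultant:
  assumes "meval a (resultant (as_poly y p) (pderiv (as_poly y p))) \<noteq> 0" "mdeg p y > 0"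
  shows "regular_at p y a"
proof -
  have "lc p y dvd resultant (as_poly y p) (pderiv (as_poly y p))"
    unfolding lc_def using assms(2) by (intro lead_coeff_dvd_resultant_pderiv) (simp add: mdeg_def)
  then have lc: "meval a (lc p y) \<noteq> 0" using assms(1) by (auto simp: dvd_def meval.hom_mult)
  then have "degree (gcd (upoly a y p) (pderiv (upoly a y p))) = 0"
    using assms meval_resultant real_resultant_0 by metis
  moreover have "upoly a y p \<noteq> 0" using degree_upoly[OF lc] assms(2) by auto
  ultimately have "\<not> [:-t, 1:] dvd gcd (upoly a y p) (pderiv (upoly a y p))" for t
    using dvd_imp_degree_le[of "[:-t, 1:]" "gcd (upoly a y p) (pderiv (upoly a y p))"] by auto
  then show ?thesis using lc by (auto simp: regular_at_def poly_eq_0_iff_dvd)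
qed

definition mderiv :: "nat \<Rightarrow> mpoly \<Rightarrow> mpoly" where
  "mderiv y p = poly (pderiv (as_poly y p)) (mvar y)"

lemma as_poly_mderiv: "as_poly y (mderiv y p) = pderiv (as_poly y p)"
  unfolding mderiv_def
proof (rule as_poly_poly_mvar)
  fix i
  have "mvars (coeff (pderiv (as_poly y p)) i) \<subseteq> mvars p - {y}"
    by (rule mvars_coeff_pderiv) (rule mvars_coeff_as_poly)
  then show "y \<notin> mvars (coeff (pderiv (as_poly y p)) i)" by blast
qed

lemma upoly_mderiv: "upoly a y (mderiv y p) = pderiv (upoly a y p)"
  by (simp add: pderiv_upoly) (simp add: upoly_def as_poly_mderiv)

lemma mderiv_mult: "mderiv y (p * q) = mderiv y p * q + p * mderiv y q"
  by (simp add: mderiv_def as_poly_mult pderiv_mult poly_as_poly_mvar)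

lemma not_dvd_mderiv:
  assumes "y \<in> mvars p" shows "\<not> p dvd mderiv y p"
proof
  assume "p dvd mderiv y p"
  then have "as_poly y p dvd pderiv (as_poly y p)" by (simp only: as_poly_dvd_iff flip: as_poly_mderiv)
  moreover have "degree (as_poly y p) > 0" using assms mdeg_eq_0_iff[of p y] by (simp add: mdeg_def)
  ultimately show False
    using dvd_imp_degree_le[of "as_poly y p" "pderiv (as_poly y p)"]
    by (auto simp: degree_pderiv pderiv_eq_0_iff)
qed

text \<open>Elimination gives a nonzero r free of y in the ideal of p and its y-derivative, since an
  irreducible common factor involving y would divide two members of F. At a point where r and the
  leading coefficient do not vanish, the gcd of the two restrictions divides a nonzero
  constant.\<close>

lemma resultant_squarefree_nonzero:
  assumes fin: "finite F" and F: "\<And>p. p \<in> F \<Longrightarrow> normal_irreducible p" and y: "y \<in> mvars (\<Prod>F)"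
  shows "resultant (as_poly y (\<Prod>F)) (pderiv (as_poly y (\<Prod>F))) \<noteq> 0"
proof -
  define p where "p = \<Prod>F"
  have "p \<noteq> 0" using fin F by (auto simp: p_def normal_irreducible_def)
  have "\<exists>r. r \<noteq> 0 \<and> y \<notin> mvars r \<and> (\<forall>J. mideal J \<longrightarrow> {p, mderiv y p} \<subseteq> J \<longrightarrow> r \<in> J)"
  proof (rule elimination[of p])
    fix \<pi> assume \<pi>: "irreducible \<pi>" "y \<in> mvars \<pi>"
    show "\<exists>f\<in>{p, mderiv y p}. \<not> \<pi> dvd f"
    proof (rule ccontr)
      assume "\<not> ?thesis"
      then have dvd: "\<pi> dvd p" "\<pi> dvd mderiv y p" by auto
      obtain q where q: "q \<in> F" "\<pi> dvd q"
        using prime_elem_dvd_prodE[OF fin mpoly_irreducible_prime[OF \<pi>(1)]] dvd(1) unfolding p_def by blast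
      then obtain u where u: "q = \<pi> * u" by (auto simp: dvd_def)
      have irr: "irreducible q" using F q by (auto simp: normal_irreducible_def)
      then have "u dvd 1" using \<pi>(1) u by (auto simp: irreducible_def)
      then have uu: "u = 1 \<or> u = -1" by (simp add: mpoly_unit_iff)
      then have qd: "q dvd mderiv y p" and yq: "y \<in> mvars q" using u dvd \<pi> by auto
      define g where "g = \<Prod>(F - {q})"
      have "p = q * g" unfolding p_def g_def using fin q by (simp add: prod.remove)
      then have "q dvd mderiv y q * g" using qd by (simp add: mderiv_mult dvd_add_left_iff)
      moreover have prime: "prime_elem q" using irr by (rule mpoly_irreducible_prime)
      ultimately have "q dvd g" using not_dvd_mderiv[OF yq] by (auto simp: prime_elem_dvd_mult_iff)
      then obtain r where "r \<in> F - {q}" "q dvd r"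
        unfolding g_def using prime_elem_dvd_prodE[OF _ prime] fin by (metis finite_Diff)
      then show False using F q normalized_irreducible_dvd_imp_eq by (auto simp: normal_irreducible_def)
    qed
  qed (use \<open>p \<noteq> 0\<close> in auto)
  then obtain r where r: "r \<noteq> 0" "y \<notin> mvars r" "\<And>J. mideal J \<Longrightarrow> {p, mderiv y p} \<subseteq> J \<Longrightarrow> r \<in> J" by blast
  have "r * lc p y \<noteq> 0" using r \<open>p \<noteq> 0\<close> by simp
  from mpoly_nonzero_point[OF this] obtain a where a: "meval a r \<noteq> 0" "meval a (lc p y) \<noteq> 0"
    by (auto simp: meval.hom_mult)
  define d where "d = gcd (upoly a y p) (pderiv (upoly a y p))"
  have "r \<in> {f. d dvd upoly a y f}"
    by (rule r) (auto simp: mideal_def upoly.hom_minus upoly.hom_mult d_def upoly_mderiv intro: dvd_diff)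
  moreover have "upoly a y r = [:meval a r:]"
    using r(2) by (rule upoly_free)
  ultimately have "d dvd [:meval a r:]" by simp
  then have "degree d = 0" using a dvd_imp_degree_le[of d "[:meval a r:]"] by auto
  moreover have deg: "mdeg p y > 0" using y mdeg_eq_0_iff[of p y] by (simp add: p_def)
  ultimately have "meval a (resultant (as_poly y p) (pderiv (as_poly y p))) \<noteq> 0"
    using meval_resultant[OF a(2) deg] real_resultant_0 unfolding d_def by metis
  then show ?thesis unfolding p_def by auto
qed

lemma mvars_resultant_pderiv:
  "mvars (resultant (as_poly y p) (pderiv (as_poly y p))) \<subseteq> mvars p - {y}"
  by (intro mvars_resultant mvars_coeff_pderiv mvars_coeff_as_poly)

text \<open>The restriction of h itself may have multiple roots. Regularity is therefore claimed for
  some q with the zeros of h: the squarefree part if y occurs in h, and h itself otherwise.\<close>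

lemma Bp_props:
  assumes "h \<noteq> 0"
  shows "Bp h y \<noteq> 0" "mvars (Bp h y) \<subseteq> mvars h - {y}"
    and "\<And>a. meval a (Bp h y) \<noteq> 0 \<Longrightarrow>
      \<exists>q. regular_at q y a \<and> (\<forall>b. meval b q = 0 \<longleftrightarrow> meval b h = 0) \<and> mvars q \<subseteq> mvars h"
proof -
  have "Bp h y \<noteq> 0 \<and> mvars (Bp h y) \<subseteq> mvars h - {y} \<and> (\<forall>a. meval a (Bp h y) \<noteq> 0 \<longrightarrow>
      (\<exists>q. regular_at q y a \<and> (\<forall>b. meval b q = 0 \<longleftrightarrow> meval b h = 0) \<and> mvars q \<subseteq> mvars h))"
  proof (cases "mdeg h y > 0")
    case False
    then have y: "y \<notin> mvars h" by (simp add: mdeg_eq_0_iff)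
    then have "as_poly y h = [:h:]" by (simp add: not_in_mvars_iff_as_poly)
    then have "regular_at h y a" if "meval a h \<noteq> 0" for a
      using that y by (auto simp: regular_at_def lc_def upoly_free)
    then show ?thesis using False y assms by (auto simp: Bp_def)
  next
    case True
    then have y: "y \<in> mvars h" using mdeg_eq_0_iff[of h y] by auto
    then have "\<not> mconst h" by (auto simp: mconst_def)
    then obtain F where F: "finite F" "\<And>p. p \<in> F \<Longrightarrow> normal_irreducible p \<and> p dvd h"
      "sqrf1 h \<union> sqrf2 h = F" "sqrf h = \<Prod>F"
      "\<And>a. meval a h = 0 \<longleftrightarrow> (\<exists>p\<in>F. meval a p = 0)" "mvars h \<subseteq> (\<Union>p\<in>F. mvars p)"
      by (rule sqrf_factors) (rule that; blast)
    have sub: "mvars (sqrf h) \<subseteq> mvars h"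
      unfolding F(4) using F(2) assms mvars_dvd by (intro order_trans[OF mvars_prod] UN_least) auto
    have "y \<in> mvars (sqrf h)"
    proof -
      obtain p where p: "p \<in> F" "y \<in> mvars p" using F(6) y by blast
      have "\<Prod>F \<noteq> 0" using F(1,2) by (auto simp: normal_irreducible_def)
      then have "mvars p \<subseteq> mvars (\<Prod>F)" using p(1) F(1) by (intro mvars_dvd dvd_prodI) auto
      then show ?thesis using p(2) F(4) by auto
    qed
    then have deg: "mdeg (sqrf h) y > 0" using mdeg_eq_0_iff[of "sqrf h" y] by auto
    have Bp: "Bp h y = resultant (as_poly y (sqrf h)) (pderiv (as_poly y (sqrf h)))"
      using True by (simp add: Bp_def)
    have "Bp h y \<noteq> 0"
      unfolding Bp F(4) by (rule resultant_squarefree_nonzero) (use F \<open>y \<in> mvars (sqrf h)\<close> in auto)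
    moreover have "mvars (Bp h y) \<subseteq> mvars h - {y}"
      unfolding Bp using mvars_resultant_pderiv[of y "sqrf h"] sub by blast
    moreover have "meval b (sqrf h) = 0 \<longleftrightarrow> meval b h = 0" for b
      unfolding F(4) F(5) using F(1) by (simp add: meval.hom_prod)
    moreover have "regular_at (sqrf h) y a" if "meval a (Bp h y) \<noteq> 0" for a
      using regular_at_resultant that deg Bp by simp
    ultimately show ?thesis using sub by blast
  qed
  then show "Bp h y \<noteq> 0" "mvars (Bp h y) \<subseteq> mvars h - {y}"
    "\<And>a. meval a (Bp h y) \<noteq> 0 \<Longrightarrow>
      \<exists>q. regular_at q y a \<and> (\<forall>b. meval b q = 0 \<longleftrightarrow> meval b h = 0) \<and> mvars q \<subseteq> mvars h"
    by blast+
qed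

text \<open>Justifies the \<open>THE\<close> in \<open>discrim\<close>: the leading coefficient
  divides the resultant, the sign is its own inverse, and cancellation gives uniqueness.\<close>

lemma discrim_resultant:
  assumes "mdeg f x > 0"
  shows "resultant (as_poly x f) (pderiv (as_poly x f)) =
    (-1) ^ (mdeg f x * (mdeg f x - 1) div 2) * lc f x * discrim f x"
proof -
  let ?R = "resultant (as_poly x f) (pderiv (as_poly x f))"
  define s :: mpoly where "s = (-1) ^ (mdeg f x * (mdeg f x - 1) div 2)"
  have s: "s * s = 1" "s \<noteq> 0" by (simp_all add: s_def flip: power_add mult_2)
  have lc: "lc f x \<noteq> 0" using assms by (auto simp: mdeg_def)
  have "lc f x dvd ?R"
    unfolding lc_def using assms by (intro lead_coeff_dvd_resultant_pderiv) (simp add: mdeg_def)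
  then obtain D0 where "?R = lc f x * D0" by (auto simp: dvd_def)
  moreover have "s * lc f x * (s * D0) = (s * s) * (lc f x * D0)" by (simp add: mult_ac)
  ultimately have ex: "?R = s * lc f x * (s * D0)" using s by simp
  have "?R = s * lc f x * (THE D. ?R = s * lc f x * D)"
    by (rule theI[of _ "s * D0"]) (use ex s lc in auto)
  then show ?thesis using assms by (simp add: discrim_def s_def)
qed

lemma mvars_discrim: "discrim f x \<noteq> 0 \<Longrightarrow> mvars (discrim f x) \<subseteq> mvars f - {x}"
proof (cases "mdeg f x = 0")
  case False
  assume nz: "discrim f x \<noteq> 0"
  let ?R = "resultant (as_poly x f) (pderiv (as_poly x f))"
  have "lc f x \<noteq> 0" using False by (auto simp: mdeg_def)
  then have "?R \<noteq> 0" using nz False by (simp add: discrim_resultant)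
  moreover have "discrim f x dvd ?R" using False by (simp add: discrim_resultant)
  ultimately have "mvars (discrim f x) \<subseteq> mvars ?R" by (rule mvars_dvd[rotated])
  then show ?thesis using mvars_resultant_pderiv by blast
qed (simp add: discrim_def)

lemma regular_at_discrim:
  assumes "meval a (lc f x) \<noteq> 0" "meval a (discrim f x) \<noteq> 0"
  shows "regular_at f x a"
proof (cases "mdeg f x = 0")
  case True
  then have x: "x \<notin> mvars f" by (simp add: mdeg_eq_0_iff)
  then have "lc f x = f" by (simp add: lc_def not_in_mvars_iff_as_poly)
  then show ?thesis using assms x by (simp add: regular_at_def upoly_free)
next
  case False
  then have "meval a (resultant (as_poly x f) (pderiv (as_poly x f))) \<noteq> 0"
    using assms by (simp add: discrim_resultant meval.hom_mult meval.hom_power meval.hom_uminus)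
  then show ?thesis using False regular_at_resultant by blast
qed

lemma Ocd_Ecd_props:
  assumes "discrim f x \<noteq> 0"
  shows "finite (Ocd f x)" "finite (Ecd f x)"
    and "\<And>p. p \<in> Ocd f x \<union> Ecd f x \<Longrightarrow> p = 1 \<or> normal_irreducible p"
    and "\<And>p. p \<in> Ocd f x \<union> Ecd f x \<Longrightarrow> mvars p \<subseteq> mvars f - {x}"
    and "\<And>a. f \<noteq> 0 \<Longrightarrow> (\<And>p. p \<in> Ocd f x \<union> Ecd f x \<Longrightarrow> meval a p \<noteq> 0) \<Longrightarrow> regular_at f x a"
proof -
  note s = sqrf12_props[where h = "lc f x"] sqrf12_props[where h = "discrim f x"]
  show "finite (Ocd f x)" "finite (Ecd f x)" using s by (auto simp: Ocd_def Ecd_def)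
  show "p = 1 \<or> normal_irreducible p" if "p \<in> Ocd f x \<union> Ecd f x" for p
    using that s(3,8) by (auto simp: Ocd_def Ecd_def)
  show "mvars p \<subseteq> mvars f - {x}" if "p \<in> Ocd f x \<union> Ecd f x" for p
    using that s(4,9)[of p] mvars_lc[of f x] mvars_discrim[OF assms] by (auto simp: Ocd_def Ecd_def)
  show "regular_at f x a" if "f \<noteq> 0" "\<And>p. p \<in> Ocd f x \<union> Ecd f x \<Longrightarrow> meval a p \<noteq> 0" for a
  proof (rule regular_at_discrim)
    show "meval a (lc f x) \<noteq> 0" using s(5)[of a] that by (auto simp: Ocd_def Ecd_def)
    show "meval a (discrim f x) \<noteq> 0" using s(10)[of a] that assms by (auto simp: Ocd_def Ecd_def)
  qed
qed

lemma normal_irreducible_prod_nonzero: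
  assumes "finite F" "\<And>p. p \<in> F \<Longrightarrow> p = 1 \<or> normal_irreducible p"
  shows "\<Prod>F \<noteq> 0"
  using assms(1) assms(2)[of 0] by (auto simp: normal_irreducible_def)

lemma Np_props_aux:
  assumes "ys \<noteq> []" "distinct ys" "\<And>y. y \<in> set ys \<Longrightarrow> discrim f y \<noteq> 0"
  shows "Np f ys \<noteq> 0 \<and> mvars (Np f ys) \<subseteq> mvars f - set ys \<and>
    (\<forall>y\<in>set ys. Np_wrt f ys y \<noteq> 0 \<and> mvars (Np_wrt f ys y) \<subseteq> mvars f - set ys)"
  using assms
proof (induction "length ys" arbitrary: ys rule: less_induct)
  case (less ys)
  show ?case
  proof (cases "length ys \<ge> 2")
    case False
    then obtain y where ys: "ys = [y]" using less.prems(1) by (cases ys; cases "tl ys") auto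
    then have d: "discrim f y \<noteq> 0" using less.prems by auto
    note P = Ocd_Ecd_props[OF d]
    have "\<Prod>(Ecd f y - Ocd f y) \<noteq> 0" "\<Prod>(Ocd f y) \<noteq> 0"
      by (intro normal_irreducible_prod_nonzero; use P(1-3) in auto)+
    moreover have "mvars (\<Prod>(Ecd f y - Ocd f y)) \<subseteq> mvars f - {y}" "mvars (\<Prod>(Ocd f y)) \<subseteq> mvars f - {y}"
      by (intro order_trans[OF mvars_prod] UN_least P(4); auto)+
    ultimately show ?thesis by (simp add: ys Np_wrt_def Np1_def)
  next
    case True
    have wrt: "Np_wrt f ys y = Bp (Np f (remove1 y ys)) y \<and> Np_wrt f ys y \<noteq> 0 \<and>
      mvars (Np_wrt f ys y) \<subseteq> mvars f - set ys" if y: "y \<in> set ys" for y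
    proof -
      have len: "length (remove1 y ys) < length ys" using y True by (simp add: length_remove1)
      have "remove1 y ys \<noteq> []" using True y by (metis One_nat_def Suc_1 Suc_pred length_pos_if_in_set length_remove1 list.size(3) not_less_eq_eq order_refl)
      then have IH: "Np f (remove1 y ys) \<noteq> 0" "mvars (Np f (remove1 y ys)) \<subseteq> mvars f - set (remove1 y ys)"
        using less.hyps[OF len] less.prems by (auto dest: notin_set_remove1)
      have eq: "Np_wrt f ys y = Bp (Np f (remove1 y ys)) y" using True by (auto simp: Np_wrt_def)
      have set: "set (remove1 y ys) = set ys - {y}" using less.prems by (simp add: set_remove1_eq)
      show ?thesis
        using Bp_props(1,2)[OF IH(1), of y] IH(2) unfolding eq set by blast
    qed
    define A where "A = Np_wrt f ys ` set ys"
    have Np: "Np f ys = mgcd A" unfolding A_def using True by (rule Np_eq_mgcd_Np_wrt)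
    obtain y where y: "y \<in> set ys" using less.prems by (cases ys) auto
    then have mem: "Np_wrt f ys y \<in> A" "Np_wrt f ys y \<noteq> 0" using wrt[OF y] y unfolding A_def by blast+
    have "mgcd A \<noteq> 0" by (rule mgcd_props(3)[OF mem])
    moreover have "mvars (mgcd A) \<subseteq> mvars (Np_wrt f ys y)"
      using mgcd_props(1)[OF mem mem(1)] mem(2) by (rule mvars_dvd)
    ultimately show ?thesis using wrt y Np by (metis order_trans)
  qed
qed

lemma Np_props:
  assumes "ys \<noteq> []" "distinct ys" "\<And>y. y \<in> set ys \<Longrightarrow> discrim f y \<noteq> 0"
  shows "Np f ys \<noteq> 0" "mvars (Np f ys) \<subseteq> mvars f - set ys"
    and "\<And>y. y \<in> set ys \<Longrightarrow> Np_wrt f ys y \<noteq> 0"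
    and "\<And>y. y \<in> set ys \<Longrightarrow> mvars (Np_wrt f ys y) \<subseteq> mvars f - set ys"
  using Np_props_aux[OF assms] by blast+

text \<open>With no variable left to project, \<open>f\<close> itself takes the place of \<open>Np(f, [])\<close>.\<close>

definition Np0 :: "mpoly \<Rightarrow> nat list \<Rightarrow> mpoly" where
  "Np0 f ys = (if ys = [] then f else Np f ys)"

text \<open>For a single variable the two products together contain every nonconstant irreducible
  factor of the leading coefficient and of the discriminant. For longer lists q comes from
  \<open>Bp_props\<close>.\<close>

lemma Np0_regular:
  assumes "y \<in> set ys" "distinct ys" "\<And>y. y \<in> set ys \<Longrightarrow> discrim f y \<noteq> 0" "f \<noteq> 0"
    and "meval a (Np f ys) \<noteq> 0" "meval a (Np_wrt f ys y) \<noteq> 0"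
  shows "\<exists>q. regular_at q y a \<and> (\<forall>b. meval b q = 0 \<longleftrightarrow> meval b (Np0 f (remove1 y ys)) = 0) \<and>
    mvars q \<subseteq> mvars (Np0 f (remove1 y ys))"
proof (cases "ys = [y]")
  case True
  note P = Ocd_Ecd_props[OF assms(3)[OF assms(1)]]
  have "regular_at f y a"
  proof (rule P(5)[OF assms(4)])
    fix p assume p: "p \<in> Ocd f y \<union> Ecd f y"
    show "meval a p \<noteq> 0"
      using p assms(5,6) P(1,2) True by (cases "p \<in> Ocd f y") (auto simp: Np_wrt_def Np1_def meval.hom_prod)
  qed
  then show ?thesis using True by (auto simp: Np0_def)
next
  case False
  then have ne: "remove1 y ys \<noteq> []" using assms(1) by (cases ys; cases "tl ys") auto
  have "Np f (remove1 y ys) \<noteq> 0"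
    by (rule Np_props(1)[OF ne]) (use assms(2,3) in \<open>auto dest: notin_set_remove1\<close>)
  then show ?thesis using Bp_props(3) assms(6) False ne by (auto simp: Np_wrt_def Np0_def)
qed

section \<open>Connectedness after removal of thin sets\<close>

definition cylindrical :: "nat set \<Rightarrow> (nat \<Rightarrow> real) set \<Rightarrow> bool" where
  "cylindrical Y A \<longleftrightarrow> (\<forall>a\<in>A. \<forall>b. (\<forall>i. i \<notin> Y \<longrightarrow> a i = b i) \<longrightarrow> b \<in> A)"

text \<open>With finite I and r > 0 these form a neighbourhood base of the product topology;
  coordinates outside I stay free, so that a box can be cylindrical.\<close>

definition pbox :: "(nat \<Rightarrow> real) \<Rightarrow> nat set \<Rightarrow> real \<Rightarrow> (nat \<Rightarrow> real) set" where
  "pbox a I r = {b. \<forall>i\<in>I. \<bar>b i - a i\<bar> < r}"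

definition line :: "(nat \<Rightarrow> real) \<Rightarrow> (nat \<Rightarrow> real) \<Rightarrow> real \<Rightarrow> nat \<Rightarrow> real" where
  "line a b t = (\<lambda>i. a i + t * (b i - a i))"

lemma line_0 [simp]: "line a b 0 = a" and line_1 [simp]: "line a b 1 = b"
  by (auto simp: line_def)

lemma continuous_meval: "continuous_on A (\<lambda>a. meval a f)"
  unfolding meval_def by (intro continuous_intros continuous_on_product_coordinates continuous_on_subset[OF continuous_on_product_coordinates]) auto

lemma continuous_line: "continuous_on A (line a b)"
  unfolding line_def by (intro continuous_on_coordinatewise_then_product continuous_intros)

lemma open_meval_nonzero: "open {a. meval a f \<noteq> 0}"
  using continuous_meval[of UNIV f] by (intro open_Collect_neq) auto

lemma center_in_pbox: "r > 0 \<Longrightarrow> a \<in> pbox a I r"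
  by (simp add: pbox_def)

lemma open_pbox:
  assumes "finite I" shows "open (pbox a I r)"
proof -
  have "pbox a I r = (\<Inter>i\<in>I. {b. \<bar>b i - a i\<bar> < r})" by (auto simp: pbox_def)
  also have "open \<dots>"
    using assms by (intro open_INT ballI open_Collect_less continuous_intros continuous_on_product_coordinates)
  finally show ?thesis .
qed

lemma open_contains_pbox:
  assumes "open O'" "a \<in> O'"
  obtains I r where "finite I" "r > 0" "pbox a I r \<subseteq> O'"
proof -
  have "openin (product_topology (\<lambda>i. euclidean) UNIV) O'"
    using assms(1) by (simp add: euclidean_product_topology)
  from product_topology_open_contains_basis[OF this assms(2)] obtain X where
    X: "a \<in> PiE UNIV X" "\<And>i. open (X i)" "finite {i. X i \<noteq> UNIV}" "PiE UNIV X \<subseteq> O'"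
    by (auto simp: topspace_euclidean)
  define I where "I = {i. X i \<noteq> UNIV}"
  have "\<exists>e>0. ball (a i) e \<subseteq> X i" for i using X(1,2) by (meson PiE_mem UNIV_I openE)
  then obtain e where e: "\<And>i. e i > 0" "\<And>i. ball (a i) (e i) \<subseteq> X i" by metis
  define r where "r = Min (insert 1 (e ` I))"
  have fin: "finite I" using X by (simp add: I_def)
  then have "r > 0" using e by (simp add: r_def)
  moreover have "pbox a I r \<subseteq> PiE UNIV X"
  proof
    fix b assume b: "b \<in> pbox a I r"
    have "b i \<in> X i" for i
    proof (cases "i \<in> I")
      case True
      then have "r \<le> e i" unfolding r_def using fin by (intro Min_le) auto
      then have "b i \<in> ball (a i) (e i)" using b True by (force simp: pbox_def dist_real_def abs_minus_commute)
      then show ?thesis using e by blast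
    qed (simp add: I_def)
    then show "b \<in> PiE UNIV X" by auto
  qed
  ultimately show ?thesis using that fin X(4) by blast
qed

lemma line_in_pbox:
  assumes "b \<in> pbox a I r" "c \<in> pbox a I r" "0 \<le> t" "t \<le> 1"
  shows "line b c t \<in> pbox a I r"
proof -
  have "\<bar>b i + t * (c i - b i) - a i\<bar> < r" if "i \<in> I" for i
  proof -
    have "b i \<in> ball (a i) r" "c i \<in> ball (a i) r"
      using assms that by (auto simp: pbox_def dist_real_def abs_minus_commute)
    then have "(1 - t) *\<^sub>R b i + t *\<^sub>R c i \<in> ball (a i) r"
      using assms(3,4) by (intro convexD[OF convex_ball]) auto
    moreover have "(1 - t) *\<^sub>R b i + t *\<^sub>R c i = b i + t * (c i - b i)" by (simp add: algebra_simps)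
    ultimately show ?thesis by (simp add: dist_real_def abs_minus_commute)
  qed
  then show ?thesis by (simp add: pbox_def line_def)
qed

lemma connected_component_line:
  assumes "\<And>t. 0 \<le> t \<Longrightarrow> t \<le> 1 \<Longrightarrow> line a b t \<in> S"
  shows "connected_component S a b"
proof -
  have "connected (line a b ` {0..1})"
    by (intro connected_continuous_image continuous_line) auto
  moreover have "a \<in> line a b ` {0..1}" by (rule image_eqI[of _ _ 0]) auto
  moreover have "b \<in> line a b ` {0..1}" by (rule image_eqI[of _ _ 1]) auto
  moreover have "line a b ` {0..1} \<subseteq> S" using assms by auto
  ultimately show ?thesis unfolding connected_component_def by blast
qed

lemma connected_pbox: "connected (pbox a I r)"
  unfolding connected_iff_connected_component using connected_component_line line_in_pbox by blast

text \<open>Boxes are connected, so the space of sequences is locally connected.\<close>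

lemma open_connected_component_set:
  fixes S :: "(nat \<Rightarrow> real) set"
  assumes "open S" shows "open (connected_component_set S a)"
proof (subst open_subopen, intro ballI)
  fix b assume b: "b \<in> connected_component_set S a"
  then have "b \<in> S" by (simp add: connected_component_in)
  then obtain I r where I: "finite I" "r > 0" "pbox b I r \<subseteq> S" using open_contains_pbox assms by blast
  have "pbox b I r \<subseteq> connected_component_set S b"
    using I center_in_pbox connected_pbox by (intro connected_component_maximal) auto
  also have "connected_component_set S b = connected_component_set S a"
    using connected_component_eq[OF b] by simp
  finally show "\<exists>T. open T \<and> b \<in> T \<and> T \<subseteq> connected_component_set S a"
    by (intro exI[of _ "pbox b I r"] conjI open_pbox center_in_pbox I)
qed

section \<open>Polynomials on lines, generic points and thin sets\<close>

lemma meval_line_poly: "\<exists>P. \<forall>t. meval (line a b t) f = poly P t"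
proof (induction f rule: mpoly_induct)
  case zero
  then show ?case by (intro exI[of _ 0]) simp
next
  case (add m c f)
  then obtain P where P: "\<And>t. meval (line a b t) f = poly P t" by blast
  have "poly (\<Prod>i\<in>Poly_Mapping.keys m. [:a i, b i - a i:] ^ Poly_Mapping.lookup m i) t =
      (\<Prod>i\<in>Poly_Mapping.keys m. line a b t i ^ Poly_Mapping.lookup m i)" for t
    by (simp add: poly_prod line_def mult.commute)
  then have "meval (line a b t) (Poly_Mapping.single m c + f) =
      poly (Polynomial.smult (of_int c) (\<Prod>i\<in>Poly_Mapping.keys m. [:a i, b i - a i:] ^ Poly_Mapping.lookup m i) + P) t" for t
    by (simp add: meval_add meval_single P)
  then show ?case by blast
qed

lemma ex_line_param_nonroot:
  assumes "open O'" "c \<in> O'" "P \<noteq> (0::real poly)"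
  shows "\<exists>t. line a c t \<in> O' \<and> poly P t \<noteq> 0"
proof -
  have "open (line a c -` O')"
    using continuous_line[of UNIV a c] assms(1) by (simp add: continuous_on_open_vimage[OF open_UNIV])
  moreover have "1 \<in> line a c -` O'" using assms by simp
  ultimately obtain e where e: "e > 0" "ball 1 e \<subseteq> line a c -` O'" by (meson openE)
  have "infinite (ball (1::real) e)" using e(1) by (simp add: ball_eq_greaterThanLessThan infinite_Ioo)
  moreover have "finite {t. poly P t = 0}" using assms(3) by (rule poly_roots_finite)
  ultimately have "\<not> ball 1 e \<subseteq> {t. poly P t = 0}" using finite_subset by blast
  then show ?thesis using e by blast
qed

text \<open>On the line through c and a point with r nonzero, r is a nonzero univariate polynomial;
  its finitely many zeros leave parameters arbitrarily close to that of c.\<close>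

lemma nonzero_dense:
  assumes "r \<noteq> 0" "open O'" "c \<in> O'"
  shows "\<exists>b\<in>O'. meval b r \<noteq> 0"
proof -
  obtain a where a: "meval a r \<noteq> 0" using mpoly_nonzero_point assms(1) by blast
  obtain P where P: "\<And>t. meval (line a c t) r = poly P t" using meval_line_poly by blast
  have "P \<noteq> 0" using a P[of 0] by auto
  from ex_line_param_nonroot[OF assms(2,3) this, of a] show ?thesis by (metis P)
qed

lemma Zeros_closed: "closed (Zeros P)"
proof -
  have "Zeros P = (\<Inter>p\<in>P. {a. meval a p = 0})" by (auto simp: Zeros_def)
  also have "closed \<dots>"
    using continuous_meval[of UNIV] by (intro closed_INT ballI closed_Collect_eq) auto
  finally show ?thesis .
qed

text \<open>The common zeros of coprime polynomials lie, for each variable \<open>x\<^sub>i\<close>, in the zero set of a nonzero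
  polynomial \<open>r\<^sub>i\<close> free of \<open>x\<^sub>i\<close>, so a line in direction \<open>x\<^sub>i\<close> through a point with \<open>r\<^sub>i \<noteq> 0\<close> avoids them.
  Generic points of a box are joined by changing one coordinate after the other.\<close>

lemma connected_component_box_minus_Zeros:
  assumes f0: "f0 \<in> P" "f0 \<noteq> 0" and fin: "\<And>f. f \<in> P \<Longrightarrow> mvars f \<subseteq> {..<N}"
    and coprime: "\<And>p. irreducible p \<Longrightarrow> mvars p \<noteq> {} \<Longrightarrow> \<exists>f\<in>P. \<not> p dvd f"
    and B: "B = pbox c0 I0 r0" "finite I0" and pq: "p \<in> B - Zeros P" "q \<in> B - Zeros P"
  shows "connected_component (B - Zeros P) p q"
proof -
  define S where "S = B - Zeros P"
  have "open S" unfolding S_def B using Zeros_closed open_pbox B(2) by (intro open_Diff)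
  have "\<exists>r. r \<noteq> 0 \<and> i \<notin> mvars r \<and> (\<forall>a\<in>Zeros P. meval a r = 0)" for i
  proof -
    have "\<exists>r. r \<noteq> 0 \<and> i \<notin> mvars r \<and> (\<forall>J. mideal J \<longrightarrow> P \<subseteq> J \<longrightarrow> r \<in> J)"
      by (rule elimination[OF f0]) (rule coprime; auto)
    then obtain r where r: "r \<noteq> 0" "i \<notin> mvars r" "\<forall>J. mideal J \<longrightarrow> P \<subseteq> J \<longrightarrow> r \<in> J" by (elim exE conjE)
    have "r \<in> {f. meval a f = 0}" if "a \<in> Zeros P" for a
      by (rule r(3)[rule_format])
        (use that in \<open>auto simp: mideal_def Zeros_def meval.hom_minus meval.hom_mult\<close>)
    then show ?thesis using r by blast
  qed
  then obtain r where r: "\<And>i. r i \<noteq> 0" "\<And>i. i \<notin> mvars (r i)" "\<And>i a. a \<in> Zeros P \<Longrightarrow> meval a (r i) = 0"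
    by metis
  obtain I1 r1 where 1: "finite I1" "r1 > 0" "pbox p I1 r1 \<subseteq> S"
    using open_contains_pbox[OF \<open>open S\<close>] pq S_def by blast
  obtain I2 r2 where 2: "finite I2" "r2 > 0" "pbox q I2 r2 \<subseteq> S"
    using open_contains_pbox[OF \<open>open S\<close>] pq S_def by blast
  have "(\<Prod>i<N. r i) \<noteq> 0" using r by simp
  then obtain a where a: "a \<in> pbox p I1 r1" "meval a (\<Prod>i<N. r i) \<noteq> 0"
    using nonzero_dense open_pbox center_in_pbox 1 by metis
  \<comment> \<open>From \<open>mix i b\<close> to \<open>mix (Suc i) b\<close> only coordinate i
    changes, which \<open>r i\<close> does not involve; so \<open>r i\<close> only has to be nonzero
    at \<open>mix i b\<close>. The next lines find such a b near q on the line through a and q: at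
    parameter 0 all mixtures are a itself, where no \<open>r i\<close> with i < N vanishes.\<close>
  define mix where "mix i b = (\<lambda>k. if k < i then b k else a k)" for i :: nat and b
  have mix_line: "mix i (line a b t) = line a (mix i b) t" for i b t
    by (auto simp: mix_def line_def)
  have "\<forall>i. \<exists>P. \<forall>t. meval (line a (mix i q) t) (r i) = poly P t" using meval_line_poly by blast
  from choice[OF this] obtain G where G: "\<And>i t. meval (line a (mix i q) t) (r i) = poly (G i) t"
    by blast
  have "poly (G i) 0 \<noteq> 0" if "i < N" for i
    using a(2) that G[of i 0] by (auto simp: meval.hom_prod)
  then have "(\<Prod>i<N. G i) \<noteq> 0" by (metis finite_lessThan lessThan_iff poly_0 prod_zero_iff)
  then obtain t where t: "line a q t \<in> pbox q I2 r2" "poly (\<Prod>i<N. G i) t \<noteq> 0"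
    using ex_line_param_nonroot[OF open_pbox[OF 2(1)] center_in_pbox[OF 2(2)]] by blast
  define b where "b = line a q t"
  have rmix: "meval (mix i b) (r i) \<noteq> 0" if "i < N" for i
    using t(2) that unfolding b_def mix_line G by (auto simp: poly_prod)
  have aS: "a \<in> S" and bS: "b \<in> S" using a 1 2 t b_def by blast+
  then have mixB: "mix i b \<in> B" for i by (auto simp: S_def B pbox_def mix_def)
  have "connected_component S (mix i b) (mix (Suc i) b)" if "i < N" for i
  proof (rule connected_component_line)
    fix s :: real assume s: "0 \<le> s" "s \<le> 1"
    let ?z = "line (mix i b) (mix (Suc i) b) s"
    have "?z \<in> B" using mixB s unfolding B by (intro line_in_pbox) auto
    moreover have "meval ?z (r i) = meval (mix i b) (r i)"
      by (rule meval_cong) (use r(2)[of i] in \<open>auto simp: line_def mix_def less_Suc_eq\<close>)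
    ultimately show "?z \<in> S" using rmix[OF that] r(3) by (auto simp: S_def)
  qed
  then have "connected_component S (mix 0 b) (mix i b)" if "i \<le> N" for i
    using that
  proof (induction i)
    case 0
    have "mix 0 b = a" by (auto simp: mix_def)
    then show ?case using aS by (simp add: connected_component_refl)
  next
    case (Suc i)
    then show ?case by (meson Suc_le_lessD connected_component_trans less_imp_le_nat)
  qed
  from this[of N] have "connected_component S a (mix N b)" by (simp add: mix_def)
  \<comment> \<open>\<open>mix N b\<close> and b agree below N, and no member of P involves the
    coordinates that change on this last segment.\<close>
  moreover have "connected_component S (mix N b) b"
  proof (rule connected_component_line)
    fix s :: real assume s: "0 \<le> s" "s \<le> 1"
    let ?z = "line (mix N b) b s"
    have "?z \<in> B" using mixB bS s unfolding B S_def by (intro line_in_pbox) auto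
    moreover have "meval ?z f = meval b f" if "f \<in> P" for f
      by (rule meval_cong) (use fin[OF that] in \<open>auto simp: line_def mix_def\<close>)
    ultimately show "?z \<in> S" using bS by (auto simp: S_def Zeros_def)
  qed
  moreover have "connected_component S p a" "connected_component S b q"
    unfolding connected_component_def
    using 1 2 a(1) t(1) center_in_pbox connected_pbox b_def by blast+
  ultimately show ?thesis unfolding S_def[symmetric] by (meson connected_component_trans)
qed

text \<open>A separation of \<open>U - Z\<close> would extend to U: \<open>ext A\<close> collects
  the points with a neighbourhood in U that lies in A off Z. Connectedness of boxes off Z puts every
  point of U into \<open>ext A\<close> or \<open>ext B\<close>, and density of the complement of Z
  keeps the two apart.\<close>

lemma connected_diff_thin:
  fixes U Z :: "(nat \<Rightarrow> real) set"
  assumes U: "open U" "connected U" and "closed Z"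
    and dense: "\<And>V. open V \<Longrightarrow> V \<noteq> {} \<Longrightarrow> V - Z \<noteq> {}"
    and local: "\<And>c I r. finite I \<Longrightarrow> r > 0 \<Longrightarrow> connected (pbox c I r - Z)"
  shows "connected (U - Z)"
proof (rule connectedI)
  fix A B assume AB: "open A" "open B" "A \<inter> (U - Z) \<noteq> {}" "B \<inter> (U - Z) \<noteq> {}"
    "A \<inter> B \<inter> (U - Z) = {}" "U - Z \<subseteq> A \<union> B"
  define ext where "ext A = \<Union>{V. open V \<and> V \<subseteq> U \<and> V - Z \<subseteq> A}" for A :: "(nat \<Rightarrow> real) set"
  have op: "open (ext A)" for A by (auto simp: ext_def)
  have ne: "ext A \<inter> U \<noteq> {}" if "open A" "A \<inter> (U - Z) \<noteq> {}" for A
  proof -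
    have "A \<inter> (U - Z) \<subseteq> ext A"
      unfolding ext_def using that(1) U(1) \<open>closed Z\<close> by (intro Union_upper) (auto intro: open_Diff)
    then show ?thesis using that by blast
  qed
  have cover: "U \<subseteq> ext A \<union> ext B"
  proof
    fix x assume "x \<in> U"
    then obtain I r where I: "finite I" "r > 0" "pbox x I r \<subseteq> U" using open_contains_pbox U(1) by blast
    have "connected (pbox x I r - Z)" using local I by blast
    moreover have "pbox x I r - Z \<subseteq> A \<union> B" "A \<inter> B \<inter> (pbox x I r - Z) = {}" using I AB by blast+
    ultimately have "A \<inter> (pbox x I r - Z) = {} \<or> B \<inter> (pbox x I r - Z) = {}"
      using AB(1,2) connectedD by blast
    then have "pbox x I r - Z \<subseteq> A \<or> pbox x I r - Z \<subseteq> B" using \<open>pbox x I r - Z \<subseteq> A \<union> B\<close> by blast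
    moreover have "x \<in> pbox x I r" "open (pbox x I r)" using I center_in_pbox open_pbox by auto
    ultimately show "x \<in> ext A \<union> ext B" unfolding ext_def using I(3) by blast
  qed
  moreover have "ext A \<inter> ext B \<inter> U = {}"
  proof (rule ccontr)
    assume "\<not> ?thesis"
    then obtain x V W where "x \<in> V" "x \<in> W" "open V" "open W" "V \<subseteq> U" "V - Z \<subseteq> A" "W - Z \<subseteq> B"
      by (auto simp: ext_def)
    moreover then have "V \<inter> W - Z \<noteq> {}" using dense[of "V \<inter> W"] by (auto simp: open_Int)
    ultimately show False using AB(5) by blast
  qed
  ultimately show False using connectedD[OF U(2) op op] ne AB by metis
qed

lemma connected_minus_Zeros:
  assumes f0: "f0 \<in> P" "f0 \<noteq> 0" and fin: "\<And>f. f \<in> P \<Longrightarrow> mvars f \<subseteq> {..<N}"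
    and coprime: "\<And>p. irreducible p \<Longrightarrow> mvars p \<noteq> {} \<Longrightarrow> \<exists>f\<in>P. \<not> p dvd f"
    and U: "open U" "connected U"
  shows "connected (U - Zeros P)"
proof (rule connected_diff_thin[OF U Zeros_closed])
  fix V :: "(nat \<Rightarrow> real) set" assume "open V" "V \<noteq> {}"
  then obtain b where "b \<in> V" "meval b f0 \<noteq> 0" using nonzero_dense[OF f0(2)] by blast
  then show "V - Zeros P \<noteq> {}" using f0(1) by (auto simp: Zeros_def)
next
  fix c :: "nat \<Rightarrow> real" and I :: "nat set" and r :: real assume "finite I" "r > 0"
  then show "connected (pbox c I r - Zeros P)"
    unfolding connected_iff_connected_component
    using connected_component_box_minus_Zeros[OF f0 fin coprime refl] by blast
qed

text \<open>A zero of a semi-definite polynomial is a local extremum on each line parallel to an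
  axis.\<close>

lemma semidefinite_zero_imp_mderiv_zero:
  assumes "open U" "semidefinite_on l U" "a \<in> U" "meval a l = 0"
  shows "meval a (mderiv x l) = 0"
proof -
  let ?P = "upoly a x l"
  have "open ((\<lambda>t. a(x := t)) -` U)"
  proof -
    have "continuous_on UNIV (\<lambda>t. (a(x := t)) i)" for i by (cases "i = x") auto
    then have "continuous_on UNIV (\<lambda>t. a(x := t))" by (intro continuous_on_coordinatewise_then_product)
    then show ?thesis using assms(1) by (simp add: continuous_on_open_vimage[OF open_UNIV])
  qed
  moreover have "a x \<in> (\<lambda>t. a(x := t)) -` U" using assms by simp
  ultimately obtain e where e: "e > 0" "ball (a x) e \<subseteq> (\<lambda>t. a(x := t)) -` U" by (meson openE)
  have in_U: "a(x := t) \<in> U" if "\<bar>a x - t\<bar> < e" for t using e that by (auto simp: dist_real_def)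
  have P0: "poly ?P (a x) = 0" using assms(4) by (simp add: poly_upoly)
  have D: "DERIV (poly ?P) (a x) :> poly (pderiv ?P) (a x)" by (rule poly_DERIV)
  have "poly (pderiv ?P) (a x) = 0"
  proof (cases "\<forall>a\<in>U. meval a l \<ge> 0")
    case True
    then show ?thesis using DERIV_local_min[OF D e(1)] in_U P0 by (simp add: poly_upoly)
  next
    case False
    then have "\<forall>a\<in>U. meval a l \<le> 0" using assms(2) by (auto simp: semidefinite_on_def)
    then show ?thesis using DERIV_local_max[OF D e(1)] in_U P0 by (simp add: poly_upoly)
  qed
  then show ?thesis using poly_upoly[of a x "mderiv x l" "a x"] by (simp add: upoly_mderiv)
qed

lemma connected_minus_Zeros_semidefinite:
  assumes U: "open U" "connected U" and l: "l = 1 \<or> normal_irreducible l" "semidefinite_on l U"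
  shows "connected (U - Zeros {l})"
proof (cases "l = 1")
  case True
  then show ?thesis using U by (simp add: Zeros_def)
next
  case False
  then have irr: "irreducible l" "mvars l \<noteq> {}" using l by (auto simp: normal_irreducible_def mconst_def)
  then obtain x where x: "x \<in> mvars l" by blast
  have "U - Zeros {l} = U - Zeros {l, mderiv x l}"
    using semidefinite_zero_imp_mderiv_zero[OF U(1) l(2)] by (auto simp: Zeros_def)
  also have "connected \<dots>"
  proof (rule connected_minus_Zeros[OF _ _ _ _ U])
    show "l \<in> {l, mderiv x l}" "l \<noteq> 0" using irr by auto
    show "mvars f \<subseteq> {..<Suc (Max (mvars l \<union> mvars (mderiv x l)))}" if "f \<in> {l, mderiv x l}" for f
      using that by (auto simp: less_Suc_eq_le)
    fix p assume p: "irreducible p" "mvars p \<noteq> {}"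
    show "\<exists>f\<in>{l, mderiv x l}. \<not> p dvd f"
    proof (rule ccontr)
      assume "\<not> ?thesis"
      then have dvd: "p dvd l" "p dvd mderiv x l" by auto
      then obtain u where "l = p * u" by (auto simp: dvd_def)
      moreover then have "u dvd 1" using irr p by (auto simp: irreducible_def)
      ultimately have "l dvd p" by (auto simp: mpoly_unit_iff)
      then show False using dvd not_dvd_mderiv[OF x] dvd_trans by blast
    qed
  qed
  finally show ?thesis .
qed

lemma connected_minus_Zeros_prod:
  assumes "finite F" "open U" "connected U"
    and "\<And>l. l \<in> F \<Longrightarrow> (l = 1 \<or> normal_irreducible l) \<and> semidefinite_on l U"
  shows "connected (U - Zeros {\<Prod>F})"
  using assms
proof (induction F arbitrary: U)
  case empty
  then show ?case by (simp add: Zeros_def)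
next
  case (insert l F)
  have "connected (U - Zeros {l})"
    using insert by (intro connected_minus_Zeros_semidefinite) auto
  then have "connected (U - Zeros {l} - Zeros {\<Prod>F})"
    using insert.prems Zeros_closed by (intro insert.IH) (auto simp: semidefinite_on_def)
  moreover have "U - Zeros {\<Prod>(insert l F)} = U - Zeros {l} - Zeros {\<Prod>F}"
    using insert.hyps by (auto simp: Zeros_def meval.hom_mult)
  ultimately show ?case by simp
qed

section \<open>Local structure near regular points\<close>

text \<open>The neighbourhood constrains the variables of f only; boxes built from it are then
  cylindrical in all other directions.\<close>

lemma local_sign:
  assumes "meval a f \<noteq> 0"
  shows "\<exists>r>0. \<forall>b. (\<forall>i\<in>mvars f. \<bar>b i - a i\<bar> < r) \<longrightarrow> meval b f * meval a f > 0"
proof -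
  have "open {b. 0 < meval b f * meval a f}"
    using continuous_meval[of UNIV f] by (intro open_Collect_less continuous_intros) auto
  moreover have "a \<in> {b. 0 < meval b f * meval a f}" using assms by (auto simp: zero_less_mult_iff linorder_neq_iff)
  ultimately obtain I r where r: "finite I" "r > 0" "pbox a I r \<subseteq> {b. 0 < meval b f * meval a f}"
    by (rule open_contains_pbox)
  have "meval b f * meval a f > 0" if "\<forall>i\<in>mvars f. \<bar>b i - a i\<bar> < r" for b
  proof -
    have "(\<lambda>i. if i \<in> mvars f then b i else a i) \<in> pbox a I r" using that r(2) by (auto simp: pbox_def)
    then have "meval (\<lambda>i. if i \<in> mvars f then b i else a i) f * meval a f > 0" using r(3) by blast
    also have "meval (\<lambda>i. if i \<in> mvars f then b i else a i) f = meval b f" by (rule meval_cong) auto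
    finally show ?thesis .
  qed
  then show ?thesis using r(2) by blast
qed

lemma local_sign_upd:
  assumes "meval (a(y := t)) f \<noteq> 0"
  shows "\<exists>r>0. \<forall>b u. (\<forall>i\<in>mvars f - {y}. \<bar>b i - a i\<bar> < r) \<longrightarrow> \<bar>u - t\<bar> < r \<longrightarrow>
    meval (b(y := u)) f * meval (a(y := t)) f > 0"
proof -
  obtain r where r: "r > 0" "\<And>b. (\<forall>i\<in>mvars f. \<bar>b i - (a(y := t)) i\<bar> < r) \<Longrightarrow> meval b f * meval (a(y := t)) f > 0"
    using local_sign[OF assms] by blast
  have "meval (b(y := u)) f * meval (a(y := t)) f > 0"
    if "\<forall>i\<in>mvars f - {y}. \<bar>b i - a i\<bar> < r" "\<bar>u - t\<bar> < r" for b u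
    by (rule r(2)) (use that in auto)
  then show ?thesis using r(1) by blast
qed

lemma poly_strict_mono_on:
  fixes P :: "real poly"
  assumes "u < v" "\<And>x. u \<le> x \<Longrightarrow> x \<le> v \<Longrightarrow> poly (pderiv P) x > 0"
  shows "poly P u < poly P v"
  by (rule DERIV_pos_imp_increasing[OF assms(1)]) (use assms(2) poly_DERIV in blast)

lemma mvars_poly_mvar:
  assumes "\<And>i. mvars (coeff P i) \<subseteq> Y" "y \<in> Y"
  shows "mvars (poly P (mvar y)) \<subseteq> Y"
  using assms
proof (induction P)
  case (pCons c P)
  have "mvars c \<subseteq> Y" using pCons.prems(1)[of 0] by simp
  moreover have "mvars (coeff P i) \<subseteq> Y" for i using pCons.prems(1)[of "Suc i"] by simp
  ultimately show ?case
    unfolding poly_pCons using pCons by (intro mvars_closed) auto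
qed simp

lemma mvars_mderiv: "mvars (mderiv y q) \<subseteq> mvars q \<union> {y}"
  unfolding mderiv_def
proof (rule mvars_poly_mvar)
  fix i
  have "mvars (coeff (pderiv (as_poly y q)) i) \<subseteq> mvars q - {y}"
    by (intro mvars_coeff_pderiv mvars_coeff_as_poly)
  then show "mvars (coeff (pderiv (as_poly y q)) i) \<subseteq> mvars q \<union> {y}" by blast
qed simp

text \<open>If q is nonzero at height \<open>t0\<close> over a, its sign is constant nearby and
  \<open>t' = t\<close> works. At a simple root q is strictly monotone in y nearby, with opposite
  nonzero signs at \<open>t0 + s\<close> and \<open>t0 - s\<close> over the whole neighbourhood; the
  sign of q at t tells to which of these heights t can be pushed without meeting the root.\<close>

lemma regular_strip:
  assumes reg: "regular_at q y a"
  shows "\<exists>s>0. \<exists>\<rho>>0. \<forall>b t. (\<forall>i\<in>mvars q - {y}. \<bar>b i - a i\<bar> < \<rho>) \<longrightarrow> \<bar>t - t0\<bar> < s \<longrightarrow> meval (b(y := t)) q \<noteq> 0 \<longrightarrow>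
    (\<exists>t'. (\<forall>c. (\<forall>i\<in>mvars q - {y}. \<bar>c i - a i\<bar> < \<rho>) \<longrightarrow> meval (c(y := t')) q \<noteq> 0) \<and>
      (\<forall>u. min t t' \<le> u \<and> u \<le> max t t' \<longrightarrow> meval (b(y := u)) q \<noteq> 0))"
proof (cases "meval (a(y := t0)) q = 0")
  case False
  obtain r where r: "r > 0" "\<And>b u. (\<forall>i\<in>mvars q - {y}. \<bar>b i - a i\<bar> < r) \<Longrightarrow> \<bar>u - t0\<bar> < r \<Longrightarrow>
      meval (b(y := u)) q * meval (a(y := t0)) q > 0"
    using local_sign_upd[OF False] by blast
  show ?thesis
  proof (rule exI[of _ r], rule conjI[OF r(1)], rule exI[of _ r], rule conjI[OF r(1)], intro allI impI)
    fix b t assume b: "\<forall>i\<in>mvars q - {y}. \<bar>b i - a i\<bar> < r" "\<bar>t - t0\<bar> < r"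
    show "\<exists>t'. (\<forall>c. (\<forall>i\<in>mvars q - {y}. \<bar>c i - a i\<bar> < r) \<longrightarrow> meval (c(y := t')) q \<noteq> 0) \<and>
      (\<forall>u. min t t' \<le> u \<and> u \<le> max t t' \<longrightarrow> meval (b(y := u)) q \<noteq> 0)"
    proof (intro exI[of _ t] conjI allI impI)
      show "meval (c(y := t)) q \<noteq> 0" if "\<forall>i\<in>mvars q - {y}. \<bar>c i - a i\<bar> < r" for c
        using r(2)[OF that b(2)] by auto
      show "meval (b(y := u)) q \<noteq> 0" if "min t t \<le> u \<and> u \<le> max t t" for u
        using that r(2)[OF b] by auto
    qed
  qed
next
  case True
  let ?D = "mderiv y q"
  let ?near = "\<lambda>\<rho> b. \<forall>i\<in>mvars q - {y}. \<bar>b i - a i\<bar> < \<rho>"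
  have D: "meval (b(y := t)) ?D = poly (pderiv (upoly b y q)) t" for b t
    by (simp flip: poly_upoly add: upoly_mderiv)
  have "meval (a(y := t0)) ?D \<noteq> 0" using reg True unfolding D by (auto simp: regular_at_def poly_upoly)
  have mD: "mvars ?D - {y} \<subseteq> mvars q - {y}"
    using mvars_mderiv[of y q] by blast
  obtain r where r: "r > 0" "\<And>b u. (\<forall>i\<in>mvars ?D - {y}. \<bar>b i - a i\<bar> < r) \<Longrightarrow> \<bar>u - t0\<bar> < r \<Longrightarrow>
      meval (b(y := u)) ?D * meval (a(y := t0)) ?D > 0"
    using local_sign_upd[OF \<open>meval (a(y := t0)) ?D \<noteq> 0\<close>] by blast
  define \<sigma> where "\<sigma> = meval (a(y := t0)) ?D"
  \<comment> \<open>Multiplication by the derivative at the root makes \<open>Q b\<close> increasing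
    in y, whatever the sign of that derivative.\<close>
  define Q where "Q b = Polynomial.smult \<sigma> (upoly b y q)" for b
  have Q: "poly (Q b) t = \<sigma> * meval (b(y := t)) q" for b t by (simp add: Q_def poly_upoly)
  have Qd: "poly (pderiv (Q b)) t > 0" if "?near r b" "\<bar>t - t0\<bar> < r" for b t
    using r(2)[of b t] that mD by (auto simp: Q_def pderiv_smult D[symmetric] \<sigma>_def mult.commute)
  have mono: "poly (Q b) u < poly (Q b) v" if "?near r b" "\<bar>u - t0\<bar> < r" "\<bar>v - t0\<bar> < r" "u < v" for b u v
    by (rule poly_strict_mono_on[OF \<open>u < v\<close>]) (use that in \<open>auto intro!: Qd\<close>)
  have near_a: "?near r a" using r by simp
  define s where "s = r / 2"
  have s: "s > 0" "s < r" using r by (auto simp: s_def)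
  have Q0: "poly (Q a) t0 = 0" using True by (simp add: Q)
  have hi: "poly (Q a) (t0 + s) > 0" using mono[OF near_a, of t0 "t0 + s"] s Q0 by simp
  have lo: "poly (Q a) (t0 - s) < 0" using mono[OF near_a, of "t0 - s" t0] s Q0 by simp
  have nz: "meval (a(y := t0 + s)) q \<noteq> 0" "meval (a(y := t0 - s)) q \<noteq> 0" using hi lo by (auto simp: Q)
  obtain r1 where r1: "r1 > 0" "\<And>b u. ?near r1 b \<Longrightarrow> \<bar>u - (t0 + s)\<bar> < r1 \<Longrightarrow>
      meval (b(y := u)) q * meval (a(y := t0 + s)) q > 0"
    using local_sign_upd[OF nz(1)] by blast
  obtain r2 where r2: "r2 > 0" "\<And>b u. ?near r2 b \<Longrightarrow> \<bar>u - (t0 - s)\<bar> < r2 \<Longrightarrow>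
      meval (b(y := u)) q * meval (a(y := t0 - s)) q > 0"
    using local_sign_upd[OF nz(2)] by blast
  define \<rho> where "\<rho> = min r (min r1 r2)"
  have \<rho>: "\<rho> > 0" "\<rho> \<le> r" "\<rho> \<le> r1" "\<rho> \<le> r2" using r r1 r2 by (auto simp: \<rho>_def)
  have near: "?near r b" "?near r1 b" "?near r2 b" if "?near \<rho> b" for b
    using that \<rho>(2-4) by (meson less_le_trans)+
  have hi': "meval (b(y := t0 + s)) q \<noteq> 0" if "?near \<rho> b" for b
    using r1(2)[OF near(2)[OF that], of "t0 + s"] r1(1) by auto
  have lo': "meval (b(y := t0 - s)) q \<noteq> 0" if "?near \<rho> b" for b
    using r2(2)[OF near(3)[OF that], of "t0 - s"] r2(1) by auto
  show ?thesis
  proof (rule exI[of _ s], intro conjI s(1), rule exI[of _ \<rho>], intro conjI \<rho>(1) allI impI)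
    fix b t assume b: "?near \<rho> b" "\<bar>t - t0\<bar> < s" "meval (b(y := t)) q \<noteq> 0"
    have \<sigma>: "\<sigma> \<noteq> 0" using \<open>meval (a(y := t0)) ?D \<noteq> 0\<close> by (simp add: \<sigma>_def)
    then have nz: "poly (Q b) t \<noteq> 0" using b(3) by (simp add: Q)
    have mono_b: "poly (Q b) u \<le> poly (Q b) v" if "\<bar>u - t0\<bar> \<le> s" "\<bar>v - t0\<bar> \<le> s" "u \<le> v" for u v
      using mono[OF near(1)[OF b(1)], of u v] that s by (cases "u = v") auto
    show "\<exists>t'. (\<forall>c. ?near \<rho> c \<longrightarrow> meval (c(y := t')) q \<noteq> 0) \<and>
      (\<forall>u. min t t' \<le> u \<and> u \<le> max t t' \<longrightarrow> meval (b(y := u)) q \<noteq> 0)"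
    proof (cases "poly (Q b) t > 0")
      case True
      have "meval (b(y := u)) q \<noteq> 0" if "min t (t0 + s) \<le> u \<and> u \<le> max t (t0 + s)" for u
      proof -
        have "poly (Q b) t \<le> poly (Q b) u" using that b(2) by (intro mono_b) (auto simp: abs_le_iff abs_less_iff)
        then show ?thesis using True by (auto simp: Q)
      qed
      then show ?thesis using hi' by blast
    next
      case False
      have "meval (b(y := u)) q \<noteq> 0" if "min t (t0 - s) \<le> u \<and> u \<le> max t (t0 - s)" for u
      proof -
        have "poly (Q b) u \<le> poly (Q b) t" using that b(2) by (intro mono_b) (auto simp: abs_le_iff abs_less_iff)
        then show ?thesis using False nz by (auto simp: Q)
      qed
      then show ?thesis using lo' by blast
    qed
  qed
qed

text \<open>Substituting \<open>t = 1/s\<close> and clearing denominators turns the behaviour for large \<open>t\<close> into that at \<open>s = 0\<close>,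
  where the leading coefficient decides.\<close>

lemma nonzero_at_infinity:
  assumes "meval a (lc q y) \<noteq> 0"
  shows "\<exists>M. \<exists>\<rho>>0. \<forall>b t. (\<forall>i\<in>mvars q - {y}. \<bar>b i - a i\<bar> < \<rho>) \<longrightarrow> \<bar>t\<bar> > M \<longrightarrow> meval (b(y := t)) q \<noteq> 0"
proof -
  define d where "d = mdeg q y"
  define H where "H = (\<Sum>i\<le>d. coeff (as_poly y q) i * mvar y ^ (d - i))"
  have H: "meval (b(y := s)) H = (\<Sum>i\<le>d. coeff (upoly b y q) i * s ^ (d - i))" for b s
  proof -
    have "meval (b(y := s)) (coeff (as_poly y q) i) = coeff (upoly b y q) i" for i
      unfolding coeff_upoly by (rule meval_cong) (use mvars_coeff_as_poly[of y q i] in auto)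
    then show ?thesis by (simp add: H_def meval.hom_sum meval.hom_mult meval.hom_power)
  qed
  have "meval (a(y := 0)) H = (\<Sum>i\<le>d. if i = d then coeff (upoly a y q) d else 0)"
    unfolding H by (intro sum.cong) (auto simp: power_0_left)
  also have "\<dots> = meval a (lc q y)" by (simp add: coeff_upoly lc_def d_def mdeg_def)
  finally obtain r where r: "r > 0" "\<And>b u. (\<forall>i\<in>mvars H - {y}. \<bar>b i - a i\<bar> < r) \<Longrightarrow> \<bar>u - 0\<bar> < r \<Longrightarrow>
      meval (b(y := u)) H * meval (a(y := 0)) H > 0"
    using local_sign_upd[of a y 0 H] assms by auto
  have mH: "mvars H - {y} \<subseteq> mvars q - {y}"
  proof -
    have "mvars H \<subseteq> mvars q \<union> {y}"
      unfolding H_def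
      by (intro order_trans[OF mvars_sum] UN_least mvars_closed) (use mvars_coeff_as_poly in auto)
    then show ?thesis by blast
  qed
  have "meval (b(y := t)) q \<noteq> 0" if b: "\<forall>i\<in>mvars q - {y}. \<bar>b i - a i\<bar> < r" and t: "\<bar>t\<bar> > 1 / r" for b t
  proof -
    have t0: "t \<noteq> 0" using t r(1) by auto
    have "1 < \<bar>t\<bar> * r" using t r(1) by (simp add: pos_divide_less_eq)
    then have "\<bar>1 / t\<bar> < r" using t0 by (simp add: abs_divide pos_divide_less_eq mult.commute)
    then have nz: "meval (b(y := 1 / t)) H \<noteq> 0" using r(2)[of b "1 / t"] b subsetD[OF mH] by auto
    have "degree (upoly b y q) \<le> d" unfolding upoly_def d_def mdeg_def by (rule degree_map_poly_le)
    then have "poly (upoly b y q) t = poly (\<Sum>i\<le>d. monom (coeff (upoly b y q) i) i) t"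
      by (simp only: poly_as_sum_of_monoms')
    also have "\<dots> = (\<Sum>i\<le>d. coeff (upoly b y q) i * t ^ i)" by (simp add: poly_sum poly_monom)
    also have "\<dots> = (\<Sum>i\<le>d. t ^ d * (coeff (upoly b y q) i * (1 / t) ^ (d - i)))"
      by (intro sum.cong refl) (use t0 in \<open>auto simp: power_diff power_divide field_simps\<close>)
    also have "\<dots> = t ^ d * meval (b(y := 1 / t)) H" unfolding H sum_distrib_left ..
    finally show ?thesis using nz t0 by (simp add: poly_upoly)
  qed
  then show ?thesis using r(1) by blast
qed

text \<open>A weak form of delineability: near a regular point every point off the zero set can be moved vertically,
  without crossing the zero set, to a height at which the whole neighbourhood is free of zeros.\<close>

lemma regular_local:
  assumes reg: "regular_at q y a"
  shows "\<exists>\<rho>>0. \<forall>b t. (\<forall>i\<in>mvars q - {y}. \<bar>b i - a i\<bar> < \<rho>) \<longrightarrow> meval (b(y := t)) q \<noteq> 0 \<longrightarrow>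
    (\<exists>t'. (\<forall>c. (\<forall>i\<in>mvars q - {y}. \<bar>c i - a i\<bar> < \<rho>) \<longrightarrow> meval (c(y := t')) q \<noteq> 0) \<and>
      (\<forall>u. min t t' \<le> u \<and> u \<le> max t t' \<longrightarrow> meval (b(y := u)) q \<noteq> 0))"
proof -
  let ?near = "\<lambda>\<rho> b. \<forall>i\<in>mvars q - {y}. \<bar>b i - a i\<bar> < \<rho>"
  let ?good = "\<lambda>\<rho> b t t'. (\<forall>c. ?near \<rho> c \<longrightarrow> meval (c(y := t')) q \<noteq> 0) \<and>
      (\<forall>u. min t t' \<le> u \<and> u \<le> max t t' \<longrightarrow> meval (b(y := u)) q \<noteq> 0)"
  obtain M \<rho>1 where M: "\<rho>1 > 0" "\<And>b t. ?near \<rho>1 b \<Longrightarrow> \<bar>t\<bar> > M \<Longrightarrow> meval (b(y := t)) q \<noteq> 0"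
    using nonzero_at_infinity reg unfolding regular_at_def by blast
  have "\<forall>t0. \<exists>s r. s > 0 \<and> r > 0 \<and> (\<forall>b t. ?near r b \<longrightarrow> \<bar>t - t0\<bar> < s \<longrightarrow> meval (b(y := t)) q \<noteq> 0 \<longrightarrow>
      (\<exists>t'. ?good r b t t'))"
    using regular_strip[OF reg] by blast
  then obtain s r where sr: "\<And>t0. s t0 > 0" "\<And>t0. r t0 > 0"
    "\<And>t0 b t. ?near (r t0) b \<Longrightarrow> \<bar>t - t0\<bar> < s t0 \<Longrightarrow> meval (b(y := t)) q \<noteq> 0 \<Longrightarrow> \<exists>t'. ?good (r t0) b t t'"
    by metis
  \<comment> \<open>Beyond M there are no zeros; finitely many strips cover the remaining heights,
    so one radius in the base serves all of them.\<close>
  have "compact {-M..M}" by simp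
  moreover have "{-M..M} \<subseteq> (\<Union>t0\<in>{-M..M}. ball t0 (s t0))" using sr(1) by force
  ultimately obtain T where T: "T \<subseteq> {-M..M}" "finite T" "{-M..M} \<subseteq> (\<Union>t0\<in>T. ball t0 (s t0))"
    by (elim compactE_image[where C = "{-M..M}" and f = "\<lambda>t0. ball t0 (s t0)"]) auto
  define \<rho> where "\<rho> = Min (insert \<rho>1 (r ` T))"
  have \<rho>: "\<rho> > 0" "\<rho> \<le> \<rho>1" using M sr T by (auto simp: \<rho>_def)
  have \<rho>T: "\<rho> \<le> r t0" if "t0 \<in> T" for t0 unfolding \<rho>_def using that T by (intro Min_le) auto
  have weaken: "?near \<rho>' b" if "?near \<rho> b" "\<rho> \<le> \<rho>'" for \<rho>' b using that by force
  show ?thesis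
  proof (rule exI[of _ \<rho>], rule conjI[OF \<rho>(1)], intro allI impI)
    fix b t assume b: "?near \<rho> b" "meval (b(y := t)) q \<noteq> 0"
    show "\<exists>t'. ?good \<rho> b t t'"
    proof (cases "\<bar>t\<bar> > M")
      case True
      have "meval (c(y := t)) q \<noteq> 0" if "?near \<rho> c" for c using M(2)[OF weaken[OF that \<rho>(2)] True] .
      then show ?thesis using b(2) by (intro exI[of _ t]) auto
    next
      case False
      then have "t \<in> {-M..M}" by auto
      then obtain t0 where t0: "t0 \<in> T" "\<bar>t - t0\<bar> < s t0" using T(3) by (force simp: dist_real_def abs_minus_commute)
      from sr(3)[OF weaken[OF b(1) \<rho>T[OF t0(1)]] t0(2) b(2)] obtain t' where "?good (r t0) b t t'" ..
      then have "?good \<rho> b t t'" using weaken[OF _ \<rho>T[OF t0(1)]] by blast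
      then show ?thesis ..
    qed
  qed
qed

section \<open>Cylindrical sets and sectors over a box\<close>

lemma cylindricalD: "cylindrical Y A \<Longrightarrow> a \<in> A \<Longrightarrow> (\<And>i. i \<notin> Y \<Longrightarrow> a i = b i) \<Longrightarrow> b \<in> A"
  unfolding cylindrical_def by blast

lemma cylindrical_pbox: "Y \<inter> I = {} \<Longrightarrow> cylindrical Y (pbox a I r)"
  unfolding cylindrical_def pbox_def by force

lemma cylindrical_subset: "cylindrical Y A \<Longrightarrow> Z \<subseteq> Y \<Longrightarrow> cylindrical Z A"
  unfolding cylindrical_def by (meson subsetD)

lemma cylindrical_Int: "cylindrical Y A \<Longrightarrow> cylindrical Y B \<Longrightarrow> cylindrical Y (A \<inter> B)"
  unfolding cylindrical_def by (metis Int_iff)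

lemma cylindrical_nonzero: "Y \<inter> mvars g = {} \<Longrightarrow> cylindrical Y {a. meval a g \<noteq> 0}"
  unfolding cylindrical_def
proof (intro ballI allI impI)
  fix a b assume "Y \<inter> mvars g = {}" "a \<in> {a. meval a g \<noteq> 0}" "\<forall>i. i \<notin> Y \<longrightarrow> a i = b i"
  moreover then have "meval a g = meval b g" by (intro meval_cong) auto
  ultimately show "b \<in> {a. meval a g \<noteq> 0}" by simp
qed

lemma cylindrical_component:
  assumes "cylindrical Y A" shows "cylindrical Y (connected_component_set A c)"
  unfolding cylindrical_def
proof (intro ballI allI impI)
  fix a b assume a: "a \<in> connected_component_set A c" and b: "\<forall>i. i \<notin> Y \<longrightarrow> a i = b i"
  have "a \<in> A" using a connected_component_in by blast
  then have "line a b t \<in> A" for t by (rule cylindricalD[OF assms]) (use b in \<open>auto simp: line_def\<close>)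
  then have "connected_component A a b" by (intro connected_component_line)
  then show "b \<in> connected_component_set A c" using a connected_component_trans by fastforce
qed

lemma cylindrical_open_contains_pbox:
  assumes "open U" "a \<in> U" "cylindrical Y U"
  obtains I r where "finite I" "I \<inter> Y = {}" "r > 0" "pbox a I r \<subseteq> U"
proof -
  obtain I r where I: "finite I" "r > 0" "pbox a I r \<subseteq> U"
    using assms(1,2) by (rule open_contains_pbox)
  have "pbox a (I - Y) r \<subseteq> U"
  proof
    fix b assume b: "b \<in> pbox a (I - Y) r"
    then have "(\<lambda>i. if i \<in> Y then a i else b i) \<in> pbox a I r" using I(2) by (auto simp: pbox_def)
    then have "(\<lambda>i. if i \<in> Y then a i else b i) \<in> U" using I by blast
    then show "b \<in> U" by (rule cylindricalD[OF assms(3)]) auto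
  qed
  then show ?thesis using that[of "I - Y" r] I by auto
qed

text \<open>W is the component of b in the part of a small box B where g is nonzero. With the height
  t from \<open>regular_local\<close>, the vertical segment from b to height t stays in W, and the
  image of B at height t is connected and free of zeros, hence in W too. So W projects onto B. As g
  involves no variable of \<open>Y - {y}\<close>, W is cylindrical in these, as the recursion over
  the variables requires.\<close>

lemma sector_exists:
  assumes reg: "regular_at q y a" "\<And>b. meval b q = 0 \<longleftrightarrow> meval b g = 0" "mvars q \<subseteq> mvars g"
    and g: "mvars g \<inter> (Y - {y}) = {}" and y: "y \<in> Y"
    and U: "open U" "cylindrical Y U" "a \<in> U"
  obtains B where "open B" "a \<in> B" "B \<subseteq> U" "cylindrical Y B"
    "\<And>b. b \<in> B \<Longrightarrow> meval b g \<noteq> 0 \<Longrightarrow> \<exists>W t. open W \<and> connected W \<and> b \<in> W \<and> W \<subseteq> B \<inter> {c. meval c g \<noteq> 0} \<and>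
      cylindrical (Y - {y}) W \<and> (\<forall>c\<in>B. c(y := t) \<in> W) \<and>
      (\<forall>C. connected C \<longrightarrow> C \<subseteq> B \<inter> {c. meval c g \<noteq> 0} \<longrightarrow> C \<inter> W \<noteq> {} \<longrightarrow> C \<subseteq> W)"
proof -
  obtain I r where I: "finite I" "I \<inter> Y = {}" "r > 0" "pbox a I r \<subseteq> U"
    using U(1,3,2) by (rule cylindrical_open_contains_pbox)
  let ?M = "mvars q - {y}"
  obtain \<rho> where \<rho>: "\<rho> > 0"
    "\<And>b t. (\<forall>i\<in>?M. \<bar>b i - a i\<bar> < \<rho>) \<Longrightarrow> meval (b(y := t)) q \<noteq> 0 \<Longrightarrow>
      \<exists>t'. (\<forall>c. (\<forall>i\<in>?M. \<bar>c i - a i\<bar> < \<rho>) \<longrightarrow> meval (c(y := t')) q \<noteq> 0) \<and>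
      (\<forall>u. min t t' \<le> u \<and> u \<le> max t t' \<longrightarrow> meval (b(y := u)) q \<noteq> 0)"
    using regular_local[OF reg(1)] by blast
  define s where "s = min r \<rho>"
  define B where "B = pbox a (I \<union> ?M) s"
  have near: "\<forall>i\<in>?M. \<bar>b i - a i\<bar> < \<rho>" if "b \<in> B" for b using that by (auto simp: B_def pbox_def s_def)
  have "open B" unfolding B_def using I by (intro open_pbox) auto
  have "a \<in> B" unfolding B_def s_def using I \<rho> by (intro center_in_pbox) auto
  have "B \<subseteq> U" using I(4) by (auto simp: B_def pbox_def s_def)
  have "Y \<inter> (I \<union> ?M) = {}" using I(2) g reg(3) by auto
  then have "cylindrical Y B" unfolding B_def by (rule cylindrical_pbox)
  let ?N = "B \<inter> {c. meval c g \<noteq> 0}"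
  have "open ?N" using \<open>open B\<close> open_meval_nonzero by (intro open_Int)
  have "\<exists>W t. open W \<and> connected W \<and> b \<in> W \<and> W \<subseteq> ?N \<and>
      cylindrical (Y - {y}) W \<and> (\<forall>c\<in>B. c(y := t) \<in> W) \<and>
      (\<forall>C. connected C \<longrightarrow> C \<subseteq> ?N \<longrightarrow> C \<inter> W \<noteq> {} \<longrightarrow> C \<subseteq> W)"
    if b: "b \<in> B" "meval b g \<noteq> 0" for b
  proof -
    define W where "W = connected_component_set ?N b"
    have upd: "c(y := t) \<in> B" if "c \<in> B" for c t
      by (rule cylindricalD[OF \<open>cylindrical Y B\<close> that]) (use y in auto)
    have "meval (b(y := b y)) q \<noteq> 0" using b(2) reg(2) by simp
    from \<rho>(2)[OF near[OF b(1)] this] obtain t where t: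
      "\<And>c. \<forall>i\<in>?M. \<bar>c i - a i\<bar> < \<rho> \<Longrightarrow> meval (c(y := t)) q \<noteq> 0"
      "\<And>u. min (b y) t \<le> u \<Longrightarrow> u \<le> max (b y) t \<Longrightarrow> meval (b(y := u)) q \<noteq> 0" by blast
    have "b \<in> W" using b by (simp add: W_def connected_component_refl)
    have conn: "connected_component ?N b (b(y := t))"
    proof (rule connected_component_line)
      fix v :: real assume v: "0 \<le> v" "v \<le> 1"
      have eq: "line b (b(y := t)) v = b(y := b y + v * (t - b y))" by (auto simp: line_def)
      have "min (b y) t \<le> b y + v * (t - b y) \<and> b y + v * (t - b y) \<le> max (b y) t"
      proof (cases "b y \<le> t")
        case True
        then have "0 \<le> v * (t - b y)" "v * (t - b y) \<le> 1 * (t - b y)"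
          using v mult_right_mono[of v 1 "t - b y"] by auto
        then show ?thesis using True by auto
      next
        case False
        then have "0 \<le> v * (b y - t)" "v * (b y - t) \<le> 1 * (b y - t)"
          using v mult_right_mono[of v 1 "b y - t"] by auto
        then show ?thesis using False by (auto simp: algebra_simps)
      qed
      then show "line b (b(y := t)) v \<in> ?N" unfolding eq using t(2) upd[OF b(1)] reg(2) by blast
    qed
    have eqW: "connected_component_set ?N (b(y := t)) = W"
      unfolding W_def by (rule connected_component_eq) (use conn in simp)
    have "(\<lambda>c. c(y := t)) ` B \<subseteq> ?N" using upd t(1) near reg(2) by blast
    moreover have "connected ((\<lambda>c. c(y := t)) ` B)"
    proof (intro connected_continuous_image continuous_on_coordinatewise_then_product)
      show "continuous_on B (\<lambda>c. (c(y := t)) i)" for i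
        by (cases "i = y") (auto intro: continuous_on_subset[OF continuous_on_product_coordinates])
      show "connected B" unfolding B_def by (rule connected_pbox)
    qed
    moreover have "b(y := t) \<in> (\<lambda>c. c(y := t)) ` B" using b by blast
    ultimately have "(\<lambda>c. c(y := t)) ` B \<subseteq> W"
      unfolding eqW[symmetric] by (intro connected_component_maximal)
    then have "\<forall>c\<in>B. c(y := t) \<in> W" by blast
    moreover have "cylindrical (Y - {y}) ?N"
      using \<open>cylindrical Y B\<close> g by (intro cylindrical_Int cylindrical_nonzero) (auto intro: cylindrical_subset)
    then have "cylindrical (Y - {y}) W" unfolding W_def by (rule cylindrical_component)
    moreover have "C \<subseteq> W" if C: "connected C" "C \<subseteq> ?N" "C \<inter> W \<noteq> {}" for C
    proof -
      obtain c where "c \<in> C" "c \<in> W" using C by blast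
      then show ?thesis using C connected_component_maximal[of c C ?N] connected_component_eq[of c ?N b]
        by (auto simp: W_def)
    qed
    moreover have "open W" unfolding W_def using \<open>open ?N\<close> by (rule open_connected_component_set)
    moreover have "connected W" "W \<subseteq> ?N"
      unfolding W_def by (rule connected_connected_component, rule connected_component_subset)
    ultimately show ?thesis using \<open>b \<in> W\<close> by blast
  qed
  then show ?thesis using that \<open>open B\<close> \<open>a \<in> B\<close> \<open>B \<subseteq> U\<close> \<open>cylindrical Y B\<close> by blast
qed

section \<open>Projections of cells\<close>

lemma connected_minus_Np_wrt:
  assumes ys: "ys \<noteq> []" "distinct ys" "\<And>y. y \<in> set ys \<Longrightarrow> discrim f y \<noteq> 0"
    and U: "open U" "connected U" "\<And>a. a \<in> U \<Longrightarrow> meval a (Np f ys) \<noteq> 0"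
    and semi: "\<And>y g. y \<in> set ys \<Longrightarrow> g \<in> Np1 f y \<Longrightarrow> semidefinite_on g U"
  shows "connected (U - Zeros (Np_wrt f ys ` set ys))"
proof (cases "length ys \<ge> 2")
  case False
  then obtain y where y: "ys = [y]" using ys(1) by (cases ys; cases "tl ys") auto
  note P = Ocd_Ecd_props[OF ys(3)]
  have "connected (U - Zeros {\<Prod>(Np1 f y)})"
  proof (rule connected_minus_Zeros_prod[OF _ U(1,2)])
    show "finite (Np1 f y)" using P(1)[of y] y by (simp add: Np1_def)
    show "(l = 1 \<or> normal_irreducible l) \<and> semidefinite_on l U" if "l \<in> Np1 f y" for l
      using that P(3)[of y l] semi[of y l] y by (auto simp: Np1_def)
  qed
  then show ?thesis by (simp add: y Np_wrt_def)
next
  case True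
  define A where "A = Np_wrt f ys ` set ys"
  have g: "Np f ys = mgcd A" unfolding A_def using True by (rule Np_eq_mgcd_Np_wrt)
  obtain y where "y \<in> set ys" using ys(1) by (cases ys) auto
  then have h0: "Np_wrt f ys y \<in> A" "Np_wrt f ys y \<noteq> 0" using Np_props(3)[OF ys] by (auto simp: A_def)
  note gcd = mgcd_props[OF h0]
  \<comment> \<open>The cofactors of the gcd have no common irreducible factor, and on U, where the
    gcd does not vanish, they have the same common zeros as A.\<close>
  define P where "P = {k. mgcd A * k \<in> A}"
  have A: "\<exists>k\<in>P. h = mgcd A * k" if "h \<in> A" for h
    using gcd(1)[OF that] that by (auto simp: P_def dvd_def)
  have Anz: "h \<noteq> 0" "mvars h \<subseteq> mvars f" if "h \<in> A" for h
    using that Np_props(3,4)[OF ys] by (auto simp: A_def)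
  have "U - Zeros A = U - Zeros P"
  proof -
    have "a \<in> Zeros A \<longleftrightarrow> a \<in> Zeros P" if "a \<in> U" for a
    proof -
      have nz: "meval a (mgcd A) \<noteq> 0" using U(3)[OF that] g by simp
      have "a \<in> Zeros P" if "a \<in> Zeros A"
        using that nz by (auto simp: Zeros_def P_def meval.hom_mult)
      moreover have "a \<in> Zeros A" if "a \<in> Zeros P"
        using that A by (auto simp: Zeros_def) (metis meval.hom_mult mult_zero_right)
      ultimately show ?thesis by blast
    qed
    then show ?thesis by blast
  qed
  moreover have "connected (U - Zeros P)"
  proof -
    obtain k0 where k0: "k0 \<in> P" "Np_wrt f ys y = mgcd A * k0" using A[OF h0(1)] by blast
    obtain N where N: "mvars f \<subseteq> {..<N}" using finite_nat_bounded[OF finite_mvars] by blast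
    show ?thesis
    proof (rule connected_minus_Zeros[OF k0(1) _ _ _ U(1,2)])
      show "k0 \<noteq> 0" using k0 h0 by auto
      show "mvars k \<subseteq> {..<N}" if "k \<in> P" for k
      proof -
        have "mgcd A * k \<in> A" using that by (simp add: P_def)
        then have "mvars k \<subseteq> mvars f" using Anz[of "mgcd A * k"] mvars_mult[of "mgcd A" k] by auto
        then show ?thesis using N by blast
      qed
      fix p assume p: "irreducible p" "mvars p \<noteq> {}"
      show "\<exists>k\<in>P. \<not> p dvd k"
      proof (rule ccontr)
        assume "\<not> ?thesis"
        then have "mgcd A * p dvd h" if "h \<in> A" for h using A[OF that] by (auto intro: mult_dvd_mono)
        then have "mgcd A * p dvd mgcd A * 1" using gcd(2) by simp
        then have "p dvd 1" using gcd(3) unfolding dvd_mult_cancel_left by blast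
        then show False using p by (auto simp: irreducible_def)
      qed
    qed
  qed
  ultimately show ?thesis by (simp add: A_def)
qed

lemma Np0_props:
  assumes "distinct ys" "\<And>y. y \<in> set ys \<Longrightarrow> discrim f y \<noteq> 0" "f \<noteq> 0"
  shows "Np0 f ys \<noteq> 0" "mvars (Np0 f ys) \<subseteq> mvars f - set ys"
  using Np_props(1,2)[OF _ assms(1,2)] assms(3) by (cases "ys = []"; simp add: Np0_def)+

text \<open>What is used of a component of \<open>{f \<noteq> 0}\<close> in the whole space of sequences.\<close>

definition saturated :: "mpoly \<Rightarrow> (nat \<Rightarrow> real) set \<Rightarrow> bool" where
  "saturated f V \<longleftrightarrow> open V \<and> (\<forall>C. connected C \<longrightarrow> C \<subseteq> {a. meval a f \<noteq> 0} \<longrightarrow> C \<inter> V \<noteq> {} \<longrightarrow> C \<subseteq> V)"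

text \<open>Density cannot be improved to surjectivity: for \<open>f = (x\<^sub>1\<^sup>2 + x\<^sub>2\<^sup>2) q\<close> no cell has a point over \<open>x\<^sub>1 = x\<^sub>2 = 0\<close>.\<close>

lemma projection_dense:
  assumes V: "saturated f V" and "f \<noteq> 0"
    and "distinct ys" "\<And>y. y \<in> set ys \<Longrightarrow> discrim f y \<noteq> 0"
    and "open U" "connected U" "cylindrical (set ys) U" "\<And>a. a \<in> U \<Longrightarrow> meval a (Np0 f ys) \<noteq> 0"
    and "\<And>y g. y \<in> set ys \<Longrightarrow> g \<in> Np1 f y \<Longrightarrow> semidefinite_on g U"
    and "U \<inter> V \<noteq> {}" "open O'" "O' \<subseteq> U" "O' \<noteq> {}" "cylindrical (set ys) O'"
  shows "O' \<inter> V \<noteq> {}"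
  using assms(3-)
proof (induction "length ys" arbitrary: ys U O' rule: less_induct)
  case (less ys U O')
  note ys = less.prems(1,2) and U = less.prems(3-6) and semi = less.prems(7)
  show ?case
  proof (cases "ys = []")
    case True
    then have "U \<subseteq> {a. meval a f \<noteq> 0}" using U(4) by (auto simp: Np0_def)
    then have "U \<subseteq> V" using V U(2) less.prems(8) by (auto simp: saturated_def)
    then show ?thesis using less.prems by blast
  next
    case False
    have Np: "meval a (Np f ys) \<noteq> 0" if "a \<in> U" for a using U(4)[OF that] False by (simp add: Np0_def)
    define S where "S = U - Zeros (Np_wrt f ys ` set ys)"
    have conn: "connected S" unfolding S_def
      using False ys U(1,2) Np semi by (intro connected_minus_Np_wrt) auto
    obtain y0 where y0: "y0 \<in> set ys" using False by (cases ys) auto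
    have dense: "X \<inter> S \<noteq> {}" if X: "open X" "X \<subseteq> U" "X \<noteq> {}" for X
    proof -
      have "Np_wrt f ys y0 \<noteq> 0" using Np_props(3)[OF False ys y0] .
      then obtain b where "b \<in> X" "meval b (Np_wrt f ys y0) \<noteq> 0"
        using nonzero_dense X by blast
      then show ?thesis using X y0 by (auto simp: S_def Zeros_def)
    qed
    have openV: "open V" using V by (simp add: saturated_def)
    \<comment> \<open>Cylindrical test sets Q speak about the projection of V along ys: A is the
      exterior of the projection, D the interior of its closure. Both are open and they are
      disjoint; the point is that they cover S.\<close>
    define A where "A = \<Union>{Q. open Q \<and> cylindrical (set ys) Q \<and> Q \<inter> V = {}}"
    define D where "D = \<Union>{B. open B \<and> (\<forall>Q. open Q \<longrightarrow> cylindrical (set ys) Q \<longrightarrow> Q \<inter> B \<noteq> {} \<longrightarrow> Q \<inter> V \<noteq> {})}"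
    have "S \<subseteq> A \<union> D"
    proof
      fix a assume a: "a \<in> S"
      \<comment> \<open>The usable variable y depends on the point a.\<close>
      then obtain y where y: "y \<in> set ys" "meval a (Np_wrt f ys y) \<noteq> 0" by (auto simp: S_def Zeros_def)
      have aU: "a \<in> U" using a by (simp add: S_def)
      let ?zs = "remove1 y ys"
      have zs: "set ?zs = set ys - {y}" "distinct ?zs" "length ?zs < length ys"
        using ys(1) y(1) length_pos_if_in_set[OF y(1)] by (auto simp: set_remove1_eq length_remove1)
      define g where "g = Np0 f ?zs"
      have zsd: "discrim f z \<noteq> 0" if "z \<in> set ?zs" for z using that zs ys(2) by auto
      have g: "g \<noteq> 0" "mvars g \<inter> (set ys - {y}) = {}"
        using Np0_props[OF zs(2) zsd \<open>f \<noteq> 0\<close>] unfolding g_def zs(1) by blast+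
      obtain q where q: "regular_at q y a" "\<And>b. meval b q = 0 \<longleftrightarrow> meval b g = 0" "mvars q \<subseteq> mvars g"
        using Np0_regular[OF y(1) ys \<open>f \<noteq> 0\<close> Np[OF aU] y(2)] unfolding g_def by blast
      obtain B where B: "open B" "a \<in> B" "B \<subseteq> U" "cylindrical (set ys) B" and
        sec: "\<And>b. b \<in> B \<Longrightarrow> meval b g \<noteq> 0 \<Longrightarrow> \<exists>W t. open W \<and> connected W \<and> b \<in> W \<and> W \<subseteq> B \<inter> {c. meval c g \<noteq> 0} \<and>
      cylindrical (set ys - {y}) W \<and> (\<forall>c\<in>B. c(y := t) \<in> W) \<and>
      (\<forall>C. connected C \<longrightarrow> C \<subseteq> B \<inter> {c. meval c g \<noteq> 0} \<longrightarrow> C \<inter> W \<noteq> {} \<longrightarrow> C \<subseteq> W)"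
        by (rule sector_exists[OF q g(2) y(1) U(1,3) aU]) blast
      show "a \<in> A \<union> D"
      proof (cases "B \<inter> V = {}")
        case True
        then show ?thesis using B by (auto simp: A_def)
      next
        case False
        then obtain b0 where "b0 \<in> B \<inter> V" by blast
        \<comment> \<open>A point of V in B may be a zero of g; as V and B are open, it can be moved
          off the zeros.\<close>
        from nonzero_dense[OF g(1) open_Int[OF B(1) openV] this]
        obtain b where b: "b \<in> B \<inter> V" "meval b g \<noteq> 0" by blast
        have "b \<in> B" using b by blast
        from sec[OF this b(2)] obtain W t where W: "open W" "connected W" "b \<in> W" "W \<subseteq> B \<inter> {c. meval c g \<noteq> 0}"
          "cylindrical (set ys - {y}) W" "\<forall>c\<in>B. c(y := t) \<in> W" by (elim exE conjE)
        have "Q \<inter> V \<noteq> {}" if Q: "open Q" "cylindrical (set ys) Q" "Q \<inter> B \<noteq> {}" for Q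
        proof -
          obtain c where c: "c \<in> Q" "c \<in> B" using Q by blast
          \<comment> \<open>Q is cylindrical in y, so c can be moved within Q to the height t, which
            lies in W over all of B. This makes \<open>Q \<inter> W\<close> a nonempty test set for
            the induction hypothesis on the region W.\<close>
          have "c(y := t) \<in> Q" by (rule cylindricalD[OF Q(2) c(1)]) (use y in auto)
          then have ne: "Q \<inter> W \<noteq> {}" using W(6) c(2) by blast
          have "Q \<inter> W \<inter> V \<noteq> {}"
          proof (rule less.hyps[OF zs(3) zs(2) zsd W(1,2)])
            show "cylindrical (set ?zs) W" using W(5) zs(1) by simp
            show "meval a (Np0 f ?zs) \<noteq> 0" if "a \<in> W" for a using that W(4) by (auto simp: g_def)
            show "semidefinite_on h W" if "z \<in> set ?zs" "h \<in> Np1 f z" for z h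
              using semi[of z h] that zs(1) W(4) B(3) unfolding semidefinite_on_def by blast
            show "W \<inter> V \<noteq> {}" using b W by blast
            show "open (Q \<inter> W)" using Q W by blast
            show "cylindrical (set ?zs) (Q \<inter> W)"
              using W(5) zs(1) cylindrical_subset[OF Q(2), of "set ?zs"] by (intro cylindrical_Int) auto
          qed (use ne in auto)
          then show ?thesis by blast
        qed
        then have "B \<subseteq> D" using B(1) by (auto simp: D_def)
        then show ?thesis using B by blast
      qed
    qed
    moreover have "A \<inter> D \<inter> S = {}" by (auto simp: A_def D_def)
    moreover have "open A" "open D" by (auto simp: A_def D_def)
    ultimately have "A \<inter> S = {} \<or> D \<inter> S = {}" using connectedD[OF conn] by blast
    moreover have "D \<inter> S \<noteq> {}"
    proof -
      obtain a where "a \<in> U \<inter> V \<inter> S" using dense[of "U \<inter> V"] U(1) openV less.prems(8) by (auto simp: open_Int)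
      then show ?thesis using \<open>S \<subseteq> A \<union> D\<close> by (auto simp: A_def)
    qed
    ultimately have AS: "A \<inter> S = {}" by blast
    show ?thesis
    proof
      assume "O' \<inter> V = {}"
      then have "O' \<subseteq> A" using less.prems by (auto simp: A_def)
      then show False using dense[of O'] AS less.prems by blast
    qed
  qed
qed

section \<open>Tracking a cell through the sampling\<close>

definition trunc :: "nat \<Rightarrow> (nat \<Rightarrow> real) \<Rightarrow> nat \<Rightarrow> real" where
  "trunc m a = (\<lambda>i. if i < m then a i else 0)"

lemma trunc_id: "(\<And>i. i \<ge> m \<Longrightarrow> a i = 0) \<Longrightarrow> trunc m a = a"
  by (auto simp: trunc_def)

lemma continuous_trunc: "continuous_on A (trunc m)"
proof (rule continuous_on_coordinatewise_then_product)
  show "continuous_on A (\<lambda>a. trunc m a i)" for i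
    by (cases "i < m") (auto simp: trunc_def intro: continuous_on_subset[OF continuous_on_product_coordinates])
qed

lemma meval_trunc: "mvars h \<subseteq> {..<m} \<Longrightarrow> meval (trunc m a) h = meval a h"
  by (rule meval_cong) (auto simp: trunc_def)

text \<open>Pulling back along \<open>trunc m\<close> turns a cell of R^m into a cylinder of the
  sequence space that is again a maximal connected set: \<open>trunc m\<close> maps connected sets
  to connected sets without changing h, and every point of the cylinder is joined to its truncation
  by a segment in it.\<close>

lemma open_cell_lift:
  assumes C: "C \<in> open_cells (Euclidean_space m) (\<lambda>a. meval a h)" and h: "mvars h \<subseteq> {..<m}"
  defines "L \<equiv> trunc m -` C"
  shows "saturated h L" "connected L" "L \<subseteq> {a. meval a h \<noteq> 0}"
    and "C = L \<inter> topspace (Euclidean_space m)" "C \<noteq> {}"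
proof -
  define E where "E = topspace (Euclidean_space m) \<inter> {a. meval a h \<noteq> 0}"
  have E: "a \<in> E \<longleftrightarrow> (\<forall>i\<ge>m. a i = 0) \<and> meval a h \<noteq> 0" for a
    by (auto simp: E_def topspace_Euclidean_space)
  have top: "subtopology (Euclidean_space m) {a. meval a h \<noteq> 0} = subtopology euclidean E"
    unfolding E_def topspace_Euclidean_space
    by (simp add: Euclidean_space_def subtopology_subtopology euclidean_product_topology)
  have comp: "C \<in> connected_components_of (subtopology euclidean E)"
    using C by (simp add: open_cells_def top)
  have "connectedin (subtopology euclidean E) C" using comp by (rule connectedin_connected_components_of)
  then have connC: "connected C" and CE: "C \<subseteq> E" by (auto simp: connectedin_subtopology)
  show "C \<noteq> {}" using nonempty_connected_components_of[OF comp] .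
  have max: "K \<subseteq> C" if "connected K" "K \<subseteq> E" "K \<inter> C \<noteq> {}" for K
    using connected_components_of_maximal[OF comp, of K] that
    by (auto simp: connectedin_subtopology disjnt_def)
  have idC: "trunc m a = a" if "a \<in> C" for a using that CE by (intro trunc_id) (auto simp: E)
  show "L \<subseteq> {a. meval a h \<noteq> 0}"
    using CE meval_trunc[OF h] by (auto simp: L_def E)
  have sat: "K \<subseteq> L" if "connected K" "K \<subseteq> {a. meval a h \<noteq> 0}" "K \<inter> L \<noteq> {}" for K
  proof -
    have "trunc m ` K \<subseteq> C"
    proof (rule max)
      show "connected (trunc m ` K)" using that(1) continuous_trunc by (rule connected_continuous_image[rotated])
      show "trunc m ` K \<subseteq> E" using that(2) meval_trunc[OF h] by (auto simp: E) (auto simp: trunc_def)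
      show "trunc m ` K \<inter> C \<noteq> {}" using that(3) by (auto simp: L_def)
    qed
    then show ?thesis by (auto simp: L_def)
  qed
  moreover have "open L"
  proof (subst open_subopen, intro ballI)
    fix a assume a: "a \<in> L"
    have "open {a. meval a h \<noteq> 0}" "a \<in> {a. meval a h \<noteq> 0}"
      using open_meval_nonzero a \<open>L \<subseteq> {a. meval a h \<noteq> 0}\<close> by auto
    then obtain I r where I: "finite I" "r > 0" "pbox a I r \<subseteq> {a. meval a h \<noteq> 0}"
      by (rule open_contains_pbox)
    have "a \<in> pbox a I r \<inter> L" using a center_in_pbox[OF I(2)] by simp
    then have "pbox a I r \<subseteq> L" using I(3) connected_pbox by (intro sat) auto
    then show "\<exists>T. open T \<and> a \<in> T \<and> T \<subseteq> L"
      by (intro exI[of _ "pbox a I r"] conjI open_pbox center_in_pbox I)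
  qed
  ultimately show "saturated h L" by (auto simp: saturated_def)
  have CL: "C \<subseteq> L" using idC by (auto simp: L_def)
  show "C = L \<inter> topspace (Euclidean_space m)"
  proof
    show "C \<subseteq> L \<inter> topspace (Euclidean_space m)" using CL CE by (auto simp: E_def)
    show "L \<inter> topspace (Euclidean_space m) \<subseteq> C"
      using trunc_id by (auto simp: L_def topspace_Euclidean_space)
  qed
  show "connected L"
    unfolding connected_iff_connected_component
  proof (intro ballI)
    fix a b assume ab: "a \<in> L" "b \<in> L"
    have vert: "connected_component L c (trunc m c)" if "c \<in> L" for c
    proof (rule connected_component_line)
      fix t :: real
      have "trunc m (line c (trunc m c) t) = trunc m c" by (auto simp: trunc_def line_def)
      then show "line c (trunc m c) t \<in> L" using that by (simp add: L_def)
    qed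
    have "connected_component L (trunc m a) (trunc m b)"
      unfolding connected_component_def using connC CL ab by (auto simp: L_def)
    then show "connected_component L a b"
      using vert ab by (meson connected_component_sym connected_component_trans)
  qed
qed

lemma varlist_Suc: "varlist n (Suc k) = rev [k..<n]"
  by (simp add: varlist_def)

lemma remove1_rev_upt: "k < n \<Longrightarrow> remove1 k (rev [k..<n]) = rev [Suc k..<n]"
  by (simp add: upt_conv_Cons remove1_append)

text \<open>The invariant of the sampling: the sample point \<open>\<beta>\<close> in dimension \<open>k\<close> lies in a region \<open>W\<close> that meets the
  cell \<open>V\<close> and to which \<open>projection_dense\<close> applies.\<close>

definition tracks :: "mpoly \<Rightarrow> nat \<Rightarrow> (nat \<Rightarrow> real) set \<Rightarrow> nat \<Rightarrow> (nat \<Rightarrow> real) \<Rightarrow> (nat \<Rightarrow> real) set \<Rightarrow> bool" where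
  "tracks f n V k \<beta> W \<longleftrightarrow> (\<forall>i\<ge>k. \<beta> i = 0) \<and> \<beta> \<in> W \<and> open W \<and> connected W \<and> cylindrical {k..<n} W \<and>
    (\<forall>a\<in>W. meval a (Np0 f (rev [k..<n])) \<noteq> 0) \<and>
    (\<forall>y\<in>{k..<n}. \<forall>g\<in>Np1 f y. semidefinite_on g W) \<and> W \<inter> V \<noteq> {} \<and>
    (k < n \<longrightarrow> meval \<beta> (Np_wrt f (rev [k..<n]) k) \<noteq> 0)"

text \<open>Density gives points of V over any box around \<beta>; about the fibre over \<beta>
  itself nothing is known yet. Regularity at \<beta> provides a sector \<open>W'\<close> over the
  box that meets V and contains \<open>\<beta>(k := t)\<close>. The interval of the fibre around t
  is connected, so it stays in \<open>W'\<close>, and the sample meets it. The condition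
  \<open>Suc k < n\<close> on q reflects that \<open>tracks\<close> asks for a nonzero
  \<open>Np_wrt\<close> only below dimension n.\<close>

lemma tracks_step:
  assumes V: "saturated f V" and "f \<noteq> 0" and "k < n" and disc: "\<And>y. y \<in> {k..<n} \<Longrightarrow> discrim f y \<noteq> 0"
    and tr: "tracks f n V k \<beta> W"
    and T: "open_sample_nz euclideanreal (\<lambda>x. meval (\<beta>(k := x)) (Np0 f (rev [Suc k..<n])))
      (\<lambda>x. meval (\<beta>(k := x)) q) T"
    and q: "Suc k < n \<Longrightarrow> q = Np_wrt f (rev [Suc k..<n]) (Suc k)"
  shows "\<exists>x\<in>T. \<exists>W'. tracks f n V (Suc k) (\<beta>(k := x)) W'"
proof -
  let ?ys = "rev [k..<n]" and ?zs = "rev [Suc k..<n]"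
  define g where "g = Np0 f ?zs"
  have sets: "set ?ys = {k..<n}" "set ?zs = {k..<n} - {k}" by auto
  have rem: "remove1 k ?ys = ?zs" using \<open>k < n\<close> by (rule remove1_rev_upt)
  have k: "k \<in> {k..<n}" using \<open>k < n\<close> by simp
  have W: "\<beta> \<in> W" "open W" "connected W" "cylindrical {k..<n} W" "W \<inter> V \<noteq> {}"
    "\<And>a. a \<in> W \<Longrightarrow> meval a (Np0 f ?ys) \<noteq> 0"
    "\<And>y g. y \<in> {k..<n} \<Longrightarrow> g \<in> Np1 f y \<Longrightarrow> semidefinite_on g W"
    and \<beta>: "meval \<beta> (Np_wrt f ?ys k) \<noteq> 0" "\<forall>i\<ge>k. \<beta> i = 0"
    using tr \<open>k < n\<close> unfolding tracks_def by auto
  have "meval \<beta> (Np f ?ys) \<noteq> 0" using W(6)[OF W(1)] \<open>k < n\<close> by (simp add: Np0_def)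
  then have "\<exists>q. regular_at q k \<beta> \<and> (\<forall>b. meval b q = 0 \<longleftrightarrow> meval b g = 0) \<and> mvars q \<subseteq> mvars g"
    using Np0_regular[of k ?ys f \<beta>] \<beta>(1) disc k \<open>f \<noteq> 0\<close> unfolding rem g_def by simp
  then obtain r where r: "regular_at r k \<beta>" "\<And>b. meval b r = 0 \<longleftrightarrow> meval b g = 0" "mvars r \<subseteq> mvars g" by blast
  have g: "g \<noteq> 0" "mvars g \<inter> ({k..<n} - {k}) = {}"
    using Np0_props[of ?zs f] disc \<open>f \<noteq> 0\<close> unfolding g_def sets by auto
  obtain B where B: "open B" "\<beta> \<in> B" "B \<subseteq> W" "cylindrical {k..<n} B" and
    sec: "\<And>b. b \<in> B \<Longrightarrow> meval b g \<noteq> 0 \<Longrightarrow> \<exists>W t. open W \<and> connected W \<and> b \<in> W \<and> W \<subseteq> B \<inter> {c. meval c g \<noteq> 0} \<and>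
      cylindrical ({k..<n} - {k}) W \<and> (\<forall>c\<in>B. c(k := t) \<in> W) \<and>
      (\<forall>C. connected C \<longrightarrow> C \<subseteq> B \<inter> {c. meval c g \<noteq> 0} \<longrightarrow> C \<inter> W \<noteq> {} \<longrightarrow> C \<subseteq> W)"
    by (rule sector_exists[OF r g(2) k W(2,4,1)]) blast
  have "B \<inter> V \<noteq> {}"
    by (rule projection_dense[OF V \<open>f \<noteq> 0\<close>, of ?ys W]) (use disc W B in auto)
  then obtain b0 where "b0 \<in> B \<inter> V" by blast
  from nonzero_dense[OF g(1) open_Int[OF B(1)] this] V
  obtain b where b: "b \<in> B" "b \<in> V" "meval b g \<noteq> 0" by (auto simp: saturated_def)
  from sec[OF b(1,3)] obtain W' t where W': "open W'" "connected W'" "b \<in> W'" "W' \<subseteq> B \<inter> {c. meval c g \<noteq> 0}"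
    "cylindrical ({k..<n} - {k}) W'" "\<forall>c\<in>B. c(k := t) \<in> W'"
    "\<And>C. connected C \<Longrightarrow> C \<subseteq> B \<inter> {c. meval c g \<noteq> 0} \<Longrightarrow> C \<inter> W' \<noteq> {} \<Longrightarrow> C \<subseteq> W'" by (elim exE conjE) blast
  define G where "G = {x. meval (\<beta>(k := x)) g \<noteq> 0}"
  define C where "C = connected_component_of_set (subtopology euclideanreal G) t"
  have "t \<in> G" using W'(4,6) B(2) by (auto simp: G_def)
  then have "C \<in> open_cells euclideanreal (\<lambda>x. meval (\<beta>(k := x)) g)"
    unfolding open_cells_def connected_components_of_def C_def G_def[symmetric] by simp
  then obtain x where x: "x \<in> T" "x \<in> C"
    using T unfolding open_sample_nz_def open_sample_def g_def by blast
  have "connectedin (subtopology euclideanreal G) C"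
    unfolding C_def by (rule connectedin_connected_component_of)
  then have C: "connected C" "C \<subseteq> G" by (auto simp: connectedin_subtopology)
  have updB: "\<beta>(k := v) \<in> B" for v
    by (rule cylindricalD[OF B(4,2)]) (use k in auto)
  have "(\<lambda>x. \<beta>(k := x)) ` C \<subseteq> W'"
  proof (rule W'(7))
    have "continuous_on C (\<lambda>t. (\<beta>(k := t)) i)" for i by (cases "i = k") auto
    then show "connected ((\<lambda>x. \<beta>(k := x)) ` C)"
      using C(1) by (intro connected_continuous_image continuous_on_coordinatewise_then_product)
    show "(\<lambda>x. \<beta>(k := x)) ` C \<subseteq> B \<inter> {c. meval c g \<noteq> 0}"
      using updB C(2) by (auto simp: G_def)
    have "t \<in> C" using \<open>t \<in> G\<close> by (simp add: C_def connected_component_of_refl)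
    then show "(\<lambda>x. \<beta>(k := x)) ` C \<inter> W' \<noteq> {}" using W'(6) B(2) by blast
  qed
  then have "\<beta>(k := x) \<in> W'" using x by blast
  moreover have "{k..<n} - {k} = {Suc k..<n}" by auto
  moreover have "Suc k < n \<Longrightarrow> meval (\<beta>(k := x)) (Np_wrt f ?zs (Suc k)) \<noteq> 0"
    using T x q unfolding open_sample_nz_def by auto
  moreover have "semidefinite_on h W'" if "y \<in> {Suc k..<n}" "h \<in> Np1 f y" for y h
    using W(7)[of y h] that W'(4) B(3) unfolding semidefinite_on_def by auto
  ultimately have "tracks f n V (Suc k) (\<beta>(k := x)) W'"
    using W' b \<beta>(2) unfolding tracks_def g_def by auto
  then show ?thesis using x by blast
qed

text \<open>\<open>OpenSP\<close> is built from dimension l upwards, so the lists are those of the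
  theorem cut off at dimension k. At i = n both entries are f, since \<open>Np0\<close> of the empty
  list of variables is f.\<close>

lemma OpenSP_tracks:
  assumes V: "saturated f V" and "f \<noteq> 0" and disc: "\<And>y. y \<in> {l..<n} \<Longrightarrow> discrim f y \<noteq> 0"
    and start: "tracks f n V l \<alpha> W0"
    and "OpenSP l {\<alpha>} L1 L2 A"
    and "L1 = map (\<lambda>i. Np0 f (rev [i..<n])) (rev [l..<Suc k])"
    and "L2 = map (\<lambda>i. if i = n then f else Np_wrt f (rev [i..<n]) i) (rev [l..<Suc k])"
    and "l \<le> k" "k \<le> n"
  shows "\<exists>\<beta>\<in>A. \<exists>W. tracks f n V k \<beta> W"
  using assms(5-)
proof (induction arbitrary: k rule: OpenSP.induct)
  case (base p q)
  have "length [p] = Suc k - l" using base(1) by (metis length_map length_rev length_upt)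
  then have "k = l" using \<open>l \<le> k\<close> by simp
  then show ?case using start by auto
next
  case (step L1 L2 B k' p q Tf)
  have len: "length L1 = k - l" using step.prems(1,3) by (metis Suc_diff_le length_Cons length_map length_rev length_upt nat.inject)
  have "length L1 > 0" using step.hyps(1) by cases auto
  then have kl: "l < k" using len by simp
  have k': "Suc k' = k" using step.hyps(2) len kl by simp
  have split: "rev [l..<Suc k] = k # rev [l..<Suc k']" using kl k' by simp
  have *: "p = Np0 f (rev [k..<n])" "q = (if k = n then f else Np_wrt f (rev [k..<n]) k)"
    using step.prems(1,2) unfolding split by auto
  have "\<exists>\<beta>\<in>B. \<exists>W. tracks f n V k' \<beta> W"
    by (rule step.IH) (use step.prems kl k' split in auto)
  then obtain \<beta> W where \<beta>: "\<beta> \<in> B" "tracks f n V k' \<beta> W" by blast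
  have "\<exists>x\<in>Tf \<beta>. \<exists>W'. tracks f n V (Suc k') (\<beta>(k' := x)) W'"
  proof (rule tracks_step[OF V \<open>f \<noteq> 0\<close> _ _ \<beta>(2)])
    show "k' < n" using k' step.prems by simp
    show "discrim f y \<noteq> 0" if "y \<in> {k'..<n}" for y using that disc kl k' by auto
    show "open_sample_nz euclideanreal (\<lambda>x. meval (\<beta>(k' := x)) (Np0 f (rev [Suc k'..<n])))
      (\<lambda>x. meval (\<beta>(k' := x)) q) (Tf \<beta>)"
      using step.hyps(3)[OF \<beta>(1)] unfolding * k' .
    show "q = Np_wrt f (rev [Suc k'..<n]) (Suc k')" if "Suc k' < n" using that * k' by simp
  qed
  then show ?case using \<beta>(1) k' by blast
qed

lemma rev_upt_shift: "rev [Suc l..<Suc m] = map Suc (rev [l..<m])"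
  by (simp only: map_Suc_upt[symmetric] rev_map)

text \<open>The variable x_t has index \<open>t - 1\<close>, and polynomials free of x_{n-i} are
  tested on points whose coordinate \<open>n - i - 1\<close> is 0. \<open>discrim_nz\<close>
  excludes a zero discriminant: \<open>sqrf1\<close> and \<open>sqrf2\<close> turn 0 into {1}, so
  its vanishing would leave no trace in the projections.\<close>

theorem theorem5:
  fixes n j :: nat and f :: mpoly and U S :: "(nat \<Rightarrow> real) set"
  assumes j: "2 \<le> j" "j \<le> n"
    and f: "mvars f \<subseteq> {..<n}"
    and discrim_nz: "\<forall>t\<in>{j..n}. discrim f (t - 1) \<noteq> 0"
    and U: "U \<in> open_cells (Euclidean_space (j - 1)) (\<lambda>a. meval a (Np f (varlist n j)))"
    and S: "S = U - Zeros ((\<lambda>t. Np_wrt f (varlist n j) (t - 1)) ` {j..n})"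
    and semidef: "\<forall>i\<in>{0..n - j}. \<forall>g\<in>Np1 f (n - i - 1).
        semidefinite_on g {a \<in> cyl (j - 1) n U. a (n - i - 1) = 0}"
  shows "open_delineable n (j - 1) (j - 1) f S (Np_bar n f j) (Np_tilde n f j)"
proof -
  define l where "l = j - 1"
  have j_l: "j = Suc l" "l < n" "j - 1 = l" using j by (auto simp: l_def)
  have ys: "varlist n j = rev [l..<n]" by (simp add: j_l varlist_Suc)
  have disc: "discrim f y \<noteq> 0" if "y \<in> {l..<n}" for y
    using discrim_nz[rule_format, of "Suc y"] that j_l by auto
  have ne: "rev [l..<n] \<noteq> []" using j_l by simp
  have mNp: "mvars (Np f (rev [l..<n])) \<subseteq> {..<l}"
  proof -
    have "mvars (Np f (rev [l..<n])) \<subseteq> mvars f - set (rev [l..<n])"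
      by (rule Np_props(2)[OF ne]) (use disc in auto)
    moreover have "{..<n} - set (rev [l..<n]) \<subseteq> {..<l}" by auto
    ultimately show ?thesis using f by blast
  qed
  note U' = U[unfolded ys j_l(3)]
  define LU where "LU = trunc l -` U"
  note LU = open_cell_lift[OF U' mNp, folded LU_def]
  \<comment> \<open>The hypothesis concerns points of R^n with y-coordinate 0. As g involves neither
    y nor coordinates from n on, every value of g on LU is attained at such a point.\<close>
  have semi: "semidefinite_on g LU" if y: "y \<in> {l..<n}" and g: "g \<in> Np1 f y" for y g
  proof -
    define i where "i = n - y - 1"
    have i: "i \<in> {0..n - j}" "n - i - 1 = y" using y j_l by (auto simp: i_def)
    then have semi: "semidefinite_on g {a \<in> cyl l n U. a y = 0}"
      using semidef g j_l by auto
    have free: "mvars g \<subseteq> mvars f - {y}"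
      using Ocd_Ecd_props(4)[OF disc[OF y]] g by (auto simp: Np1_def)
    have "\<exists>b\<in>{a \<in> cyl l n U. a y = 0}. meval b g = meval a g" if a: "a \<in> LU" for a
    proof
      let ?b = "(trunc n a)(y := 0)"
      show "meval ?b g = meval a g"
        by (rule meval_cong) (use free f in \<open>auto simp: trunc_def\<close>)
      have "(\<lambda>i. if i < l then ?b i else 0) = trunc l a"
        using y j_l by (auto simp: trunc_def)
      then show "?b \<in> {a \<in> cyl l n U. a y = 0}"
        using a y by (simp add: cyl_def topspace_Euclidean_space LU_def) (simp add: trunc_def)
    qed
    then show ?thesis using semi unfolding semidefinite_on_def by fastforce
  qed
  have Sl: "S = U - Zeros (Np_wrt f (rev [l..<n]) ` {l..<n})"
  proof -
    have "(\<lambda>t. t - 1) ` {j..n} = {l..<n}"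
      using j_l by (auto simp: image_iff intro!: bexI[of _ "Suc _"])
    then have "(\<lambda>t. Np_wrt f (rev [l..<n]) (t - 1)) ` {j..n} = Np_wrt f (rev [l..<n]) ` {l..<n}"
      by (metis image_image)
    then show ?thesis by (simp add: S ys)
  qed
  have openS: "openin (Euclidean_space l) S"
  proof -
    have "open (LU - Zeros (Np_wrt f (rev [l..<n]) ` {l..<n}))"
      using LU(1) Zeros_closed by (auto simp: saturated_def)
    moreover have "S = topspace (Euclidean_space l) \<inter> (LU - Zeros (Np_wrt f (rev [l..<n]) ` {l..<n}))"
      using LU(4) Sl by blast
    ultimately show ?thesis
      unfolding Euclidean_space_def topspace_Euclidean_space[unfolded Euclidean_space_def]
      by (auto simp: euclidean_product_topology openin_subtopology)
  qed
  have upt: "rev [l..<Suc n] = n # rev [l..<n]" using j_l by simp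
  have shift: "rev [j..<n + 1] = map Suc (rev [l..<n])" by (simp only: j_l(1) Suc_eq_plus1[symmetric] rev_upt_shift)
  have bar: "Np_bar n f j = map (\<lambda>i. Np0 f (rev [i..<n])) (rev [l..<Suc n])"
    unfolding Np_bar_def shift upt by (auto simp: Np0_def varlist_Suc)
  have tilde: "Np_tilde n f j = map (\<lambda>i. if i = n then f else Np_wrt f (rev [i..<n]) i) (rev [l..<Suc n])"
    unfolding Np_tilde_def shift upt by (auto simp: varlist_Suc)
  have last: "last (map F (rev [l..<Suc n])) = F l" for F :: "nat \<Rightarrow> mpoly"
    using j_l by (simp add: last_map last_rev del: upt_Suc)
  have main: "A \<inter> V \<noteq> {}"
    if V: "V \<in> open_cells (Euclidean_space n) (\<lambda>a. meval a f)"
      and VS: "V \<inter> cyl l n (cyl l l S) \<noteq> {}" and \<alpha>: "\<alpha> \<in> cyl l l S"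
      and nz: "meval \<alpha> (last (Np_bar n f j)) * meval \<alpha> (last (Np_tilde n f j)) \<noteq> 0"
      and A: "OpenSP l {\<alpha>} (Np_bar n f j) (Np_tilde n f j) A" for V \<alpha> A
  proof -
    define LV where "LV = trunc n -` V"
    note LV = open_cell_lift[OF V f, folded LV_def]
    \<comment> \<open>A cell is nonempty, so the existence of V rules out f = 0.\<close>
    have "f \<noteq> 0" using LV(3,4,5) by auto
    obtain v where v: "v \<in> V" "v \<in> cyl l n (cyl l l S)" using VS by blast
    then have "trunc l (trunc l v) \<in> S" by (auto simp: cyl_def trunc_def[abs_def])
    moreover have "trunc l (trunc l v) = trunc l v" by (auto simp: trunc_def)
    ultimately have "v \<in> LU \<inter> LV" using v(1) LV(4) by (auto simp: LU_def S)
    have E: "\<forall>i\<ge>l. \<alpha> i = 0" using \<alpha> by (auto simp: cyl_def topspace_Euclidean_space)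
    have "trunc l \<alpha> \<in> S" using \<alpha> by (auto simp: cyl_def trunc_def[abs_def])
    then have "\<alpha> \<in> LU" by (auto simp: LU_def S)
    have wrt: "meval \<alpha> (Np_wrt f (rev [l..<n]) l) \<noteq> 0"
      using nz j_l unfolding bar tilde last by auto
    have "tracks f n LV l \<alpha> LU"
      unfolding tracks_def
      using E \<open>\<alpha> \<in> LU\<close> LU(1,2,3) semi \<open>v \<in> LU \<inter> LV\<close> wrt ne
      by (auto simp: saturated_def Np0_def cylindrical_def LU_def trunc_def cong: if_cong)
    from OpenSP_tracks[OF LV(1) \<open>f \<noteq> 0\<close> disc this A bar tilde]
    obtain \<beta> W where \<beta>: "\<beta> \<in> A" "tracks f n LV n \<beta> W"
      using j_l(2) by auto
    \<comment> \<open>Once all variables are sampled, \<open>Np0 f []\<close> is f: W is a connected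
      set without zeros of f that meets the cell, hence lies in it.\<close>
    then have W: "\<beta> \<in> W" "connected W" "W \<subseteq> {a. meval a f \<noteq> 0}" "W \<inter> LV \<noteq> {}" "\<forall>i\<ge>n. \<beta> i = 0"
      by (auto simp: tracks_def Np0_def)
    then have "W \<subseteq> LV" using LV(1) by (auto simp: saturated_def)
    then have "\<beta> \<in> V" using W LV(4) by (auto simp: topspace_Euclidean_space)
    then show ?thesis using \<beta>(1) by blast
  qed
  have "length (Np_bar n f j) = n - l + 1" "length (Np_tilde n f j) = n - l + 1"
    using j_l by (simp_all add: Np_bar_def Np_tilde_def)
  then show ?thesis
    unfolding open_delineable_def j_l(3) using openS main j_l by (auto simp: Np_bar_def)
qed

end
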